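(* Let $M$ be a connected matroid of rank $4$ on a finite set $E$, with no loops and no pair of parallel elements. Let $L_1,L_2,\dots$ be the flats of rank $2$ of $M$ and $P_1,P_2,\dots$ those of rank $3$. Then $$\begin{aligned}\omega(M)={}&\binom{|E|-5}{3}-\sum_j\binom{|P_j|-3}{3}-\sum_i\binom{|L_i|-2}{2}\Big(|E|-\tfrac23|L_i|-\tfrac{13}{3}\Big)\\&+\sum_{L_i\subset P_j}\binom{|L_i|-2}{2}\Big(|P_j|-\tfrac23|L_i|-\tfrac73\Big),\end{aligned}$$ where the last sum is over all pairs $(i,j)$ with $L_i\subset P_j$.
   Context: Let $M$ be a matroid of rank $r$ on a finite set $E$, $|E|=n$, and let $c(M)$ be its number of connected components. Speyer's $g$-polynomial $g_M(t)\in\mathbb Z[t]$ is given as follows (in the form of Berget–Eur–Spink–Tseng, equivalent to the original $K$-theoretic definition). If $E=\emptyset$, $g_M=1$. If $M$ has a loop or a coloop, $g_M=0$. Otherwise, for each total ordering $w=(w_1,\dots,w_n)$ of $E$, let $B_w$ be the basis with $w_k\in B_w$ iff $\operatorname{rank}\{w_1,\dots,w_k\}>\operatorname{rank}\{w_1,\dots,w_{k-1}\}$. In $\mathbb Z[z_e:e\in E]$, let $x^w$ be the list of the $z_b$, $b\in B_w$; let $y^w$ be the list of the $-z_c$, $c\in E\setminus B_w$; let $\alpha^w=-z_{w_n}$. For a family $f=(f_w)_w$ put $\deg f=\sum_w f_w/\prod_{i=1}^{n-1}(z_{w_i}-z_{w_{i+1}})$. With $\boldsymbol e_k$ the $k$-th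 elementary symmetric polynomial, $$g_M(t)=(-1)^{c(M)}\sum_{i=1}^{r}(-t)^i\sum_{j=0}^{i-1}\deg\big(\alpha^j\,\boldsymbol e_{i-j-1}(-y)\,\boldsymbol e_{r-i}(x)\,\boldsymbol e_{n-r}(y)\big).$$ $\omega(M)$ is the coefficient of $t^r$ in $g_M(t)$. *)

theory Defs
  imports
    Complex_Main
    "HOL-Library.Poly_Mapping"
    "HOL-Combinatorics.Multiset_Permutations"
    "HOL-Computational_Algebra.Polynomial"
    "HOL-Computational_Algebra.Fraction_Field"
begin

section \<open>Matroids\<close>

locale matroid =
  fixes E :: "'a set" and \<I> :: "'a set set"
  assumes finite_ground: "finite E"
    and indep_ground: "I \<in> \<I> \<Longrightarrow> I \<subseteq> E"
    and indep_empty: "{} \<in> \<I>"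
    and indep_mono: "I \<in> \<I> \<Longrightarrow> J \<subseteq> I \<Longrightarrow> J \<in> \<I>"
    and indep_augment:
      "I \<in> \<I> \<Longrightarrow> J \<in> \<I> \<Longrightarrow> card I < card J \<Longrightarrow> \<exists>x\<in>J - I. insert x I \<in> \<I>"

definition mat_rank :: "'a set set \<Rightarrow> 'a set \<Rightarrow> nat"
  where "mat_rank \<I> X = Max {card I | I. I \<in> \<I> \<and> I \<subseteq> X}"

definition mat_basis :: "'a set set \<Rightarrow> 'a set \<Rightarrow> bool"
  where "mat_basis \<I> B \<longleftrightarrow> B \<in> \<I> \<and> (\<forall>J\<in>\<I>. B \<subseteq> J \<longrightarrow> J = B)"

definition mat_circuit :: "'a set \<Rightarrow> 'a set set \<Rightarrow> 'a set \<Rightarrow> bool"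
  where "mat_circuit E \<I> C \<longleftrightarrow> C \<subseteq> E \<and> C \<notin> \<I> \<and> (\<forall>D. D \<subset> C \<longrightarrow> D \<in> \<I>)"

definition mat_loop :: "'a set \<Rightarrow> 'a set set \<Rightarrow> 'a \<Rightarrow> bool"
  where "mat_loop E \<I> e \<longleftrightarrow> e \<in> E \<and> {e} \<notin> \<I>"

definition mat_coloop :: "'a set \<Rightarrow> 'a set set \<Rightarrow> 'a \<Rightarrow> bool"
  where "mat_coloop E \<I> e \<longleftrightarrow> e \<in> E \<and> (\<forall>B. mat_basis \<I> B \<longrightarrow> e \<in> B)"

definition mat_parallel :: "'a set \<Rightarrow> 'a set set \<Rightarrow> 'a \<Rightarrow> 'a \<Rightarrow> bool"
  where "mat_parallel E \<I> e f \<longleftrightarrow> e \<noteq> f \<and> mat_circuit E \<I> {e, f}"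

definition mat_flat :: "'a set \<Rightarrow> 'a set set \<Rightarrow> 'a set \<Rightarrow> bool"
  where "mat_flat E \<I> F \<longleftrightarrow>
    F \<subseteq> E \<and> (\<forall>e\<in>E - F. mat_rank \<I> (insert e F) > mat_rank \<I> F)"

definition flats_of_rank :: "'a set \<Rightarrow> 'a set set \<Rightarrow> nat \<Rightarrow> 'a set set"
  where "flats_of_rank E \<I> k = {F. mat_flat E \<I> F \<and> mat_rank \<I> F = k}"

definition mat_components :: "'a set \<Rightarrow> 'a set set \<Rightarrow> 'a set set"
  where "mat_components E \<I> =
    E // {(e, f). e \<in> E \<and> f \<in> E \<and> (e = f \<or> (\<exists>C. mat_circuit E \<I> C \<and> e \<in> C \<and> f \<in> C))}"

definition mat_connected :: "'a set \<Rightarrow> 'a set set \<Rightarrow> bool"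
  where "mat_connected E \<I> \<longleftrightarrow> card (mat_components E \<I>) = 1"


section \<open>The field of rational functions in the variables \<open>z\<^sub>e\<close>\<close>

text \<open>
  \<^theory>\<open>HOL-Library.Poly_Mapping\<close> makes polynomials an integral domain only if the indices
  of the variables are linearly ordered. The type \<open>'a var\<close> is a copy of \<open>'a\<close> with
  an arbitrarily chosen linear order; the order serves only to obtain that instance.
\<close>

typedef 'a var = "UNIV :: 'a set"
  morphisms var_index Var ..

definition var_order :: "'a rel"
  where "var_order = (SOME r. linear_order r)"

lemma linear_order_var_order: "linear_order (var_order :: 'a rel)"
proof -
  obtain r :: "'a rel" where "well_order_on UNIV r"
    using well_order_on by blast
  then have "linear_order r"
    by (simp add: well_order_on_def)
  then show ?thesis
    unfolding var_order_def by (rule someI)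
qed

instantiation var :: (type) linorder
begin

definition less_eq_var :: "'a var \<Rightarrow> 'a var \<Rightarrow> bool"
  where "x \<le> y \<longleftrightarrow> (var_index x, var_index y) \<in> var_order"

definition less_var :: "'a var \<Rightarrow> 'a var \<Rightarrow> bool"
  where "x < y \<longleftrightarrow> x \<le> y \<and> \<not> y \<le> (x :: 'a var)"

instance
proof
  have *: "refl (var_order :: 'a rel)" "trans (var_order :: 'a rel)"
    "antisym (var_order :: 'a rel)" "total (var_order :: 'a rel)"
    using linear_order_var_order[where 'a = 'a]
    by (auto simp: linear_order_on_def partial_order_on_def preorder_on_def)
  fix x y z :: "'a var"
  show "x < y \<longleftrightarrow> x \<le> y \<and> \<not> y \<le> x"
    by (rule less_var_def)
  show "x \<le> x"
    using *(1) by (simp add: less_eq_var_def refl_on_def)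
  show "x \<le> y \<Longrightarrow> y \<le> z \<Longrightarrow> x \<le> z"
    using *(2) unfolding less_eq_var_def by (rule transD)
  show "x \<le> y \<Longrightarrow> y \<le> x \<Longrightarrow> x = y"
    using *(3) unfolding less_eq_var_def by (metis antisymD var_index_inject)
  show "x \<le> y \<or> y \<le> x"
    using *(1,4) unfolding less_eq_var_def total_on_def refl_on_def by (metis UNIV_I)
qed

end

type_synonym 'a mpoly = "('a var \<Rightarrow>\<^sub>0 nat) \<Rightarrow>\<^sub>0 int"
type_synonym 'a ratfun = "'a mpoly fract"

lemma of_nat_fract: "(of_nat n :: 'b::idom fract) = Fraction_Field.Fract (of_nat n) 1"
  by (induction n) (simp_all add: Zero_fract_def One_fract_def)

instance fract :: ("{idom, ring_char_0}") field_char_0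
proof
  show "inj (of_nat :: nat \<Rightarrow> 'a fract)"
    by (rule injI) (simp add: of_nat_fract eq_fract)
qed

definition zvar :: "'a \<Rightarrow> 'a ratfun"
  where "zvar e =
    Fraction_Field.Fract (Poly_Mapping.single (Poly_Mapping.single (Var e) 1) 1) 1"


section \<open>Speyer's \<open>g\<close>-polynomial\<close>

definition esym :: "nat \<Rightarrow> 'b set \<Rightarrow> ('b \<Rightarrow> 'c) \<Rightarrow> 'c::comm_ring_1"
  where "esym k A u = (\<Sum>S | S \<subseteq> A \<and> card S = k. \<Prod>s\<in>S. u s)"

text \<open>Lists are indexed from \<open>0\<close>: \<open>w ! k\<close> is the mathematical \<open>w\<^sub>k\<^sub>+\<^sub>1\<close>.\<close>

definition greedy_basis :: "'a set set \<Rightarrow> 'a list \<Rightarrow> 'a set"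
  where "greedy_basis \<I> w =
    {w ! k | k. k < length w \<and>
      mat_rank \<I> (set (take (Suc k) w)) > mat_rank \<I> (set (take k w))}"

definition eq_deg :: "'a set \<Rightarrow> ('a list \<Rightarrow> 'a ratfun) \<Rightarrow> 'a ratfun"
  where "eq_deg E f =
    (\<Sum>w\<in>permutations_of_set E. f w / (\<Prod>k<card E - 1. zvar (w ! k) - zvar (w ! Suc k)))"

definition g_summand :: "'a set \<Rightarrow> 'a set set \<Rightarrow> nat \<Rightarrow> nat \<Rightarrow> 'a list \<Rightarrow> 'a ratfun"
  where "g_summand E \<I> i j w =
    (let B = greedy_basis \<I> w;
         r = mat_rank \<I> E;
         x = zvar;
         y = (\<lambda>c. - zvar c);
         \<alpha> = - zvar (last w)
     in \<alpha> ^ j * esym (i - j - 1) (E - B) (\<lambda>c. - y c) * esym (r - i) B x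
          * esym (card E - r) (E - B) y)"

text \<open>
  The values of \<^const>\<open>eq_deg\<close> used below are integers, but this is a theorem about matroids.
  The coefficients of the \<open>g\<close>-polynomial are therefore kept in the field of rational functions,
  which contains the integers.
\<close>

definition g_poly :: "'a set \<Rightarrow> 'a set set \<Rightarrow> 'a ratfun poly"
  where "g_poly E \<I> =
    (if E = {} then 1
     else if \<exists>e. mat_loop E \<I> e \<or> mat_coloop E \<I> e then 0
     else (- 1) ^ card (mat_components E \<I>) *
       (\<Sum>i = 1..mat_rank \<I> E.
         smult (\<Sum>j = 0..i - 1. eq_deg E (g_summand E \<I> i j)) ((- monom 1 1) ^ i)))"

definition omega :: "'a set \<Rightarrow> 'a set set \<Rightarrow> 'a ratfun"
  where "omega E \<I> = Polynomial.coeff (g_poly E \<I>) (mat_rank \<I> E)"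

end

theory Submission
  imports Defs
begin

text \<open>
  Only \<open>i = r\<close> contributes to the coefficient of \<open>t^r\<close>, and summing over \<open>j\<close> removes the variable of
  \<open>w\<^sub>n\<close> from the elementary symmetric function. So \<open>\<omega>(M)\<close> is, up to sign and for a new variable \<open>t\<close>, the coefficient of \<open>t^3\<close> in the
  sum over all orderings \<open>w\<close> of
  \<open>W(E) \<phi>(z\<^sub>1) \<phi>(z\<^sub>2) \<phi>(z\<^sub>p) \<phi>(z\<^sub>q) \<psi>(z\<^sub>n) / ((z\<^sub>1 - z\<^sub>2) \<cdots> (z\<^sub>n\<^sub>-\<^sub>1 - z\<^sub>n))\<close>, where \<open>1, 2, p, q\<close> are the
  positions of \<open>B\<^sub>w\<close> in \<open>w\<close>, \<open>\<psi>(z) = 1 / (1 + tz)\<close>, \<open>\<phi>(z) = \<psi>(z) / z\<close> and \<open>W\<close> is the product of all \<open>1 / \<phi>\<close>.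

  Since \<open>\<phi>(y) - \<phi>(x) = (x - y) (1 / xy - t\<^sup>2 \<psi>(x) \<psi>(y))\<close>, moving \<open>q\<close> (or \<open>p\<close>) across a gap of \<open>w\<close> cancels
  the denominator at that gap, and the orderings of the elements before and after it can be summed
  independently. Telescoping \<open>p\<close> and \<open>q\<close> down to \<open>3\<close> and \<open>4\<close> therefore writes the sum as the value for
  the uniform matroid, plus a term for each \<open>S\<close> of rank at most \<open>3\<close>, each \<open>A\<close> of rank \<open>2\<close>, and each pair
  \<open>A \<subset> S\<close>; by Lagrange interpolation these terms are multiples of \<open>t^3\<close> that depend on cardinalities only.
  What remains is to collect the sets \<open>S\<close> and \<open>A\<close> by the planes and lines that contain them.
\<close>

section \<open>Interpolation and elementary symmetric functions\<close>

text \<open>The weights come from the summand: with \<open>t\<close> included it is the product of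
  \<open>z\<^sub>c\<close> over \<open>E - B\<^sub>w\<close> times that of
  \<open>1 + tz\<^sub>c\<close> over the same set without \<open>w\<^sub>n\<close>. Division by
  \<open>W(E)\<close> moves all factors to the four elements of \<open>B\<^sub>w\<close> and to
  \<open>w\<^sub>n\<close>. Simplicity fixes the first two basis positions; absence of coloops keeps
  \<open>w\<^sub>n\<close> out of the basis. Partial fractions give
  \<open>\<phi>(z) = 1/z - t\<psi>(z)\<close>, and \<open>1/z\<close> and \<open>\<psi>(z)\<close>
  are, up to constants, reciprocal links from \<open>z\<close> to the extra nodes \<open>0\<close>
  and \<open>-1/t\<close>. A block with such weights at its two ends only is a chain hung between
  two of these nodes; if they coincide and the block has at least two elements, its sum is zero.
  This keeps the terms few and dictates the moves: absence of coloops leaves two elements behind the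
  last cut, and halting \<open>q\<close> directly behind \<open>p\<close> leaves two between the
  cuts. The field of rational functions in the \<open>z\<^sub>e\<close> has no further variable, so
  \<open>t\<close> runs through the positive integers and the coefficient is read off from a
  polynomial with infinitely many roots.\<close>

lemma sum_Pow_by_card:
  assumes "finite A"
  shows "(\<Sum>X\<in>Pow A. f X) = (\<Sum>i\<le>card A. \<Sum>X | X \<subseteq> A \<and> card X = i. f X)"
proof -
  have "(\<Sum>i\<le>card A. \<Sum>X | X \<in> Pow A \<and> card X = i. f X) = (\<Sum>X\<in>Pow A. f X)"
    by (rule sum.group) (use assms in \<open>auto simp: card_mono\<close>)
  then show ?thesis by simp
qed

lemma prod_one_plus_esym:
  assumes "finite A"
  shows "(\<Prod>c\<in>A. 1 + t * u c) = (\<Sum>i\<le>card A. t ^ i * esym i A u)"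
proof -
  have "(\<Prod>c\<in>A. 1 + t * u c) = (\<Prod>c\<in>A. t * u c + 1)"
    by (simp add: add.commute)
  also have "\<dots> = (\<Sum>X\<in>Pow A. \<Prod>c\<in>X. t * u c)"
    by (simp add: prod_add[OF assms])
  also have "\<dots> = (\<Sum>i\<le>card A. t ^ i * esym i A u)"
    unfolding sum_Pow_by_card[OF assms] esym_def sum_distrib_left
    by (intro sum.cong refl) (auto simp: prod.distrib)
  finally show ?thesis .
qed

text \<open>Vieta's formula; it identifies the coefficients of the Lagrange basis polynomials with
  signed values of \<open>esym\<close>.\<close>

lemma coeff_prod_linear_factors:
  fixes u :: "'a \<Rightarrow> 'b::comm_ring_1"
  assumes "finite A" "i \<le> card A"
  shows "Polynomial.coeff (\<Prod>c\<in>A. [:- u c, 1:]) (card A - i) = (- 1) ^ i * esym i A u"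
proof -
  have 1: "[:- u c, 1:] = [:- u c:] + monom 1 1" for c
    by (simp add: monom_altdef)
  have 2: "(\<Prod>c\<in>X. [:- u c:]) = [:(- 1) ^ card X * (\<Prod>c\<in>X. u c):]" if "X \<subseteq> A" for X
  proof -
    have "finite X" using that assms(1) finite_subset by blast
    then show ?thesis
      by (induction X) (auto simp: algebra_simps one_pCons)
  qed
  have 3: "(monom 1 1 :: 'b poly) ^ k = monom 1 k" for k
    by (induction k) (auto simp: mult_monom monom_0 one_pCons)
  have "(\<Prod>c\<in>A. [:- u c, 1:])
    = (\<Sum>X\<in>Pow A. monom ((- 1) ^ card X * (\<Prod>c\<in>X. u c)) (card A - card X))"
    unfolding 1 prod_add[OF assms(1)]
  proof (intro sum.cong refl)
    fix X assume X: "X \<in> Pow A"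
    have "(\<Prod>c\<in>X. [:- u c:]) * (\<Prod>c\<in>A - X. monom 1 1) 
      = [:(- 1) ^ card X * (\<Prod>c\<in>X. u c):] * monom 1 (card A - card X)"
      using X assms(1) by (subst 2) (auto simp: 3 card_Diff_subset finite_subset simp del: One_nat_def)
    also have "\<dots> = monom ((- 1) ^ card X * (\<Prod>c\<in>X. u c)) (card A - card X)"
      by (simp add: smult_monom)
    finally show "(\<Prod>c\<in>X. [:- u c:]) * (\<Prod>c\<in>A - X. monom 1 1) 
      = monom ((- 1) ^ card X * (\<Prod>c\<in>X. u c)) (card A - card X)" .
  qed
  also have "Polynomial.coeff \<dots> (card A - i)
    = (\<Sum>X\<in>Pow A. if card X = i then (- 1) ^ i * (\<Prod>c\<in>X. u c) else 0)"
    unfolding coeff_sum using assms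
    by (intro sum.cong refl) (auto dest!: card_mono[OF assms(1)])
  also have "\<dots> = (\<Sum>X | X \<in> Pow A \<and> card X = i. (- 1) ^ i * (\<Prod>c\<in>X. u c))"
    by (rule sum.inter_filter[symmetric]) (use assms in simp)
  finally show ?thesis
    by (simp add: esym_def sum_distrib_left)
qed

text \<open>Both sides have degree below \<open>card A\<close> and agree at the
  \<open>card A\<close> distinct values of \<open>z\<close> on \<open>A\<close>.\<close>

lemma lagrange_interpolation:
  fixes z :: "'a \<Rightarrow> 'k::field"
  assumes "finite A" "inj_on z A" "Polynomial.degree p < card A"
  shows "p = (\<Sum>d\<in>A. smult (poly p (z d) / (\<Prod>c\<in>A - {d}. z d - z c)) (\<Prod>c\<in>A - {d}. [:- z c, 1:]))"
proof (rule poly_eqI_degree[where A = "z ` A"])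
  show "card (z ` A) > Polynomial.degree p"
    using assms by (simp add: card_image)
  let ?q = "\<Sum>d\<in>A. smult (poly p (z d) / (\<Prod>c\<in>A - {d}. z d - z c)) (\<Prod>c\<in>A - {d}. [:- z c, 1:])"
  have "Polynomial.degree ?q \<le> card A - 1"
  proof (rule degree_sum_le[OF assms(1)])
    fix d assume "d \<in> A"
    have "Polynomial.degree (\<Prod>c\<in>A - {d}. [:- z c, 1:]) \<le> card (A - {d})"
      using degree_prod_sum_le[of "A - {d}" "\<lambda>c. [:- z c, 1:]"] assms(1) by simp
    then show "Polynomial.degree (smult (poly p (z d) / (\<Prod>c\<in>A - {d}. z d - z c)) (\<Prod>c\<in>A - {d}. [:- z c, 1:])) \<le> card A - 1"
      using \<open>d \<in> A\<close> assms(1) by (auto intro: order_trans[OF degree_smult_le])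
  qed
  then show "card (z ` A) > Polynomial.degree ?q"
    using assms by (simp add: card_image)
  fix x assume "x \<in> z ` A"
  then obtain e where e: "e \<in> A" "x = z e" by blast
  have "poly ?q x = (\<Sum>d\<in>A. if d = e then poly p (z e) else 0)"
    unfolding poly_sum
  proof (intro sum.cong refl)
    fix d assume d: "d \<in> A"
    show "poly (smult (poly p (z d) / (\<Prod>c\<in>A - {d}. z d - z c)) (\<Prod>c\<in>A - {d}. [:- z c, 1:])) x
      = (if d = e then poly p (z e) else 0)"
    proof (cases "d = e")
      case True
      have "(\<Prod>c\<in>A - {e}. z e - z c) \<noteq> 0"
        using assms(1,2) e by (auto simp: inj_on_def)
      then show ?thesis using True e by (simp add: poly_prod)
    next
      case False
      then have "(\<Prod>c\<in>A - {d}. x - z c) = 0"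
        using assms(1) e by (intro prod_zero) auto
      then show ?thesis using False by (simp add: poly_prod)
    qed
  qed
  then show "poly p x = poly ?q x"
    using e assms(1) by simp
qed

text \<open>Lagrange's formula evaluated at \<open>x\<close> and divided by the product over all
  nodes, that is, the partial fraction expansion of \<open>p\<close> over that product.\<close>

lemma divided_difference_off_nodes:
  fixes z :: "'a \<Rightarrow> 'k::field"
  assumes "finite A" "inj_on z A" "Polynomial.degree p < card A" "x \<notin> z ` A"
  shows "(\<Sum>d\<in>A. poly p (z d) / ((x - z d) * (\<Prod>c\<in>A - {d}. z d - z c)))
    = poly p x / (\<Prod>c\<in>A. x - z c)"
proof -
  have nz: "(\<Prod>c\<in>A. x - z c) \<noteq> 0"
    using assms(1,4) by auto
  have "poly p x = (\<Sum>d\<in>A. poly p (z d) / (\<Prod>c\<in>A - {d}. z d - z c) * (\<Prod>c\<in>A - {d}. x - z c))"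
    by (subst lagrange_interpolation[OF assms(1-3)]) (simp add: poly_sum poly_prod)
  also have "\<dots> = (\<Sum>d\<in>A. poly p (z d) / ((x - z d) * (\<Prod>c\<in>A - {d}. z d - z c)) * (\<Prod>c\<in>A. x - z c))"
  proof (intro sum.cong refl)
    fix d assume d: "d \<in> A"
    then have "x - z d \<noteq> 0" using assms(4) by auto
    then show "poly p (z d) / (\<Prod>c\<in>A - {d}. z d - z c) * (\<Prod>c\<in>A - {d}. x - z c) 
      = poly p (z d) / ((x - z d) * (\<Prod>c\<in>A - {d}. z d - z c)) * (\<Prod>c\<in>A. x - z c)"
      unfolding prod.remove[OF assms(1) d, of "\<lambda>c. x - z c"] by simp
  qed
  finally show ?thesis
    using nz by (simp add: sum_distrib_right nonzero_eq_divide_eq)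
qed

text \<open>Compare the coefficients of degree \<open>card A - 1 - i\<close> in the interpolation of
  the monomial of degree \<open>N\<close>, which is its own interpolant because \<open>N\<close> is
  below the number of nodes.\<close>

lemma esym_orthogonality:
  fixes z :: "'a \<Rightarrow> 'k::field"
  assumes "finite A" "inj_on z A" "N < card A" "i < card A"
  shows "(\<Sum>d\<in>A. z d ^ N * esym i (A - {d}) z / (\<Prod>c\<in>A - {d}. z d - z c))
    = (if N + i + 1 = card A then (- 1) ^ i else 0)"
proof -
  let ?m = "card A - 1 - i"
  have "Polynomial.coeff (monom 1 N :: 'k poly) ?m =
    Polynomial.coeff (\<Sum>d\<in>A. smult (z d ^ N / (\<Prod>c\<in>A - {d}. z d - z c)) (\<Prod>c\<in>A - {d}. [:- z c, 1:])) ?m"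
    by (subst lagrange_interpolation[OF assms(1,2), of "monom 1 N"])
      (use assms(3) in \<open>auto simp: degree_monom_eq poly_monom\<close>)
  also have "\<dots> = (\<Sum>d\<in>A. z d ^ N / (\<Prod>c\<in>A - {d}. z d - z c) * ((- 1) ^ i * esym i (A - {d}) z))"
    unfolding coeff_sum coeff_smult
  proof (intro sum.cong refl)
    fix d assume "d \<in> A"
    then have "card (A - {d}) = card A - 1" using assms(1) by simp
    then show "z d ^ N / (\<Prod>c\<in>A - {d}. z d - z c) * Polynomial.coeff (\<Prod>c\<in>A - {d}. [:- z c, 1:]) ?m
      = z d ^ N / (\<Prod>c\<in>A - {d}. z d - z c) * ((- 1) ^ i * esym i (A - {d}) z)"
      using coeff_prod_linear_factors[of "A - {d}" i z] assms(1,4) by simp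
  qed
  also have "\<dots> = (- 1) ^ i * (\<Sum>d\<in>A. z d ^ N * esym i (A - {d}) z / (\<Prod>c\<in>A - {d}. z d - z c))"
    unfolding sum_distrib_left by (intro sum.cong refl) simp
  finally have *: "Polynomial.coeff (monom 1 N :: 'k poly) ?m
    = (- 1) ^ i * (\<Sum>d\<in>A. z d ^ N * esym i (A - {d}) z / (\<Prod>c\<in>A - {d}. z d - z c))" .
  have "(- 1) ^ i * Polynomial.coeff (monom 1 N :: 'k poly) ?m 
    = (\<Sum>d\<in>A. z d ^ N * esym i (A - {d}) z / (\<Prod>c\<in>A - {d}. z d - z c))"
    unfolding * mult.assoc[symmetric] power_mult_distrib[symmetric] by simp
  moreover have "N = card A - 1 - i \<longleftrightarrow> N + i + 1 = card A"
    using assms(4) by auto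
  ultimately show ?thesis
    by auto
qed

section \<open>Sums over orderings\<close>

lemma sum_permutations_split:
  assumes "finite E" "k \<le> card E"
  shows "(\<Sum>w\<in>permutations_of_set E. f w) =
    (\<Sum>S | S \<subseteq> E \<and> card S = k. \<Sum>u\<in>permutations_of_set S. \<Sum>v\<in>permutations_of_set (E - S). f (u @ v))"
proof -
  let ?I = "SIGMA S:{S. S \<subseteq> E \<and> card S = k}. permutations_of_set S \<times> permutations_of_set (E - S)"
  have "(\<Sum>(S, u, v)\<in>?I. f (u @ v)) = (\<Sum>w\<in>permutations_of_set E. f w)"
  proof (rule sum.reindex_bij_witness[where j = "\<lambda>(S, u, v). u @ v" and
        i = "\<lambda>w. (set (take k w), take k w, drop k w)"], goal_cases)
    case (1 a)
    then show ?case
      by (auto simp: permutations_of_set_def distinct_card)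
  next
    case (2 a)
    then show ?case
      by (auto simp: permutations_of_set_def distinct_card)
  next
    case (3 w)
    then show ?case by simp
  next
    case (4 w)
    then have w: "set w = E" "distinct w" by (auto simp: permutations_of_set_def)
    then have len: "length w = card E" by (simp add: distinct_card[symmetric])
    have "set (drop k w) = E - set (take k w)"
      using w by (metis append_take_drop_id distinct_append set_append Diff_cancel Un_Diff Un_empty_left Diff_triv inf_commute)
    then show ?case
      using w len assms(2) set_take_subset[of k w]
      by (auto simp: permutations_of_set_def distinct_card)
  qed auto
  then show ?thesis
    using assms(1) by (simp add: sum.Sigma split_beta finite_subset)
qed

lemma sum_permutations_Cons:
  assumes "finite E" "E \<noteq> {}"
  shows "(\<Sum>w\<in>permutations_of_set E. f w) = (\<Sum>a\<in>E. \<Sum>v\<in>permutations_of_set (E - {a}). f (a # v))"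
proof -
  have "(\<Sum>w\<in>permutations_of_set E. f w) = (\<Sum>a\<in>E. \<Sum>w\<in>(#) a ` permutations_of_set (E - {a}). f w)"
    unfolding permutations_of_set_nonempty[OF assms(2)] 
    by (rule sum.UNION_disjoint) (use assms in auto)
  also have "\<dots> = (\<Sum>a\<in>E. \<Sum>v\<in>permutations_of_set (E - {a}). f (a # v))"
    by (rule sum.cong[OF refl]) (simp add: sum.reindex)
  finally show ?thesis .
qed

lemma sum_permutations_rev:
  "(\<Sum>w\<in>permutations_of_set E. f (rev w)) = (\<Sum>w\<in>permutations_of_set E. f w)"
  by (rule sum.reindex_bij_witness[where i = rev and j = rev]) (auto simp: permutations_of_set_def)

text \<open>The denominators of \<open>eq_deg\<close>, as a function of the list of field elements
  rather than of the ordering of \<open>E\<close>. Chains can thus be extended by nodes such as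
  \<open>0\<close> and \<open>- (1 / t)\<close> that are not values of \<open>z\<close>.\<close>

fun chain :: "'k::comm_ring_1 list \<Rightarrow> 'k" where
  "chain [] = 1"
| "chain [x] = 1"
| "chain (x # y # xs) = (x - y) * chain (y # xs)"

lemma chain_Cons: "xs \<noteq> [] \<Longrightarrow> chain (x # xs) = (x - hd xs) * chain xs"
  by (cases xs) auto

lemma chain_append:
  "xs \<noteq> [] \<Longrightarrow> ys \<noteq> [] \<Longrightarrow> chain (xs @ ys) = chain xs * (last xs - hd ys) * chain ys"
  by (induction xs rule: chain.induct) (auto simp: chain_Cons mult.assoc)

lemma chain_conv_prod: "chain xs = (\<Prod>k<length xs - 1. xs ! k - xs ! Suc k)"
  by (induction xs rule: chain.induct) (auto simp: prod.lessThan_Suc_shift simp del: prod.lessThan_Suc)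

lemma chain_rev: "chain (rev xs) = (- 1) ^ (length xs - 1) * chain xs"
proof (induction xs rule: chain.induct)
  case (3 x y xs)
  then show ?case
    by (subst rev.simps, subst chain_append) (auto simp: last_rev algebra_simps)
qed auto

text \<open>Induction by the element \<open>d\<close> that follows \<open>a\<close>. What remains is
  the partial fraction expansion of the constant \<open>1\<close> over the product of the
  \<open>a - z c\<close>.\<close>

lemma sum_chain_from:
  fixes z :: "'a \<Rightarrow> 'k::field"
  assumes "finite A" "inj_on z A" "a \<notin> z ` A"
  shows "(\<Sum>v\<in>permutations_of_set A. 1 / chain (a # map z v)) = (\<Prod>c\<in>A. 1 / (a - z c))"
  using assms
proof (induction "card A" arbitrary: A a)
  case 0
  then show ?case by simp
next
  case (Suc n)
  then have ne: "A \<noteq> {}" by auto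
  have IH: "(\<Sum>v\<in>permutations_of_set (A - {d}). 1 / chain (z d # map z v)) = (\<Prod>c\<in>A - {d}. 1 / (z d - z c))"
    if "d \<in> A" for d
    by (rule Suc.hyps(1)) (use Suc.hyps(2) Suc.prems that in \<open>auto simp: inj_on_def\<close>)
  have "(\<Sum>v\<in>permutations_of_set A. 1 / chain (a # map z v))
    = (\<Sum>d\<in>A. 1 / (a - z d) * (\<Sum>v\<in>permutations_of_set (A - {d}). 1 / chain (z d # map z v)))"
    by (simp add: sum_permutations_Cons[OF Suc.prems(1) ne] sum_distrib_left)
  also have "\<dots> = (\<Sum>d\<in>A. poly 1 (z d) / ((a - z d) * (\<Prod>c\<in>A - {d}. z d - z c)))"
    using IH by (intro sum.cong refl) (simp add: prod_dividef)
  also have "\<dots> = 1 / (\<Prod>c\<in>A. a - z c)"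
    by (subst divided_difference_off_nodes) (use Suc in auto)
  finally show ?case by (simp add: prod_dividef)
qed

lemma sum_chain_to:
  fixes z :: "'a \<Rightarrow> 'k::field"
  assumes "finite A" "inj_on z A" "b \<notin> z ` A"
  shows "(\<Sum>v\<in>permutations_of_set A. 1 / chain (map z v @ [b])) = (\<Prod>c\<in>A. 1 / (z c - b))"
proof -
  have *: "chain (map z (rev v) @ [b]) = (- 1) ^ card A * chain (b # map z v)"
    if "v \<in> permutations_of_set A" for v
    using chain_rev[of "b # map z v"] that length_finite_permutations_of_set[OF that] by (simp add: rev_map)
  have "(\<Sum>v\<in>permutations_of_set A. 1 / chain (map z v @ [b])) 
    = (\<Sum>v\<in>permutations_of_set A. 1 / chain (map z (rev v) @ [b]))"
    by (rule sum_permutations_rev[symmetric])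
  also have "\<dots> = (\<Sum>v\<in>permutations_of_set A. (- 1) ^ card A * (1 / chain (b # map z v)))"
    by (intro sum.cong refl) (simp add: * minus_one_power_iff)
  also have "\<dots> = (- 1) ^ card A * (\<Prod>c\<in>A. 1 / (b - z c))"
    by (simp add: sum_distrib_left[symmetric] sum_chain_from[OF assms] del: times_divide_eq_right)
  also have "\<dots> = (\<Prod>c\<in>A. 1 / (z c - b))"
    unfolding prod_constant[symmetric] prod.distrib[symmetric]
    by (intro prod.cong refl) (metis minus_diff_eq minus_divide_right mult_minus1)
  finally show ?thesis .
qed

text \<open>As for \<open>sum_chain_from\<close>, but the interpolated polynomial is
  \<open>[:- b, 1:] ^ (card A - 1)\<close>, of the largest degree that \<open>card A\<close> nodes
  allow. For empty \<open>A\<close> the formula would give \<open>1\<close> instead of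
  \<open>1 / (a - b)\<close>, so the induction is anchored at singletons.\<close>

lemma sum_chain_between:
  fixes z :: "'a \<Rightarrow> 'k::field"
  assumes "finite A" "inj_on z A" "a \<notin> z ` A" "b \<notin> z ` A" "A \<noteq> {}"
  shows "(\<Sum>v\<in>permutations_of_set A. 1 / chain (a # map z v @ [b])) =
    (a - b) ^ (card A - 1) / (\<Prod>c\<in>A. (a - z c) * (z c - b))"
  using assms
proof (induction "card A" arbitrary: A a)
  case 0
  then show ?case by simp
next
  case (Suc n)
  show ?case
  proof (cases "n = 0")
    case True
    then obtain d where "A = {d}" using Suc.hyps(2) by (metis card_1_singletonE One_nat_def)
    then show ?thesis by simp
  next
    case False
    have IH: "(\<Sum>v\<in>permutations_of_set (A - {d}). 1 / chain (z d # map z v @ [b])) 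
      = (z d - b) ^ (n - 1) / (\<Prod>c\<in>A - {d}. (z d - z c) * (z c - b))" if "d \<in> A" for d
    proof -
      have c: "card (A - {d}) = n" using Suc.hyps(2) Suc.prems that by simp
      then have "A - {d} \<noteq> {}" using False by force
      then show ?thesis
        using Suc.hyps(1)[of "A - {d}" "z d"] Suc.prems that c
        by (auto simp: inj_on_def)
    qed
    have nz: "(\<Prod>c\<in>A. z c - b) \<noteq> 0" using Suc.prems by auto
    have "(\<Sum>v\<in>permutations_of_set A. 1 / chain (a # map z v @ [b]))
      = (\<Sum>d\<in>A. 1 / (a - z d) * (\<Sum>v\<in>permutations_of_set (A - {d}). 1 / chain (z d # map z v @ [b])))"
      by (simp add: sum_permutations_Cons[OF Suc.prems(1) Suc.prems(5)] sum_distrib_left)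
    \<comment> \<open>Completing the product over \<open>A - {d}\<close> to one over
      \<open>A\<close> contributes the factor \<open>z d - b\<close> that raises the exponent from
      \<open>n - 1\<close> to \<open>n\<close>.\<close>
    also have "\<dots> = (\<Sum>d\<in>A. poly ([:- b, 1:] ^ n) (z d) / ((a - z d) * (\<Prod>c\<in>A - {d}. z d - z c)) / (\<Prod>c\<in>A. z c - b))"
    proof (intro sum.cong refl)
      fix d assume d: "d \<in> A"
      then have "z d - b \<noteq> 0" using Suc.prems by auto
      moreover have "(z d - b) ^ n = (z d - b) * (z d - b) ^ (n - 1)"
        using False by (simp add: power_eq_if)
      ultimately show "1 / (a - z d) * (\<Sum>v\<in>permutations_of_set (A - {d}). 1 / chain (z d # map z v @ [b]))
        = poly ([:- b, 1:] ^ n) (z d) / ((a - z d) * (\<Prod>c\<in>A - {d}. z d - z c)) / (\<Prod>c\<in>A. z c - b)"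
        unfolding IH[OF d] prod.remove[OF Suc.prems(1) d, of "\<lambda>c. z c - b"]
        by (simp add: prod.distrib)
    qed
    also have "\<dots> = (a - b) ^ n / (\<Prod>c\<in>A. a - z c) / (\<Prod>c\<in>A. z c - b)"
      unfolding sum_divide_distrib[symmetric]
      by (subst divided_difference_off_nodes)
        (use Suc in \<open>auto simp: degree_power_eq\<close>)
    finally show ?thesis
      using Suc.hyps(2)[symmetric] by (simp add: prod.distrib)
  qed
qed

section \<open>Weighted sums over orderings\<close>

lemma chain_overlap: "chain (xs @ d # ys) = chain (xs @ [d]) * chain (d # ys)"
  by (induction xs rule: chain.induct) (auto simp: chain_Cons mult.assoc)

lemma sum_subsets_prod_compl:
  assumes "finite B" "s \<le> card B"
  shows "(\<Sum>R | R \<subseteq> B \<and> card R = s. \<Prod>c\<in>B - R. u c) = esym (card B - s) B u"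
  unfolding esym_def
  by (rule sum.reindex_bij_witness[where i = "\<lambda>X. B - X" and j = "\<lambda>X. B - X"])
    (use assms in \<open>auto simp: card_Diff_subset finite_subset double_diff\<close>)

text \<open>Expand the products and exchange the sums: a set \<open>X\<close> is counted once for
  every \<open>R\<close> of size \<open>s\<close> disjoint from it.\<close>

lemma sum_subsets_prod_one_plus_compl:
  fixes u :: "'a \<Rightarrow> 'b::comm_ring_1"
  assumes "finite B"
  shows "(\<Sum>R | R \<subseteq> B \<and> card R = s. \<Prod>c\<in>B - R. 1 + t * u c)
    = (\<Sum>i\<le>card B. of_nat ((card B - i) choose s) * t ^ i * esym i B u)"
proof -
  have "(\<Sum>R | R \<subseteq> B \<and> card R = s. \<Prod>c\<in>B - R. 1 + t * u c)
    = (\<Sum>R | R \<subseteq> B \<and> card R = s. \<Sum>X\<in>Pow (B - R). \<Prod>c\<in>X. t * u c)"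
  proof (intro sum.cong refl)
    fix R assume "R \<in> {R. R \<subseteq> B \<and> card R = s}"
    have "(\<Prod>c\<in>B - R. 1 + t * u c) = (\<Prod>c\<in>B - R. t * u c + 1)" by (simp add: add.commute)
    then show "(\<Prod>c\<in>B - R. 1 + t * u c) = (\<Sum>X\<in>Pow (B - R). \<Prod>c\<in>X. t * u c)"
      using assms by (simp add: prod_add)
  qed
  also have "\<dots> = (\<Sum>R | R \<subseteq> B \<and> card R = s. \<Sum>X | X \<in> Pow B \<and> X \<inter> R = {}. \<Prod>c\<in>X. t * u c)"
    by (intro sum.cong refl) auto
  also have "\<dots> = (\<Sum>X\<in>Pow B. \<Sum>R | R \<in> {R. R \<subseteq> B \<and> card R = s} \<and> X \<inter> R = {}. \<Prod>c\<in>X. t * u c)"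
    by (rule sum.swap_restrict) (use assms in auto)
  also have "\<dots> = (\<Sum>X\<in>Pow B. \<Sum>R | R \<subseteq> B - X \<and> card R = s. \<Prod>c\<in>X. t * u c)"
    by (intro sum.cong refl) auto
  also have "\<dots> = (\<Sum>X\<in>Pow B. of_nat ((card B - card X) choose s) * (\<Prod>c\<in>X. t * u c))"
  proof (intro sum.cong refl)
    fix X assume "X \<in> Pow B"
    then have "card (B - X) = card B - card X" using assms by (auto simp: card_Diff_subset finite_subset)
    then show "(\<Sum>R | R \<subseteq> B - X \<and> card R = s. \<Prod>c\<in>X. t * u c) 
      = of_nat ((card B - card X) choose s) * (\<Prod>c\<in>X. t * u c)"
      using assms by (simp add: n_subsets)
  qed
  also have "\<dots> = (\<Sum>i\<le>card B. of_nat ((card B - i) choose s) * t ^ i * esym i B u)"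
    unfolding sum_Pow_by_card[OF assms] esym_def sum_distrib_left
    by (intro sum.cong refl) (auto simp: prod.distrib mult.assoc)
  finally show ?thesis .
qed

text \<open>After binomial expansion, \<open>esym_orthogonality\<close> lets only the exponent
  \<open>card A - 1 - i\<close> of \<open>z d\<close> survive.\<close>

lemma esym_orthogonality_binomial:
  fixes z :: "'a \<Rightarrow> 'k::field"
  assumes "finite A" "inj_on z A" "M < card A" "i < card A"
  shows "(\<Sum>d\<in>A. (1 + t * z d) ^ M * esym i (A - {d}) z / (\<Prod>c\<in>A - {d}. z d - z c))
    = of_nat (M choose (card A - 1 - i)) * t ^ (card A - 1 - i) * (- 1) ^ i"
proof -
  have "(\<Sum>d\<in>A. (1 + t * z d) ^ M * esym i (A - {d}) z / (\<Prod>c\<in>A - {d}. z d - z c))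
    = (\<Sum>k\<le>M. of_nat (M choose k) * t ^ k * (\<Sum>d\<in>A. z d ^ k * esym i (A - {d}) z / (\<Prod>c\<in>A - {d}. z d - z c)))"
    unfolding sum_distrib_left
    by (subst sum.swap)
      (simp add: add.commute[of 1] binomial_ring power_mult_distrib sum_distrib_right sum_divide_distrib mult.assoc)
  also have "\<dots> = (\<Sum>k\<le>M. if k = card A - 1 - i then of_nat (M choose k) * t ^ k * (- 1) ^ i else 0)"
  proof (intro sum.cong refl)
    fix k assume "k \<in> {..M}"
    then have "k < card A" using assms by auto
    then show "of_nat (M choose k) * t ^ k * (\<Sum>d\<in>A. z d ^ k * esym i (A - {d}) z / (\<Prod>c\<in>A - {d}. z d - z c))
      = (if k = card A - 1 - i then of_nat (M choose k) * t ^ k * (- 1) ^ i else 0)"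
      using assms by (subst esym_orthogonality) auto
  qed
  also have "\<dots> = of_nat (M choose (card A - 1 - i)) * t ^ (card A - 1 - i) * (- 1) ^ i"
    by (auto simp: sum.delta' binomial_eq_0 not_le)
  finally show ?thesis .
qed

section \<open>Chains with weights at their ends\<close>

text \<open>\<open>t\<close> is a fixed element of the field, to be replaced by positive integers
  later. The conditions say that \<open>0\<close> and \<open>- (1 / t)\<close> are two distinct
  nodes and that neither is a value of the injective function \<open>z\<close>.\<close>

locale chain_weights =
  fixes z :: "'a \<Rightarrow> 'k::field" and t :: 'k
  assumes inj_z: "inj z" and z_nonzero: "z c \<noteq> 0" and t_nonzero: "t \<noteq> 0"
    and one_plus_nonzero: "1 + t * z c \<noteq> 0"
begin

definition \<phi> :: "'a \<Rightarrow> 'k" where "\<phi> c = 1 / (z c * (1 + t * z c))"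
definition \<psi> :: "'a \<Rightarrow> 'k" where "\<psi> c = 1 / (1 + t * z c)"
definition W :: "'a set \<Rightarrow> 'k" where "W A = (\<Prod>c\<in>A. z c * (1 + t * z c))"
abbreviation den :: "'a list \<Rightarrow> 'k" where "den w \<equiv> chain (map z w)"

lemma inj_on_z: "inj_on z A"
  using inj_z by (rule inj_on_subset) simp

lemma z_eq_iff: "z a = z b \<longleftrightarrow> a = b"
  using inj_z by (auto simp: inj_def)

lemma W_nonzero: "finite A \<Longrightarrow> W A \<noteq> 0"
  by (simp add: W_def z_nonzero one_plus_nonzero)

lemma W_prod_phi: "finite A \<Longrightarrow> W A * (\<Prod>c\<in>A. \<phi> c) = 1"
  unfolding W_def \<phi>_def prod.distrib[symmetric]
  by (intro prod.neutral) (auto simp: z_nonzero one_plus_nonzero)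

lemma W_Un: "finite A \<Longrightarrow> S \<subseteq> A \<Longrightarrow> W A = W S * W (A - S)"
  unfolding W_def by (rule prod.subset_diff[THEN trans]) (auto simp: mult.commute)

text \<open>Partial fractions: \<open>\<phi> c = 1 / z c - t * \<psi> c\<close>. In each of the two
  parts the difference is \<open>z x - z y\<close> times a constant, a function of \<open>x\<close>
  and a function of \<open>y\<close>.\<close>

lemma phi_diff:
  "\<phi> y - \<phi> x = (z x - z y) * (1 / (z x * z y) - t\<^sup>2 * \<psi> x * \<psi> y)"
proof -
  define a b p q where "a = z x" "b = z y" "p = 1 + t * a" "q = 1 + t * b"
  have nz: "a \<noteq> 0" "b \<noteq> 0" "p \<noteq> 0" "q \<noteq> 0"
    using z_nonzero one_plus_nonzero by (auto simp: a_b_p_q_def)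
  have "\<phi> y - \<phi> x = (a * p - b * q) / (b * q * (a * p))"
    unfolding \<phi>_def a_b_p_q_def[symmetric] using nz by (subst diff_frac_eq) auto
  also have "a * p - b * q = (a - b) * (p * q - t\<^sup>2 * (a * b))"
    by (simp add: a_b_p_q_def algebra_simps power2_eq_square)
  also have "(a - b) * (p * q - t\<^sup>2 * (a * b)) / (b * q * (a * p)) = (a - b) * ((p * q - t\<^sup>2 * (a * b)) / (a * b * (p * q)))"
    by (simp add: mult_ac)
  also have "(p * q - t\<^sup>2 * (a * b)) / (a * b * (p * q)) = 1 / (a * b) - t\<^sup>2 / (p * q)"
    using nz by (subst diff_frac_eq) auto
  finally show ?thesis
    unfolding \<psi>_def a_b_p_q_def[symmetric] by simp
qed

text \<open>With \<open>s = - (1 / t)\<close>, the weight \<open>\<psi> (last v)\<close> is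
  \<open>1 / t\<close> times the reciprocal of the link from \<open>z (last v)\<close> to
  \<open>s\<close>. The chain thus runs from \<open>a\<close> to \<open>s\<close>, and
  \<open>sum_chain_between\<close> applies.\<close>

lemma sum_from_psi:
  assumes "finite T" "T \<noteq> {}" "a \<notin> z ` T"
  shows "(\<Sum>v\<in>permutations_of_set T. \<psi> (last v) / chain (a # map z v))
    = (1 + t * a) ^ (card T - 1) / (\<Prod>c\<in>T. (a - z c) * (1 + t * z c))"
proof -
  define s where "s = - (1 / t)"
  have sub: "x - s = (1 + t * x) / t" for x
    using t_nonzero by (simp add: s_def field_simps)
  have s: "s \<notin> z ` T"
  proof
    assume "s \<in> z ` T"
    then obtain c where "z c - s = 0" by auto
    then show False unfolding sub using t_nonzero one_plus_nonzero by simp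
  qed
  have "\<psi> (last v) / chain (a # map z v) = 1 / t * (1 / chain (a # map z v @ [s]))"
    if "v \<in> permutations_of_set T" for v
  proof -
    have "v \<noteq> []" using that assms by (auto simp: permutations_of_set_def)
    then show ?thesis
      using chain_append[of "a # map z v" "[s]"] t_nonzero
      by (simp add: sub last_map \<psi>_def)
  qed
  then have "(\<Sum>v\<in>permutations_of_set T. \<psi> (last v) / chain (a # map z v))
    = 1 / t * (\<Sum>v\<in>permutations_of_set T. 1 / chain (a # map z v @ [s]))"
    by (simp add: sum_distrib_left)
  also have "\<dots> = 1 / t * (((1 + t * a) / t) ^ (card T - 1) / (\<Prod>c\<in>T. (a - z c) * ((1 + t * z c) / t)))"
    by (subst sum_chain_between[OF assms(1) inj_on_z assms(3) s assms(2)]) (simp add: sub)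
  also have "(\<Prod>c\<in>T. (a - z c) * ((1 + t * z c) / t)) = (\<Prod>c\<in>T. (a - z c) * (1 + t * z c)) / (t * t ^ (card T - 1))"
    
    using assms(1,2) by (simp add: prod_dividef prod.distrib power_minus_mult[symmetric, of "card T"] card_gt_0_iff mult.commute[of t])
  finally show ?thesis
    using t_nonzero by (simp add: power_divide)
qed

text \<open>Here the end node is \<open>0\<close>: \<open>1 / z (last v)\<close> is the reciprocal
  of the link from \<open>z (last v)\<close> to it.\<close>

lemma sum_from_inv:
  assumes "finite T" "T \<noteq> {}" "a \<notin> z ` T"
  shows "(\<Sum>v\<in>permutations_of_set T. 1 / z (last v) / chain (a # map z v))
    = a ^ (card T - 1) / (\<Prod>c\<in>T. (a - z c) * z c)"
proof -
  have "1 / z (last v) / chain (a # map z v) = 1 / chain (a # map z v @ [0])"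
    if "v \<in> permutations_of_set T" for v
  proof -
    have "v \<noteq> []" using that assms by (auto simp: permutations_of_set_def)
    then show ?thesis
      using chain_append[of "a # map z v" "[0]"] by (simp add: last_map)
  qed
  then have "(\<Sum>v\<in>permutations_of_set T. 1 / z (last v) / chain (a # map z v))
    = (\<Sum>v\<in>permutations_of_set T. 1 / chain (a # map z v @ [0]))"
    by simp
  also have "\<dots> = a ^ (card T - 1) / (\<Prod>c\<in>T. (a - z c) * z c)"
    using z_nonzero by (subst sum_chain_between[OF assms(1) inj_on_z assms(3) _ assms(2)]) auto
  finally show ?thesis .
qed

lemma hd_inv_conv:
  assumes "v \<in> permutations_of_set T" "T \<noteq> {}"
  shows "1 / z (hd v) * x / den v = - (x / chain (0 # map z v))"
proof -
  have "v \<noteq> []" using assms by (auto simp: permutations_of_set_def)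
  then show ?thesis by (simp add: chain_Cons hd_map)
qed

lemma hd_psi_conv:
  assumes "v \<in> permutations_of_set T" "T \<noteq> {}"
  shows "\<psi> (hd v) * x / den v = - (1 / t) * (x / chain (- (1 / t) # map z v))"
proof -
  have "v \<noteq> []" using assms by (auto simp: permutations_of_set_def)
  moreover have "- (1 / t) - z (hd v) = - ((1 + t * z (hd v)) / t)"
    using t_nonzero by (simp add: field_simps)
  ultimately show ?thesis
    using t_nonzero by (simp add: chain_Cons hd_map \<psi>_def)
qed

lemma neg_inv_notin: "- (1 / t) \<notin> z ` T"
proof
  assume "- (1 / t) \<in> z ` T"
  then obtain c where c: "z c = - (1 / t)" by auto
  show False using one_plus_nonzero[of c] t_nonzero unfolding c by simp
qed

text \<open>A chain from the node \<open>0\<close> to the node \<open>- (1 / t)\<close>: at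
  \<open>a = 0\<close> the numerator in \<open>sum_from_psi\<close> is \<open>1\<close>, and the
  denominator is \<open>W T\<close> up to sign.\<close>

lemma sum_hd_inv_last_psi:
  assumes "finite T" "T \<noteq> {}"
  shows "(\<Sum>v\<in>permutations_of_set T. 1 / z (hd v) * \<psi> (last v) / den v) = (- 1) ^ (card T - 1) / W T"
proof -
  have "(\<Prod>c\<in>T. (0 - z c) * (1 + t * z c)) = (- 1) ^ card T * W T"
    unfolding W_def prod_constant[symmetric] prod.distrib[symmetric]
    by (intro prod.cong) auto
  moreover have "(- 1 :: 'k) ^ card T = - ((- 1) ^ (card T - 1))"
    using assms by (subst power_minus_mult[symmetric]) (auto simp: card_gt_0_iff)
  moreover have "(\<Sum>v\<in>permutations_of_set T. 1 / z (hd v) * \<psi> (last v) / den v)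
    = - (\<Sum>v\<in>permutations_of_set T. \<psi> (last v) / chain (0 # map z v))"
    unfolding sum_negf[symmetric] by (intro sum.cong refl hd_inv_conv) (use assms in auto)
  moreover have "0 \<notin> z ` T" using z_nonzero by auto
  ultimately show ?thesis
    by (simp add: sum_from_psi[OF assms] minus_one_power_iff)
qed

text \<open>Both ends hang on the node \<open>0\<close>, so the numerator in
  \<open>sum_from_inv\<close> is a positive power of \<open>0\<close>. A single element would give
  \<open>1 / z c ^ 2\<close> instead.\<close>

lemma sum_hd_inv_last_inv:
  assumes "finite T" "card T \<ge> 2"
  shows "(\<Sum>v\<in>permutations_of_set T. 1 / z (hd v) * (1 / z (last v)) / den v) = 0"
proof -
  have T: "T \<noteq> {}" using assms by auto
  have "(\<Sum>v\<in>permutations_of_set T. 1 / z (hd v) * (1 / z (last v)) / den v)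
    = - (\<Sum>v\<in>permutations_of_set T. 1 / z (last v) / chain (0 # map z v))"
    unfolding sum_negf[symmetric] by (intro sum.cong refl hd_inv_conv) (use T in auto)
  moreover have "0 \<notin> z ` T" using z_nonzero by auto
  ultimately show ?thesis
    using assms(2) by (subst (asm) sum_from_inv[OF assms(1) T]) (simp_all add: power_0_left)
qed

text \<open>Both ends hang on the node \<open>- (1 / t)\<close>, where \<open>1 + t * a\<close>
  vanishes.\<close>

lemma sum_hd_psi_last_psi:
  assumes "finite T" "card T \<ge> 2"
  shows "(\<Sum>v\<in>permutations_of_set T. \<psi> (hd v) * \<psi> (last v) / den v) = 0"
proof -
  have T: "T \<noteq> {}" using assms by auto
  have "(\<Sum>v\<in>permutations_of_set T. \<psi> (hd v) * \<psi> (last v) / den v)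
    = - (1 / t) * (\<Sum>v\<in>permutations_of_set T. \<psi> (last v) / chain (- (1 / t) # map z v))"
    unfolding sum_distrib_left by (intro sum.cong refl hd_psi_conv) (use T in auto)
  then show ?thesis
    using assms(2) t_nonzero
    by (subst (asm) sum_from_psi[OF assms(1) T neg_inv_notin]) (simp_all add: power_0_left)
qed

lemma sum_hd_psi_last_inv:
  assumes "finite T" "T \<noteq> {}"
  shows "(\<Sum>v\<in>permutations_of_set T. \<psi> (hd v) * (1 / z (last v)) / den v) = 1 / W T"
proof -
  have "(\<Sum>v\<in>permutations_of_set T. \<psi> (hd v) * (1 / z (last v)) / den v)
    = - (1 / t) * (\<Sum>v\<in>permutations_of_set T. 1 / z (last v) / chain (- (1 / t) # map z v))"
    unfolding sum_distrib_left by (intro sum.cong refl hd_psi_conv) (use assms in auto)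
  also have "\<dots> = - (1 / t) * ((- (1 / t)) ^ (card T - 1) / (\<Prod>c\<in>T. (- (1 / t) - z c) * z c))"
    by (subst sum_from_inv[OF assms neg_inv_notin]) simp
  also have "(\<Prod>c\<in>T. (- (1 / t) - z c) * z c) = (- (1 / t)) ^ card T * W T"
    unfolding W_def prod_constant[symmetric] prod.distrib[symmetric]
    using t_nonzero by (intro prod.cong) (auto simp: field_simps)
  also have "(- (1 / t)) ^ card T = - (1 / t) * (- (1 / t)) ^ (card T - 1)"
    using assms by (subst power_minus_mult[symmetric]) (auto simp: card_gt_0_iff)
  finally show ?thesis
    using t_nonzero by simp
qed

lemma den_append_phi_diff:
  assumes "u \<noteq> []" "v \<noteq> []" "set u \<inter> set v = {}"
  shows "(\<phi> (hd v) - \<phi> (last u)) / den (u @ v)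
    = (1 / z (last u) * (1 / z (hd v)) - t\<^sup>2 * \<psi> (last u) * \<psi> (hd v)) / den v / den u"
proof -
  have "last u \<noteq> hd v" using assms by (metis disjoint_iff hd_in_set last_in_set)
  then have "z (last u) - z (hd v) \<noteq> 0" by (simp add: z_eq_iff)
  then show ?thesis
    using assms unfolding map_append
    by (subst chain_append) (simp_all add: phi_diff hd_map last_map)
qed

text \<open>Moving a basis element across the cut between \<open>u\<close> and \<open>v\<close> cancels the factor of the
  denominator at the cut, so that the orderings \<open>v\<close> of the tail can be summed independently.\<close>

lemma sum_cut:
  assumes "finite T" "T \<noteq> {}" "u \<noteq> []" "set u \<inter> T = {}"
  shows "(\<Sum>v\<in>permutations_of_set T. (\<phi> (hd v) - \<phi> (last u)) * h v / den (u @ v))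
    = (1 / z (last u) * (\<Sum>v\<in>permutations_of_set T. 1 / z (hd v) * h v / den v)
      - t\<^sup>2 * \<psi> (last u) * (\<Sum>v\<in>permutations_of_set T. \<psi> (hd v) * h v / den v)) / den u"
  unfolding sum_distrib_left sum_subtractf[symmetric] sum_divide_distrib
proof (intro sum.cong refl)
  fix v assume "v \<in> permutations_of_set T"
  then have v: "v \<noteq> []" "set u \<inter> set v = {}"
    using assms by (auto simp: permutations_of_set_def)
  have "(\<phi> (hd v) - \<phi> (last u)) * h v / den (u @ v) = (\<phi> (hd v) - \<phi> (last u)) / den (u @ v) * h v"
    by simp
  also have "\<dots> = (1 / z (last u) * (1 / z (hd v) * h v / den v) - t\<^sup>2 * \<psi> (last u) * (\<psi> (hd v) * h v / den v)) / den u"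
    unfolding den_append_phi_diff[OF assms(3) v] 
    by (simp add: diff_divide_distrib left_diff_distrib mult.assoc mult.left_commute)
  finally show "(\<phi> (hd v) - \<phi> (last u)) * h v / den (u @ v) 
    = (1 / z (last u) * (1 / z (hd v) * h v / den v) - t\<^sup>2 * \<psi> (last u) * (\<psi> (hd v) * h v / den v)) / den u" .
qed

text \<open>Of the two terms of \<open>sum_cut\<close>, the one with \<open>\<psi>\<close> at both
  ends of the tail vanishes. The cut leaves the end weight \<open>1 / z (last u)\<close> on the
  prefix.\<close>

lemma sum_cut_last_psi:
  assumes "finite T" "card T \<ge> 2" "u \<noteq> []" "set u \<inter> T = {}"
  shows "W T * (\<Sum>v\<in>permutations_of_set T. (\<phi> (hd v) - \<phi> (last u)) * \<psi> (last v) / den (u @ v))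
    = (- 1) ^ (card T - 1) * (1 / z (last u) / den u)"
proof -
  have "T \<noteq> {}" using assms(2) by auto
  then show ?thesis
    using assms W_nonzero[OF assms(1)]
    by (subst sum_cut) (simp_all add: sum_hd_inv_last_psi[simplified] sum_hd_psi_last_psi)
qed

text \<open>With \<open>1 / z\<close> at the end of the tail it is the other term of
  \<open>sum_cut\<close> that vanishes, and the prefix keeps \<open>\<psi> (last u)\<close>.\<close>

lemma sum_cut_last_inv:
  assumes "finite T" "card T \<ge> 2" "u \<noteq> []" "set u \<inter> T = {}"
  shows "W T * (\<Sum>v\<in>permutations_of_set T. (\<phi> (hd v) - \<phi> (last u)) * (1 / z (last v)) / den (u @ v))
    = - (t\<^sup>2 * \<psi> (last u) / den u)"
proof -
  have "T \<noteq> {}" using assms(2) by auto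
  then show ?thesis
    using assms W_nonzero[OF assms(1)]
    by (subst sum_cut) (simp_all add: sum_hd_inv_last_inv[simplified] sum_hd_psi_last_inv[simplified])
qed

section \<open>Chains with weights on an initial segment\<close>

text \<open>\<open>d\<close> is the element at position \<open>s\<close> and \<open>R\<close> the
  set of those before it. The weight \<open>G\<close> sees \<open>R\<close> only as a set, so the
  orderings of \<open>R\<close> are summed by \<open>sum_chain_to\<close>. Both partial chains
  contain \<open>d\<close>, so by \<open>chain_overlap\<close> no link is lost at the split.\<close>

lemma sum_pivot:
  assumes "finite E" "Suc s < card E"
  shows "(\<Sum>w\<in>permutations_of_set E. G (set (take s w)) (w ! s) * H (last w) / den w)
    = (\<Sum>d\<in>E. \<Sum>R | R \<subseteq> E - {d} \<and> card R = s. G R d * (\<Prod>c\<in>R. 1 / (z c - z d)) *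
        (\<Sum>v\<in>permutations_of_set (E - {d} - R). H (last v) / chain (z d # map z v)))"
proof -
  let ?V = "\<lambda>R d. \<Sum>v\<in>permutations_of_set (E - {d} - R). H (last v) / chain (z d # map z v)"
  have "(\<Sum>w\<in>permutations_of_set E. G (set (take s w)) (w ! s) * H (last w) / den w)
    = (\<Sum>R | R \<subseteq> E \<and> card R = s. \<Sum>d\<in>E - R. G R d * (\<Prod>c\<in>R. 1 / (z c - z d)) * ?V R d)"
    unfolding sum_permutations_split[OF assms(1) less_imp_le[OF Suc_lessD[OF assms(2)]]]
  proof (intro sum.cong refl)
    fix R assume "R \<in> {S. S \<subseteq> E \<and> card S = s}"
    then have R: "R \<subseteq> E" "card R = s" "finite R" using assms(1) finite_subset by auto
    then have "card (E - R) \<ge> 2" using assms by (simp add: card_Diff_subset)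
    then have "0 < card (E - R)" by (rule order.strict_trans2[rotated]) (rule zero_less_numeral)
    then have ne: "E - R \<noteq> {}" by (simp only: card_gt_0_iff) simp
    have inner: "(\<Sum>v\<in>permutations_of_set (E - R). G (set (take s (u @ v))) ((u @ v) ! s) * H (last (u @ v)) / den (u @ v))
      = (\<Sum>d\<in>E - R. G R d * (1 / chain (map z u @ [z d])) * ?V R d)" 
      if u: "u \<in> permutations_of_set R" for u
      unfolding sum_permutations_Cons[OF finite_Diff[OF assms(1)] ne]
    proof (intro sum.cong refl)
      fix d assume d: "d \<in> E - R"
      have u': "set u = R" "length u = s"
        using R(2) length_finite_permutations_of_set[OF u] permutations_of_setD(1)[OF u] by simp_all
      then have nth: "(u @ d # v) ! s = d" for v
        by (metis nth_append_length)
      have eq: "E - R - {d} = E - {d} - R" by auto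
      have "card (E - {d} - R) = card E - Suc s"
        using d R assms by (subst eq[symmetric]) (simp add: card_Diff_subset)
      then have "E - {d} - R \<noteq> {}" using assms(2) by (metis card.empty diff_is_0_eq not_le)
      then have v: "v \<noteq> []" if "v \<in> permutations_of_set (E - {d} - R)" for v
        using permutations_of_setD(1)[OF that] by (metis set_empty)
      have den: "den (u @ d # v) = chain (map z u @ [z d]) * chain (z d # map z v)" for v
        unfolding map_append list.map by (rule chain_overlap)
      have "G (set (take s (u @ d # v))) ((u @ d # v) ! s) * H (last (u @ d # v)) / den (u @ d # v)
        = G R d * (1 / chain (map z u @ [z d])) * (H (last v) / chain (z d # map z v))"
        if "v \<in> permutations_of_set (E - {d} - R)" for v
      proof -
        have "take s (u @ d # v) = u" "last (u @ d # v) = last v"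
          using u'(2) v[OF that] by auto
        then show ?thesis
          unfolding den nth by (simp only: u'(1)) (simp only: times_divide_times_eq times_divide_eq_right times_divide_eq_left mult_1_right divide_divide_eq_left mult.assoc)
      qed
      then have "(\<Sum>v\<in>permutations_of_set (E - {d} - R). G (set (take s (u @ d # v))) ((u @ d # v) ! s) * H (last (u @ d # v)) / den (u @ d # v))
        = (\<Sum>v\<in>permutations_of_set (E - {d} - R). G R d * (1 / chain (map z u @ [z d])) * (H (last v) / chain (z d # map z v)))"
        by (rule sum.cong[OF refl])
      then show "(\<Sum>v\<in>permutations_of_set (E - R - {d}). G (set (take s (u @ d # v))) ((u @ d # v) ! s) * H (last (u @ d # v)) / den (u @ d # v))
        = G R d * (1 / chain (map z u @ [z d])) * ?V R d"
        unfolding eq sum_distrib_left .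
    qed
    have "(\<Sum>u\<in>permutations_of_set R. \<Sum>v\<in>permutations_of_set (E - R). G (set (take s (u @ v))) ((u @ v) ! s) * H (last (u @ v)) / den (u @ v))
      = (\<Sum>u\<in>permutations_of_set R. \<Sum>d\<in>E - R. G R d * (1 / chain (map z u @ [z d])) * ?V R d)"
      by (rule sum.cong[OF refl]) (rule inner)
    also have "\<dots> = (\<Sum>d\<in>E - R. \<Sum>u\<in>permutations_of_set R. G R d * (1 / chain (map z u @ [z d])) * ?V R d)"
      by (rule sum.swap)
    also have "\<dots> = (\<Sum>d\<in>E - R. G R d * (\<Prod>c\<in>R. 1 / (z c - z d)) * ?V R d)"
    proof (rule sum.cong[OF refl])
      fix d assume "d \<in> E - R"
      then have "z d \<notin> z ` R" by (auto simp: z_eq_iff)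
      then show "(\<Sum>u\<in>permutations_of_set R. G R d * (1 / chain (map z u @ [z d])) * ?V R d)
        = G R d * (\<Prod>c\<in>R. 1 / (z c - z d)) * ?V R d"
        by (simp only: sum_distrib_left[symmetric] sum_distrib_right[symmetric] sum_chain_to[OF R(3) inj_on_z \<open>z d \<notin> z ` R\<close>])
    qed
    finally show "(\<Sum>u\<in>permutations_of_set R. \<Sum>v\<in>permutations_of_set (E - R). G (set (take s (u @ v))) ((u @ v) ! s) * H (last (u @ v)) / den (u @ v))
      = (\<Sum>d\<in>E - R. G R d * (\<Prod>c\<in>R. 1 / (z c - z d)) * ?V R d)" .
  qed
  also have "\<dots> = (\<Sum>R | R \<subseteq> E \<and> card R = s. \<Sum>d | d \<in> E \<and> d \<notin> R. G R d * (\<Prod>c\<in>R. 1 / (z c - z d)) * ?V R d)"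
    by (simp only: set_diff_eq)
  also have "\<dots> = (\<Sum>d\<in>E. \<Sum>R | R \<in> {R. R \<subseteq> E \<and> card R = s} \<and> d \<notin> R. G R d * (\<Prod>c\<in>R. 1 / (z c - z d)) * ?V R d)"
    by (rule sum.swap_restrict) (use assms in auto)
  also have "\<dots> = (\<Sum>d\<in>E. \<Sum>R | R \<subseteq> E - {d} \<and> card R = s. G R d * (\<Prod>c\<in>R. 1 / (z c - z d)) * ?V R d)"
    by (rule sum.cong[OF refl], rule sum.cong) auto
  finally show ?thesis .
qed

lemma prod_one_div_diff:
  assumes "R \<subseteq> B" "finite B"
  shows "(\<Prod>c\<in>R. 1 / (z c - x)) * (1 / (\<Prod>c\<in>B - R. x - z c)) = (- 1) ^ card R / (\<Prod>c\<in>B. x - z c)"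
proof -
  have "(\<Prod>c\<in>R. 1 / (z c - x)) = (- 1) ^ card R * (1 / (\<Prod>c\<in>R. x - z c))"
  proof -
    have "(\<Prod>c\<in>R. 1 / (z c - x)) = (\<Prod>c\<in>R. - 1 * (1 / (x - z c)))"
      by (intro prod.cong refl) (metis minus_diff_eq minus_divide_right mult_minus1)
    then show ?thesis by (simp only: prod.distrib prod_constant prod_dividef) simp
  qed
  moreover have "(\<Prod>c\<in>B. x - z c) = (\<Prod>c\<in>R. x - z c) * (\<Prod>c\<in>B - R. x - z c)"
    using prod.subset_diff[OF assms] by (simp add: mult.commute)
  ultimately show ?thesis by simp
qed

text \<open>Pivot at \<open>d\<close>, the last position that carries \<open>\<phi>\<close>. After
  cancellation with \<open>W E\<close> the numerator contains the product of \<open>z\<close> over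
  the elements outside \<open>insert d R\<close>; summing over \<open>R\<close> gives an elementary
  symmetric function of degree \<open>card E - 1 - s\<close>, and orthogonality selects the single
  power \<open>t ^ s\<close>.\<close>

lemma sum_front_last_psi:
  assumes "finite E" "Suc s < card E"
  shows "W E * (\<Sum>w\<in>permutations_of_set E. (\<Prod>c\<in>set (take (Suc s) w). \<phi> c) * \<psi> (last w) / den w)
    = (- 1) ^ (card E - 1) * of_nat ((card E - s - 2) choose s) * t ^ s"
proof -
  let ?n = "card E"
  have "W E * (\<Sum>w\<in>permutations_of_set E. (\<Prod>c\<in>set (take (Suc s) w). \<phi> c) * \<psi> (last w) / den w)
    = W E * (\<Sum>w\<in>permutations_of_set E. (\<Prod>c\<in>insert (w ! s) (set (take s w)). \<phi> c) * \<psi> (last w) / den w)"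
    using assms by (intro arg_cong[where f = "(*) (W E)"] sum.cong refl)
      (auto simp: take_Suc_conv_app_nth dest!: length_finite_permutations_of_set)
  also have "\<dots> = (\<Sum>d\<in>E. \<Sum>R | R \<subseteq> E - {d} \<and> card R = s.
     W E * ((\<Prod>c\<in>insert d R. \<phi> c) * (\<Prod>c\<in>R. 1 / (z c - z d)) *
        (\<Sum>v\<in>permutations_of_set (E - {d} - R). \<psi> (last v) / chain (z d # map z v))))"
    by (subst sum_pivot[OF assms, where G = "\<lambda>R d. \<Prod>c\<in>insert d R. \<phi> c"]) (simp add: sum_distrib_left)
  also have "\<dots> = (\<Sum>d\<in>E. \<Sum>R | R \<subseteq> E - {d} \<and> card R = s.
      (- 1) ^ s * ((1 + t * z d) ^ (?n - s - 2) * (\<Prod>c\<in>E - {d} - R. z c) / (\<Prod>c\<in>E - {d}. z d - z c)))"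
  proof (intro sum.cong refl)
    fix d R assume d: "d \<in> E" and "R \<in> {R. R \<subseteq> E - {d} \<and> card R = s}"
    then have R: "R \<subseteq> E - {d}" "card R = s" "finite R" using assms(1) finite_subset by fastforce+
    let ?T = "E - {d} - R"
    have T: "?T = E - insert d R" by auto
    have cT: "card ?T = ?n - Suc s"
      using R d assms(1) unfolding T by (subst card_Diff_subset) (auto simp: card_insert_if)
    then have neT: "?T \<noteq> {}" using assms(2) by (metis card.empty diff_is_0_eq not_le)
    have "W E = W (insert d R) * W ?T"
      unfolding T using R d assms(1) by (intro W_Un) auto
    then have 1: "W E * (\<Prod>c\<in>insert d R. \<phi> c) = W ?T"
      using W_prod_phi[of "insert d R"] R by (simp add: mult.commute mult.left_commute del: prod.insert)
    have 2: "W ?T * ((1 + t * z d) ^ (?n - s - 2) / (\<Prod>c\<in>?T. (z d - z c) * (1 + t * z c))) 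
      = (1 + t * z d) ^ (?n - s - 2) * (\<Prod>c\<in>?T. z c) * (1 / (\<Prod>c\<in>?T. z d - z c))"
      using assms(1) one_plus_nonzero by (simp add: W_def prod.distrib)
    have "W E * ((\<Prod>c\<in>insert d R. \<phi> c) * (\<Prod>c\<in>R. 1 / (z c - z d)) *
        (\<Sum>v\<in>permutations_of_set ?T. \<psi> (last v) / chain (z d # map z v)))
      = W ?T * ((1 + t * z d) ^ (?n - s - 2) / (\<Prod>c\<in>?T. (z d - z c) * (1 + t * z c))) * (\<Prod>c\<in>R. 1 / (z c - z d))"
      using assms(1) neT cT
      by (subst sum_from_psi) (auto simp: z_eq_iff 1[symmetric] simp del: prod.insert)
    also have "\<dots> = (1 + t * z d) ^ (?n - s - 2) * (\<Prod>c\<in>?T. z c) * ((\<Prod>c\<in>R. 1 / (z c - z d)) * (1 / (\<Prod>c\<in>?T. z d - z c)))"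
      unfolding 2 by simp
    finally show "W E * ((\<Prod>c\<in>insert d R. \<phi> c) * (\<Prod>c\<in>R. 1 / (z c - z d)) *
        (\<Sum>v\<in>permutations_of_set ?T. \<psi> (last v) / chain (z d # map z v)))
      = (- 1) ^ s * ((1 + t * z d) ^ (?n - s - 2) * (\<Prod>c\<in>?T. z c) / (\<Prod>c\<in>E - {d}. z d - z c))"
      using R assms(1) by (subst (asm) prod_one_div_diff) auto
  qed
  also have "\<dots> = (- 1) ^ s * (\<Sum>d\<in>E. (1 + t * z d) ^ (?n - s - 2) * esym (?n - 1 - s) (E - {d}) z / (\<Prod>c\<in>E - {d}. z d - z c))"
    unfolding sum_distrib_left
  proof (intro sum.cong refl)
    fix d assume d: "d \<in> E"
    then have "esym (?n - 1 - s) (E - {d}) z = (\<Sum>R | R \<subseteq> E - {d} \<and> card R = s. \<Prod>c\<in>E - {d} - R. z c)"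
      using assms by (subst sum_subsets_prod_compl) auto
    then show "(\<Sum>R | R \<subseteq> E - {d} \<and> card R = s.
      (- 1) ^ s * ((1 + t * z d) ^ (?n - s - 2) * (\<Prod>c\<in>E - {d} - R. z c) / (\<Prod>c\<in>E - {d}. z d - z c)))
      = (- 1) ^ s * ((1 + t * z d) ^ (?n - s - 2) * esym (?n - 1 - s) (E - {d}) z / (\<Prod>c\<in>E - {d}. z d - z c))"
      by (simp add: sum_distrib_left sum_divide_distrib)
  qed
  also have "\<dots> = (- 1) ^ s * (of_nat ((?n - s - 2) choose s) * t ^ s * (- 1) ^ (?n - 1 - s))"
    using assms by (subst esym_orthogonality_binomial[OF _ inj_on_z]) auto
  also have "\<dots> = (- 1) ^ (s + (?n - 1 - s)) * of_nat ((?n - s - 2) choose s) * t ^ s"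
    unfolding power_add by simp
  also have "s + (?n - 1 - s) = ?n - 1" using assms(2) by simp
  finally show ?thesis .
qed

text \<open>The roles of \<open>z\<close> and \<open>1 + t * z\<close> are exchanged compared with
  \<open>sum_front_last_psi\<close>: the power of the pivot is now one of \<open>z d\<close>, and
  the product over the complement is expanded in powers of \<open>t\<close>. Orthogonality leaves
  only \<open>i = Suc s\<close>.\<close>

lemma sum_front_last_inv:
  assumes "finite E" "Suc s < card E"
  shows "W E * (\<Sum>w\<in>permutations_of_set E. (\<Prod>c\<in>set (take (Suc s) w). \<phi> c) * (1 / z (last w)) / den w)
    = - (of_nat ((card E - s - 2) choose s) * t ^ Suc s)"
proof -
  let ?n = "card E"
  have "W E * (\<Sum>w\<in>permutations_of_set E. (\<Prod>c\<in>set (take (Suc s) w). \<phi> c) * (1 / z (last w)) / den w)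
    = W E * (\<Sum>w\<in>permutations_of_set E. (\<Prod>c\<in>insert (w ! s) (set (take s w)). \<phi> c) * (1 / z (last w)) / den w)"
    using assms by (intro arg_cong[where f = "(*) (W E)"] sum.cong refl)
      (auto simp: take_Suc_conv_app_nth dest!: length_finite_permutations_of_set)
  also have "\<dots> = (\<Sum>d\<in>E. \<Sum>R | R \<subseteq> E - {d} \<and> card R = s.
     W E * ((\<Prod>c\<in>insert d R. \<phi> c) * (\<Prod>c\<in>R. 1 / (z c - z d)) *
        (\<Sum>v\<in>permutations_of_set (E - {d} - R). 1 / z (last v) / chain (z d # map z v))))"
    by (subst sum_pivot[OF assms, where G = "\<lambda>R d. \<Prod>c\<in>insert d R. \<phi> c" and H = "\<lambda>c. 1 / z c"]) 
      (simp add: sum_distrib_left)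
  also have "\<dots> = (\<Sum>d\<in>E. \<Sum>R | R \<subseteq> E - {d} \<and> card R = s.
      (- 1) ^ s * (z d ^ (?n - s - 2) * (\<Prod>c\<in>E - {d} - R. 1 + t * z c) / (\<Prod>c\<in>E - {d}. z d - z c)))"
  proof (intro sum.cong refl)
    fix d R assume d: "d \<in> E" and "R \<in> {R. R \<subseteq> E - {d} \<and> card R = s}"
    then have R: "R \<subseteq> E - {d}" "card R = s" "finite R" using assms(1) finite_subset by fastforce+
    let ?T = "E - {d} - R"
    have T: "?T = E - insert d R" by auto
    have cT: "card ?T = ?n - Suc s"
      using R d assms(1) unfolding T by (subst card_Diff_subset) (auto simp: card_insert_if)
    then have neT: "?T \<noteq> {}" using assms(2) by (metis card.empty diff_is_0_eq not_le)
    have "W E = W (insert d R) * W ?T"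
      unfolding T using R d assms(1) by (intro W_Un) auto
    then have 1: "W E * (\<Prod>c\<in>insert d R. \<phi> c) = W ?T"
      using W_prod_phi[of "insert d R"] R by (simp add: mult.commute mult.left_commute del: prod.insert)
    have 2: "W ?T * (z d ^ (?n - s - 2) / (\<Prod>c\<in>?T. (z d - z c) * z c)) 
      = z d ^ (?n - s - 2) * (\<Prod>c\<in>?T. 1 + t * z c) * (1 / (\<Prod>c\<in>?T. z d - z c))"
      using assms(1) z_nonzero by (simp add: W_def prod.distrib)
    have "W E * ((\<Prod>c\<in>insert d R. \<phi> c) * (\<Prod>c\<in>R. 1 / (z c - z d)) *
        (\<Sum>v\<in>permutations_of_set ?T. 1 / z (last v) / chain (z d # map z v)))
      = W ?T * (z d ^ (?n - s - 2) / (\<Prod>c\<in>?T. (z d - z c) * z c)) * (\<Prod>c\<in>R. 1 / (z c - z d))"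
      using assms(1) neT cT
      by (subst sum_from_inv) (auto simp: z_eq_iff 1[symmetric] simp del: prod.insert)
    also have "\<dots> = z d ^ (?n - s - 2) * (\<Prod>c\<in>?T. 1 + t * z c) * ((\<Prod>c\<in>R. 1 / (z c - z d)) * (1 / (\<Prod>c\<in>?T. z d - z c)))"
      unfolding 2 by simp
    finally show "W E * ((\<Prod>c\<in>insert d R. \<phi> c) * (\<Prod>c\<in>R. 1 / (z c - z d)) *
        (\<Sum>v\<in>permutations_of_set ?T. 1 / z (last v) / chain (z d # map z v)))
      = (- 1) ^ s * (z d ^ (?n - s - 2) * (\<Prod>c\<in>?T. 1 + t * z c) / (\<Prod>c\<in>E - {d}. z d - z c))"
      using R assms(1) by (subst (asm) prod_one_div_diff) auto
  qed
  also have "\<dots> = (\<Sum>d\<in>E. \<Sum>i\<le>?n - 1. (- 1) ^ s * of_nat ((?n - 1 - i) choose s) * t ^ i *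
      (z d ^ (?n - s - 2) * esym i (E - {d}) z / (\<Prod>c\<in>E - {d}. z d - z c)))"
  proof (intro sum.cong refl)
    fix d assume d: "d \<in> E"
    then have "(\<Sum>R | R \<subseteq> E - {d} \<and> card R = s. \<Prod>c\<in>E - {d} - R. 1 + t * z c)
      = (\<Sum>i\<le>?n - 1. of_nat ((?n - 1 - i) choose s) * t ^ i * esym i (E - {d}) z)"
      using assms by (subst sum_subsets_prod_one_plus_compl) auto
    then have "(- 1) ^ s * (z d ^ (?n - s - 2) / (\<Prod>c\<in>E - {d}. z d - z c)) * (\<Sum>R | R \<subseteq> E - {d} \<and> card R = s. \<Prod>c\<in>E - {d} - R. 1 + t * z c)
      = (- 1) ^ s * (z d ^ (?n - s - 2) / (\<Prod>c\<in>E - {d}. z d - z c)) * (\<Sum>i\<le>?n - 1. of_nat ((?n - 1 - i) choose s) * t ^ i * esym i (E - {d}) z)"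
      by simp
    then show "(\<Sum>R | R \<subseteq> E - {d} \<and> card R = s.
      (- 1) ^ s * (z d ^ (?n - s - 2) * (\<Prod>c\<in>E - {d} - R. 1 + t * z c) / (\<Prod>c\<in>E - {d}. z d - z c)))
      = (\<Sum>i\<le>?n - 1. (- 1) ^ s * of_nat ((?n - 1 - i) choose s) * t ^ i *
      (z d ^ (?n - s - 2) * esym i (E - {d}) z / (\<Prod>c\<in>E - {d}. z d - z c)))"
      unfolding sum_distrib_left by (simp add: mult_ac)
  qed
  also have "\<dots> = (\<Sum>i\<le>?n - 1. (- 1) ^ s * of_nat ((?n - 1 - i) choose s) * t ^ i *
      (\<Sum>d\<in>E. z d ^ (?n - s - 2) * esym i (E - {d}) z / (\<Prod>c\<in>E - {d}. z d - z c)))"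
    by (subst sum.swap) (simp add: sum_distrib_left)
  also have "\<dots> = (\<Sum>i\<le>?n - 1. if i = Suc s then (- 1) ^ s * of_nat ((?n - s - 2) choose s) * t ^ Suc s * (- 1) ^ Suc s else 0)"
  proof (intro sum.cong refl)
    fix i assume "i \<in> {..?n - 1}"
    then have i: "i < ?n" using assms(2) by auto
    have "?n - s - 2 + i + 1 = ?n \<longleftrightarrow> i = Suc s" using assms(2) by auto
    moreover have "?n - s - 2 < ?n" using assms(2) by auto
    ultimately have *: "(\<Sum>d\<in>E. z d ^ (?n - s - 2) * esym i (E - {d}) z / (\<Prod>c\<in>E - {d}. z d - z c))
      = (if i = Suc s then (- 1) ^ i else 0)"
      using esym_orthogonality[OF assms(1) inj_on_z _ i, of "?n - s - 2"] by simp
    have "?n - 1 - Suc s = ?n - s - 2" by simp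
    then show "(- 1) ^ s * of_nat ((?n - 1 - i) choose s) * t ^ i *
      (\<Sum>d\<in>E. z d ^ (?n - s - 2) * esym i (E - {d}) z / (\<Prod>c\<in>E - {d}. z d - z c))
      = (if i = Suc s then (- 1) ^ s * of_nat ((?n - s - 2) choose s) * t ^ Suc s * (- 1) ^ Suc s else 0)"
      unfolding * by simp
  qed
  also have "\<dots> = - (of_nat ((?n - s - 2) choose s) * t ^ Suc s)"
    using assms(2) by (simp add: sum.delta' minus_one_power_iff)
  finally show ?thesis .
qed

end

section \<open>Tails with a basis element at their second place\<close>

lemma sum_singletons:
  "finite B \<Longrightarrow> (\<Sum>R | R \<subseteq> B \<and> card R = 1. g R) = (\<Sum>a\<in>B. g {a})"
  by (rule sum.reindex_bij_witness[where i = "\<lambda>a. {a}" and j = the_elem])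
    (auto simp: card_Suc_eq)

lemma esym_card: "finite B \<Longrightarrow> esym (card B) B u = (\<Prod>c\<in>B. u c)"
proof -
  assume "finite B"
  then have "{S. S \<subseteq> B \<and> card S = card B} = {B}" by (auto dest: card_subset_eq)
  then show ?thesis by (simp add: esym_def)
qed

lemma sum_prod_remove: 
  fixes u :: "'a \<Rightarrow> 'b::comm_ring_1"
  assumes "finite B"
  shows "(\<Sum>a\<in>B. u a * (\<Prod>c\<in>B - {a}. u c)) = of_nat (card B) * esym (card B) B u"
  using assms by (simp add: esym_card prod.remove[symmetric])

context chain_weights
begin

text \<open>\<open>sum_pivot\<close> with \<open>s = 1\<close>: \<open>d\<close> is the second
  element and \<open>a\<close> the first. The weight \<open>f\<close> of the first element stays
  open because \<open>sum_cut\<close> requires both \<open>1 / z\<close> and \<open>\<psi>\<close>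
  there.\<close>

lemma sum_second_psi:
  assumes "finite T" "card T \<ge> 3"
  shows "W T * (\<Sum>v\<in>permutations_of_set T. f (hd v) * (\<phi> (v ! 1) * \<psi> (last v)) / den v)
    = - (\<Sum>d\<in>T. (1 + t * z d) ^ (card T - 3) *
        (\<Sum>a\<in>T - {d}. f a * (z a * (1 + t * z a)) * (\<Prod>c\<in>T - {d} - {a}. z c)) / (\<Prod>c\<in>T - {d}. z d - z c))"
proof -
  have "(\<Sum>v\<in>permutations_of_set T. f (hd v) * (\<phi> (v ! 1) * \<psi> (last v)) / den v)
    = (\<Sum>v\<in>permutations_of_set T. (\<Prod>c\<in>set (take 1 v). f c) * \<phi> (v ! 1) * \<psi> (last v) / den v)"
  proof (rule sum.cong[OF refl])
    fix v assume "v \<in> permutations_of_set T"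
    then have "length v = card T" by (rule length_finite_permutations_of_set)
    then have "v \<noteq> []" using assms(2) by auto
    then show "f (hd v) * (\<phi> (v ! 1) * \<psi> (last v)) / den v
      = (\<Prod>c\<in>set (take 1 v). f c) * \<phi> (v ! 1) * \<psi> (last v) / den v"
      by (cases v) auto
  qed
  also have "\<dots> = (\<Sum>d\<in>T. \<Sum>a\<in>T - {d}. f a * \<phi> d * (1 / (z a - z d)) *
        (\<Sum>v\<in>permutations_of_set (T - {d} - {a}). \<psi> (last v) / chain (z d # map z v)))"
    using assms by (subst sum_pivot[where G = "\<lambda>R d. (\<Prod>c\<in>R. f c) * \<phi> d"]) (simp_all add: sum_singletons[simplified])
  finally have *: "W T * (\<Sum>v\<in>permutations_of_set T. f (hd v) * (\<phi> (v ! 1) * \<psi> (last v)) / den v) 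
    = (\<Sum>d\<in>T. \<Sum>a\<in>T - {d}. W T * (f a * \<phi> d * (1 / (z a - z d)) *
        (\<Sum>v\<in>permutations_of_set (T - {d} - {a}). \<psi> (last v) / chain (z d # map z v))))"
    by (simp only: sum_distrib_left)
  show ?thesis
    unfolding * sum_negf[symmetric]
  proof (rule sum.cong[OF refl])
    fix d assume d: "d \<in> T"
    have "(\<Sum>a\<in>T - {d}. W T * (f a * \<phi> d * (1 / (z a - z d)) *
        (\<Sum>v\<in>permutations_of_set (T - {d} - {a}). \<psi> (last v) / chain (z d # map z v))))
      = (\<Sum>a\<in>T - {d}. - ((1 + t * z d) ^ (card T - 3) *
        (f a * (z a * (1 + t * z a)) * (\<Prod>c\<in>T - {d} - {a}. z c)) / (\<Prod>c\<in>T - {d}. z d - z c)))"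
    proof (rule sum.cong[OF refl])
      fix a assume a: "a \<in> T - {d}"
      let ?U = "T - {d} - {a}"
      have cU: "card ?U = card T - 2" using a d assms(1) by simp
      then have neU: "?U \<noteq> {}" using assms(2) by (metis card.empty diff_is_0_eq not_less_eq_eq numeral_2_eq_2 numeral_3_eq_3)
      have "W T = z d * (1 + t * z d) * (z a * (1 + t * z a)) * W ?U"
        unfolding W_def prod.remove[OF assms(1) d]
        by (subst prod.remove[OF _ a]) (use assms(1) in simp_all)
      then have 1: "W T * \<phi> d = (z a * (1 + t * z a)) * W ?U"
        by (simp add: \<phi>_def z_nonzero one_plus_nonzero)
      have 2: "W ?U * ((1 + t * z d) ^ (card T - 3) / (\<Prod>c\<in>?U. (z d - z c) * (1 + t * z c))) 
        = (1 + t * z d) ^ (card T - 3) * (\<Prod>c\<in>?U. z c) * (1 / (\<Prod>c\<in>?U. z d - z c))"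
        using assms(1) one_plus_nonzero by (simp add: W_def prod.distrib)
      have 3: "1 / (z a - z d) * (1 / (\<Prod>c\<in>?U. z d - z c)) = - (1 / (\<Prod>c\<in>T - {d}. z d - z c))"
        using prod_one_div_diff[of "{a}" "T - {d}" "z d"] a assms(1) by simp
      have "z d \<notin> z ` ?U" by (auto simp: z_eq_iff)
      then have "(\<Sum>v\<in>permutations_of_set ?U. \<psi> (last v) / chain (z d # map z v)) 
        = (1 + t * z d) ^ (card T - 3) / (\<Prod>c\<in>?U. (z d - z c) * (1 + t * z c))"
        using sum_from_psi[of ?U "z d"] assms(1) neU cU by simp
      then have "W T * (f a * \<phi> d * (1 / (z a - z d)) * (\<Sum>v\<in>permutations_of_set ?U. \<psi> (last v) / chain (z d # map z v)))
        = f a * (W T * \<phi> d) * (1 / (z a - z d)) * ((1 + t * z d) ^ (card T - 3) / (\<Prod>c\<in>?U. (z d - z c) * (1 + t * z c)))"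
        by (simp only: mult_ac)
      also have "\<dots> = f a * (z a * (1 + t * z a)) * (1 / (z a - z d)) * (W ?U * ((1 + t * z d) ^ (card T - 3) / (\<Prod>c\<in>?U. (z d - z c) * (1 + t * z c))))"
        unfolding 1 by (simp only: mult_ac)
      also have "\<dots> = f a * (z a * (1 + t * z a)) * (1 + t * z d) ^ (card T - 3) * (\<Prod>c\<in>?U. z c) * (1 / (z a - z d) * (1 / (\<Prod>c\<in>?U. z d - z c)))"
        unfolding 2 by (simp only: mult_ac)
      also have "\<dots> = - ((1 + t * z d) ^ (card T - 3) *
        (f a * (z a * (1 + t * z a)) * (\<Prod>c\<in>?U. z c)) / (\<Prod>c\<in>T - {d}. z d - z c))"
        unfolding 3 by (simp add: mult_ac)
      finally show "W T * (f a * \<phi> d * (1 / (z a - z d)) * (\<Sum>v\<in>permutations_of_set ?U. \<psi> (last v) / chain (z d # map z v)))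
        = - ((1 + t * z d) ^ (card T - 3) *
        (f a * (z a * (1 + t * z a)) * (\<Prod>c\<in>?U. z c)) / (\<Prod>c\<in>T - {d}. z d - z c))" .
    qed
    then show "(\<Sum>a\<in>T - {d}. W T * (f a * \<phi> d * (1 / (z a - z d)) *
        (\<Sum>v\<in>permutations_of_set (T - {d} - {a}). \<psi> (last v) / chain (z d # map z v))))
      = - ((1 + t * z d) ^ (card T - 3) *
        (\<Sum>a\<in>T - {d}. f a * (z a * (1 + t * z a)) * (\<Prod>c\<in>T - {d} - {a}. z c)) / (\<Prod>c\<in>T - {d}. z d - z c))"
      by (simp only: sum_negf sum_distrib_left sum_divide_distrib)
  qed
qed

text \<open>For \<open>f a = 1 / z a\<close> the weight \<open>f a * (z a * (1 + t * z a))\<close>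
  is \<open>1 + t * z a\<close> and produces two elementary symmetric functions. They contribute
  \<open>card T - 3\<close> and \<open>card T - 1\<close> with opposite signs, whence the constant
  \<open>2\<close>.\<close>

lemma sum_second_psi_inv:
  assumes "finite T" "card T \<ge> 3"
  shows "W T * (\<Sum>v\<in>permutations_of_set T. 1 / z (hd v) * (\<phi> (v ! 1) * \<psi> (last v)) / den v)
    = - 2 * t * (- 1) ^ (card T - 1)"
proof -
  let ?m = "card T"
  have "(\<Sum>a\<in>T - {d}. 1 / z a * (z a * (1 + t * z a)) * (\<Prod>c\<in>T - {d} - {a}. z c)) 
    = esym (?m - 2) (T - {d}) z + of_nat (?m - 1) * t * esym (?m - 1) (T - {d}) z" if "d \<in> T" for d
  proof -
    have "(\<Sum>a\<in>T - {d}. 1 / z a * (z a * (1 + t * z a)) * (\<Prod>c\<in>T - {d} - {a}. z c))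
      = (\<Sum>a\<in>T - {d}. (\<Prod>c\<in>T - {d} - {a}. z c)) + t * (\<Sum>a\<in>T - {d}. z a * (\<Prod>c\<in>T - {d} - {a}. z c))"
      unfolding sum_distrib_left sum.distrib[symmetric]
      by (rule sum.cong[OF refl]) (simp add: z_nonzero algebra_simps)
    moreover have "(\<Sum>a\<in>T - {d}. (\<Prod>c\<in>T - {d} - {a}. z c)) = esym (?m - 2) (T - {d}) z"
      using sum_subsets_prod_compl[of "T - {d}" 1 z] assms that sum_singletons[of "T - {d}" "\<lambda>R. \<Prod>c\<in>T - {d} - R. z c"]
      by (simp add: numeral_2_eq_2)
    moreover have "(\<Sum>a\<in>T - {d}. z a * (\<Prod>c\<in>T - {d} - {a}. z c)) = of_nat (?m - 1) * esym (?m - 1) (T - {d}) z"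
      using sum_prod_remove[of "T - {d}" z] assms(1) that by simp
    ultimately show ?thesis by simp
  qed
  then have "W T * (\<Sum>v\<in>permutations_of_set T. 1 / z (hd v) * (\<phi> (v ! 1) * \<psi> (last v)) / den v)
    = - (\<Sum>d\<in>T. (1 + t * z d) ^ (?m - 3) * 
        (esym (?m - 2) (T - {d}) z + of_nat (?m - 1) * t * esym (?m - 1) (T - {d}) z) / (\<Prod>c\<in>T - {d}. z d - z c))"
    unfolding sum_second_psi[OF assms, of "\<lambda>a. 1 / z a"]
    by (intro arg_cong[where f = uminus] sum.cong refl) (simp only:)
  also have "\<dots> = - ((\<Sum>d\<in>T. (1 + t * z d) ^ (?m - 3) * esym (?m - 2) (T - {d}) z / (\<Prod>c\<in>T - {d}. z d - z c))
      + of_nat (?m - 1) * t * (\<Sum>d\<in>T. (1 + t * z d) ^ (?m - 3) * esym (?m - 1) (T - {d}) z / (\<Prod>c\<in>T - {d}. z d - z c)))"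
    unfolding sum_distrib_left sum.distrib[symmetric]
    by (intro arg_cong[where f = uminus] sum.cong[OF refl]) (simp add: algebra_simps add_divide_distrib)
  also have "\<dots> = - (of_nat (?m - 3) * t * (- 1) ^ (?m - 2) + of_nat (?m - 1) * t * (- 1) ^ (?m - 1))"
  proof -
    have "?m - 1 - (?m - 2) = 1" "?m - 1 - (?m - 1) = 0" using assms(2) by auto
    then show ?thesis
      using esym_orthogonality_binomial[OF assms(1) inj_on_z, of "?m - 3" "?m - 2" t]
        esym_orthogonality_binomial[OF assms(1) inj_on_z, of "?m - 3" "?m - 1" t] assms(2) by simp
  qed
  also have "\<dots> = - 2 * t * (- 1) ^ (?m - 1)"
  proof -
    obtain m' where "?m = m' + 3" using assms(2) by (metis add.commute le_Suc_ex)
    then show ?thesis by (simp add: numeral_3_eq_3 algebra_simps)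
  qed
  finally show ?thesis .
qed

text \<open>For \<open>f = \<psi>\<close> the weight reduces to \<open>z a\<close>. Every
  \<open>a\<close> completes the same full product, which gives the factor
  \<open>card T - 1\<close>.\<close>

lemma sum_second_psi_psi:
  assumes "finite T" "card T \<ge> 3"
  shows "W T * (\<Sum>v\<in>permutations_of_set T. \<psi> (hd v) * (\<phi> (v ! 1) * \<psi> (last v)) / den v)
    = - of_nat (card T - 1) * (- 1) ^ (card T - 1)"
proof -
  let ?m = "card T"
  have "(\<Sum>a\<in>T - {d}. \<psi> a * (z a * (1 + t * z a)) * (\<Prod>c\<in>T - {d} - {a}. z c)) 
    = of_nat (?m - 1) * esym (?m - 1) (T - {d}) z" if "d \<in> T" for d
    using sum_prod_remove[of "T - {d}" z] assms(1) that by (simp add: \<psi>_def one_plus_nonzero)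
  then have "W T * (\<Sum>v\<in>permutations_of_set T. \<psi> (hd v) * (\<phi> (v ! 1) * \<psi> (last v)) / den v)
    = - (\<Sum>d\<in>T. (1 + t * z d) ^ (?m - 3) * (of_nat (?m - 1) * esym (?m - 1) (T - {d}) z) / (\<Prod>c\<in>T - {d}. z d - z c))"
    unfolding sum_second_psi[OF assms, of \<psi>]
    by (intro arg_cong[where f = uminus] sum.cong refl) (simp only:)
  also have "\<dots> = - (of_nat (?m - 1) * (\<Sum>d\<in>T. (1 + t * z d) ^ (?m - 3) * esym (?m - 1) (T - {d}) z / (\<Prod>c\<in>T - {d}. z d - z c)))"
    by (simp only: sum_distrib_left mult_ac times_divide_eq_right)
  also have "(\<Sum>d\<in>T. (1 + t * z d) ^ (?m - 3) * esym (?m - 1) (T - {d}) z / (\<Prod>c\<in>T - {d}. z d - z c)) = (- 1) ^ (?m - 1)"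
    using esym_orthogonality_binomial[OF assms(1) inj_on_z, of "?m - 3" "?m - 1" t] assms(2) by simp
  also have "- (of_nat (?m - 1) * (- 1) ^ (?m - 1)) = - of_nat (?m - 1) * (- 1 :: 'k) ^ (?m - 1)"
    by (rule minus_mult_left)
  finally show ?thesis .
qed

text \<open>What a cut in front of \<open>p\<close> leaves on the prefix when \<open>q\<close> sits
  directly behind \<open>p\<close>: the tail carries \<open>\<phi>\<close> at its second place,
  neither term of \<open>sum_cut\<close> vanishes in general, and both kinds of end weight
  occur.\<close>

lemma sum_cut_second_psi:
  assumes "finite T" "card T \<ge> 3" "u \<noteq> []" "set u \<inter> T = {}"
  shows "W T * (\<Sum>v\<in>permutations_of_set T. (\<phi> (hd v) - \<phi> (last u)) * (\<phi> (v ! 1) * \<psi> (last v)) / den (u @ v))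
    = (- 1) ^ (card T - 1) * (of_nat (card T - 1) * t\<^sup>2 * \<psi> (last u) - 2 * t / z (last u)) / den u"
proof -
  have T: "T \<noteq> {}" using assms(2) by auto
  have "W T * (\<Sum>v\<in>permutations_of_set T. (\<phi> (hd v) - \<phi> (last u)) * (\<phi> (v ! 1) * \<psi> (last v)) / den (u @ v))
    = (1 / z (last u) * (W T * (\<Sum>v\<in>permutations_of_set T. 1 / z (hd v) * (\<phi> (v ! 1) * \<psi> (last v)) / den v))
      - t\<^sup>2 * \<psi> (last u) * (W T * (\<Sum>v\<in>permutations_of_set T. \<psi> (hd v) * (\<phi> (v ! 1) * \<psi> (last v)) / den v))) / den u"
    unfolding sum_cut[OF assms(1) T assms(3,4), of "\<lambda>v. \<phi> (v ! 1) * \<psi> (last v)"]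
    by (simp only: times_divide_eq_right right_diff_distrib mult_ac)
  also have "\<dots> = (- 1) ^ (card T - 1) * (of_nat (card T - 1) * t\<^sup>2 * \<psi> (last u) - 2 * t / z (last u)) / den u"
    unfolding sum_second_psi_inv[OF assms(1,2)] sum_second_psi_psi[OF assms(1,2)]
    by (simp add: algebra_simps)
  finally show ?thesis .
qed

end

section \<open>From prefix lengths to prefix sets\<close>

text \<open>The condition on the length \<open>k\<close> depends on the prefix only as a set. For
  each \<open>k\<close> the orderings are split after \<open>k\<close> places, and the sets of all
  sizes together exhaust \<open>Pow E\<close>.\<close>

lemma sum_permutations_prefixes:
  assumes "finite E"
  shows "(\<Sum>w\<in>permutations_of_set E. \<Sum>k | k \<le> card E \<and> Q (set (take k w)). g k w)
    = (\<Sum>S | S \<subseteq> E \<and> Q S. \<Sum>u\<in>permutations_of_set S. \<Sum>v\<in>permutations_of_set (E - S). g (card S) (u @ v))"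
proof -
  have "(\<Sum>w\<in>permutations_of_set E. \<Sum>k | k \<le> card E \<and> Q (set (take k w)). g k w)
    = (\<Sum>w\<in>permutations_of_set E. \<Sum>k\<le>card E. if Q (set (take k w)) then g k w else 0)"
  proof (rule sum.cong[OF refl])
    fix w
    show "(\<Sum>k | k \<le> card E \<and> Q (set (take k w)). g k w) = (\<Sum>k\<le>card E. if Q (set (take k w)) then g k w else 0)"
      by (subst sum.inter_filter[symmetric]) simp_all
  qed
  also have "\<dots> = (\<Sum>k\<le>card E. \<Sum>w\<in>permutations_of_set E. if Q (set (take k w)) then g k w else 0)"
    by (rule sum.swap)
  also have "\<dots> = (\<Sum>k\<le>card E. \<Sum>S | S \<subseteq> E \<and> card S = k. if Q S then 
      \<Sum>u\<in>permutations_of_set S. \<Sum>v\<in>permutations_of_set (E - S). g (card S) (u @ v) else 0)"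
  proof (rule sum.cong[OF refl])
    fix k assume k: "k \<in> {..card E}"
    show "(\<Sum>w\<in>permutations_of_set E. if Q (set (take k w)) then g k w else 0)
      = (\<Sum>S | S \<subseteq> E \<and> card S = k. if Q S then 
      \<Sum>u\<in>permutations_of_set S. \<Sum>v\<in>permutations_of_set (E - S). g (card S) (u @ v) else 0)"
      unfolding sum_permutations_split[OF assms k[unfolded atMost_iff]]
    proof (rule sum.cong[OF refl])
      fix S assume S: "S \<in> {S. S \<subseteq> E \<and> card S = k}"
      have "set (take k (u @ v)) = S" if "u \<in> permutations_of_set S" for u v
        using that S length_finite_permutations_of_set[OF that] permutations_of_setD(1)[OF that] by simp
      then show "(\<Sum>u\<in>permutations_of_set S. \<Sum>v\<in>permutations_of_set (E - S). 
          if Q (set (take k (u @ v))) then g k (u @ v) else 0)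
        = (if Q S then \<Sum>u\<in>permutations_of_set S. \<Sum>v\<in>permutations_of_set (E - S). g (card S) (u @ v) else 0)"
        using S by simp
    qed
  qed
  also have "\<dots> = (\<Sum>S\<in>Pow E. if Q S then 
      \<Sum>u\<in>permutations_of_set S. \<Sum>v\<in>permutations_of_set (E - S). g (card S) (u @ v) else 0)"
    by (rule sum_Pow_by_card[OF assms, symmetric])
  also have "\<dots> = (\<Sum>S | S \<in> Pow E \<and> Q S. 
      \<Sum>u\<in>permutations_of_set S. \<Sum>v\<in>permutations_of_set (E - S). g (card S) (u @ v))"
    by (rule sum.inter_filter[symmetric]) (use assms in simp)
  finally show ?thesis by simp
qed

lemma sum_steps:
  fixes f :: "nat \<Rightarrow> 'b::ab_group_add"
  assumes "a \<le> b"
  shows "(\<Sum>k\<in>{Suc a..b}. f k - f (k - 1)) = f b - f a"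
  using assms sum_telescope''[OF assms, of f] by simp

lemma prod_set_take:
  assumes "distinct u" "k \<le> length u"
  shows "(\<Prod>c\<in>set (take k u). f c) = (\<Prod>i<k. f (u ! i))"
proof -
  have "set (take k u) = (!) u ` {..<k}"
    using assms(2) by (simp add: nth_image[symmetric] lessThan_atLeast0)
  moreover have "inj_on ((!) u) {..<k}"
    using assms by (intro inj_on_nth) auto
  ultimately show ?thesis by (simp add: prod.reindex)
qed

context chain_weights
begin

text \<open>The two later basis elements are moved down, one position at a time, to the positions
  \<open>2\<close> and \<open>3\<close> (counted from \<open>0\<close>); the second never collides with the first.\<close>

lemma phi_phi_telescope:
  fixes w :: "'a list"
  assumes "2 \<le> p" "p < q"
  defines "\<delta> \<equiv> \<lambda>k. \<phi> (w ! k) - \<phi> (w ! (k - 1))"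
  shows "\<phi> (w ! p) * \<phi> (w ! q) = \<phi> (w ! 2) * \<phi> (w ! 3)
    + (\<Sum>k\<in>{4..q}. \<phi> (w ! 2) * \<delta> k) + (\<Sum>j\<in>{3..p}. \<delta> j * \<phi> (w ! Suc j))
    + (\<Sum>k\<in>{4..q}. \<Sum>j | 3 \<le> j \<and> j \<le> p \<and> j + 2 \<le> k. \<delta> j * \<delta> k)"
proof -
  have q: "\<phi> (w ! q) = \<phi> (w ! 3) + (\<Sum>k\<in>{4..q}. \<delta> k)"
    using sum_steps[of 3 q "\<lambda>k. \<phi> (w ! k)"] assms by (simp add: \<delta>_def)
  have p: "\<phi> (w ! p) = \<phi> (w ! 2) + (\<Sum>j\<in>{3..p}. \<delta> j)"
    using sum_steps[of 2 p "\<lambda>k. \<phi> (w ! k)"] assms by (simp add: \<delta>_def)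
  \<comment> \<open>Once \<open>p\<close> is cut at \<open>j\<close>, \<open>q\<close> is moved down
    only to \<open>Suc j\<close>. Its remaining cuts satisfy \<open>j + 2 \<le> k\<close>, so the
    block between the two cuts has at least two elements.\<close>
  have qj: "\<phi> (w ! q) = \<phi> (w ! Suc j) + (\<Sum>k | k \<in> {4..q} \<and> j + 2 \<le> k. \<delta> k)" if "j \<in> {3..p}" for j
  proof -
    have "{k. k \<in> {4..q} \<and> j + 2 \<le> k} = {Suc (Suc j)..q}" using that by auto
    then show ?thesis
      using sum_steps[of "Suc j" q "\<lambda>k. \<phi> (w ! k)"] assms that by (simp add: \<delta>_def)
  qed
  have "\<phi> (w ! p) * \<phi> (w ! q) = \<phi> (w ! 2) * \<phi> (w ! q) + (\<Sum>j\<in>{3..p}. \<delta> j * \<phi> (w ! q))"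
    unfolding p by (simp add: distrib_right sum_distrib_right)
  also have "(\<Sum>j\<in>{3..p}. \<delta> j * \<phi> (w ! q)) 
    = (\<Sum>j\<in>{3..p}. \<delta> j * \<phi> (w ! Suc j)) + (\<Sum>j\<in>{3..p}. \<Sum>k | k \<in> {4..q} \<and> j + 2 \<le> k. \<delta> j * \<delta> k)"
    unfolding sum.distrib[symmetric]
    by (rule sum.cong[OF refl]) (simp only: qj distrib_left sum_distrib_left)
  also have "(\<Sum>j\<in>{3..p}. \<Sum>k | k \<in> {4..q} \<and> j + 2 \<le> k. \<delta> j * \<delta> k)
    = (\<Sum>k\<in>{4..q}. \<Sum>j | j \<in> {3..p} \<and> j + 2 \<le> k. \<delta> j * \<delta> k)"
    by (rule sum.swap_restrict) auto
  also have "\<phi> (w ! 2) * \<phi> (w ! q) = \<phi> (w ! 2) * \<phi> (w ! 3) + (\<Sum>k\<in>{4..q}. \<phi> (w ! 2) * \<delta> k)"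
    unfolding q by (simp add: distrib_left sum_distrib_left)
  finally show ?thesis by (simp add: add_ac conj_ac)
qed

section \<open>Contributions of single sets and of nested pairs\<close>

lemma sum_front_12_last_psi:
  assumes "finite A" "card A \<ge> 3"
  shows "W A * (\<Sum>u\<in>permutations_of_set A. \<phi> (u ! 0) * \<phi> (u ! 1) * \<psi> (last u) / den u)
    = (- 1) ^ (card A - 1) * of_nat (card A - 3) * t"
proof -
  have "(\<Prod>c\<in>set (take (Suc 1) u). \<phi> c) = \<phi> (u ! 0) * \<phi> (u ! 1)" if "u \<in> permutations_of_set A" for u
  proof -
    have "length u \<ge> 2" "distinct u"
      using that length_finite_permutations_of_set[OF that] assms(2) permutations_of_setD(2)[OF that] by auto
    then show ?thesis
      by (subst prod_set_take) (auto simp: numeral_eq_Suc mult_ac)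
  qed
  then show ?thesis
    using sum_front_last_psi[of A 1] assms by (simp add: numeral_3_eq_3)
qed

lemma sum_front_12_last_inv:
  assumes "finite A" "card A \<ge> 3"
  shows "W A * (\<Sum>u\<in>permutations_of_set A. \<phi> (u ! 0) * \<phi> (u ! 1) * (1 / z (last u)) / den u)
    = - (of_nat (card A - 3) * t\<^sup>2)"
proof -
  have "(\<Prod>c\<in>set (take (Suc 1) u). \<phi> c) = \<phi> (u ! 0) * \<phi> (u ! 1)" if "u \<in> permutations_of_set A" for u
  proof -
    have "length u \<ge> 2" "distinct u"
      using that length_finite_permutations_of_set[OF that] assms(2) permutations_of_setD(2)[OF that] by auto
    then show ?thesis
      by (subst prod_set_take) (auto simp: numeral_eq_Suc mult_ac)
  qed
  then show ?thesis
    using sum_front_last_inv[of A 1] assms by (simp add: numeral_3_eq_3 power2_eq_square)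
qed

lemma sum_front_123_last_inv:
  assumes "finite A" "card A \<ge> 4"
  shows "W A * (\<Sum>u\<in>permutations_of_set A. \<phi> (u ! 0) * \<phi> (u ! 1) * \<phi> (u ! 2) * (1 / z (last u)) / den u)
    = - (of_nat ((card A - 4) choose 2) * t ^ 3)"
proof -
  have "(\<Prod>c\<in>set (take (Suc 2) u). \<phi> c) = \<phi> (u ! 0) * \<phi> (u ! 1) * \<phi> (u ! 2)" if "u \<in> permutations_of_set A" for u
  proof -
    have "length u \<ge> 3" "distinct u"
      using that length_finite_permutations_of_set[OF that] assms(2) permutations_of_setD(2)[OF that] by auto
    then show ?thesis
      by (subst prod_set_take) (auto simp: numeral_eq_Suc mult_ac)
  qed
  then show ?thesis
    using sum_front_last_inv[of A 2] assms by (simp add: eval_nat_numeral)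
qed

lemma sum_front_1234_last_psi:
  assumes "finite A" "card A \<ge> 5"
  shows "W A * (\<Sum>u\<in>permutations_of_set A. \<phi> (u ! 0) * \<phi> (u ! 1) * (\<phi> (u ! 2) * \<phi> (u ! 3)) * \<psi> (last u) / den u)
    = (- 1) ^ (card A - 1) * of_nat ((card A - 5) choose 3) * t ^ 3"
proof -
  have "(\<Prod>c\<in>set (take (Suc 3) u). \<phi> c) = \<phi> (u ! 0) * \<phi> (u ! 1) * (\<phi> (u ! 2) * \<phi> (u ! 3))" if "u \<in> permutations_of_set A" for u
  proof -
    have "length u \<ge> 4" "distinct u"
      using that length_finite_permutations_of_set[OF that] assms(2) permutations_of_setD(2)[OF that] by auto
    then show ?thesis
      by (subst prod_set_take) (auto simp: numeral_eq_Suc mult_ac)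
  qed
  then show ?thesis
    using sum_front_last_psi[of A 3] assms by simp
qed


text \<open>\<open>W\<close> is multiplicative along the cut, so each tail sum is normalised by its
  own factor \<open>W (E - S)\<close>.\<close>

lemma sum_over_prefix:
  assumes "finite E" "S \<subseteq> E"
    and "\<And>u v. u \<in> permutations_of_set S \<Longrightarrow> v \<in> permutations_of_set (E - S) \<Longrightarrow> g (u @ v) = a u * h u v"
    and "\<And>u. u \<in> permutations_of_set S \<Longrightarrow> W (E - S) * (\<Sum>v\<in>permutations_of_set (E - S). h u v) = b u"
  shows "W E * (\<Sum>u\<in>permutations_of_set S. \<Sum>v\<in>permutations_of_set (E - S). g (u @ v))
    = W S * (\<Sum>u\<in>permutations_of_set S. a u * b u)"
proof -
  have "W E * (\<Sum>u\<in>permutations_of_set S. \<Sum>v\<in>permutations_of_set (E - S). g (u @ v))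
    = W S * (\<Sum>u\<in>permutations_of_set S. W (E - S) * (\<Sum>v\<in>permutations_of_set (E - S). g (u @ v)))"
    by (simp only: W_Un[OF assms(1,2)] sum_distrib_left mult.assoc)
  also have "(\<Sum>u\<in>permutations_of_set S. W (E - S) * (\<Sum>v\<in>permutations_of_set (E - S). g (u @ v)))
    = (\<Sum>u\<in>permutations_of_set S. a u * b u)"
  proof (rule sum.cong[OF refl])
    fix u assume u: "u \<in> permutations_of_set S"
    have "(\<Sum>v\<in>permutations_of_set (E - S). g (u @ v)) = a u * (\<Sum>v\<in>permutations_of_set (E - S). h u v)"
      unfolding sum_distrib_left by (rule sum.cong[OF refl]) (rule assms(3)[OF u])
    then show "W (E - S) * (\<Sum>v\<in>permutations_of_set (E - S). g (u @ v)) = a u * b u"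
      using assms(4)[OF u] by (simp add: mult.left_commute)
  qed
  finally show ?thesis .
qed

lemma append_positions:
  assumes "u \<in> permutations_of_set S" "v \<in> permutations_of_set T" "S \<noteq> {}" "T \<noteq> {}"
  shows "(u @ v) ! card S = hd v" "(u @ v) ! (card S - 1) = last u" "(u @ v) ! Suc (card S) = v ! 1"
    "last (u @ v) = last v" "i < card S \<Longrightarrow> (u @ v) ! i = u ! i" "u \<noteq> []" "v \<noteq> []" "set u = S"
proof -
  show ne: "u \<noteq> []" "v \<noteq> []" and "set u = S"
    using assms by (auto simp: permutations_of_set_def)
  have len: "length u = card S" using assms(1) by (rule length_finite_permutations_of_set)
  show "(u @ v) ! card S = hd v" "(u @ v) ! Suc (card S) = v ! 1"
    "last (u @ v) = last v" "i < card S \<Longrightarrow> (u @ v) ! i = u ! i"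
    using ne by (auto simp: nth_append len hd_conv_nth Suc_diff_le)
  have "(u @ v) ! (card S - 1) = u ! (length u - 1)"
    using ne by (simp add: nth_append flip: len)
  then show "(u @ v) ! (card S - 1) = last u"
    using ne by (simp add: last_conv_nth)
qed

text \<open>The term in which \<open>q\<close> crosses the cut behind \<open>S\<close> while the
  third weight stays at position \<open>2\<close>. The tail leaves \<open>1 / z (last u)\<close>,
  and the prefix is then a case of \<open>sum_front_123_last_inv\<close>.\<close>

lemma sum_plane_cut:
  assumes "finite E" "S \<subseteq> E" "card S \<ge> 4" "card (E - S) \<ge> 2"
  shows "W E * (\<Sum>u\<in>permutations_of_set S. \<Sum>v\<in>permutations_of_set (E - S). 
      (\<lambda>w. \<phi> (w ! 0) * \<phi> (w ! 1) * (\<phi> (w ! 2) * (\<phi> (w ! card S) - \<phi> (w ! (card S - 1)))) * \<psi> (last w) / den w) (u @ v))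
    = - ((- 1) ^ (card (E - S) - 1) * of_nat ((card S - 4) choose 2) * t ^ 3)"
proof -
  have fin: "finite S" "finite (E - S)" using assms finite_subset by auto
  have ne: "S \<noteq> {}" "E - S \<noteq> {}" using assms(3,4) by (metis card.empty not_numeral_le_zero)+
  have "W E * (\<Sum>u\<in>permutations_of_set S. \<Sum>v\<in>permutations_of_set (E - S). 
      (\<lambda>w. \<phi> (w ! 0) * \<phi> (w ! 1) * (\<phi> (w ! 2) * (\<phi> (w ! card S) - \<phi> (w ! (card S - 1)))) * \<psi> (last w) / den w) (u @ v))
    = W S * (\<Sum>u\<in>permutations_of_set S. \<phi> (u ! 0) * \<phi> (u ! 1) * \<phi> (u ! 2) * 
        ((- 1) ^ (card (E - S) - 1) * (1 / z (last u) / den u)))"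
  proof (rule sum_over_prefix[OF assms(1,2)])
    fix u v assume uv: "u \<in> permutations_of_set S" "v \<in> permutations_of_set (E - S)"
    note pos = append_positions[OF uv ne]
    show "\<phi> ((u @ v) ! 0) * \<phi> ((u @ v) ! 1) * (\<phi> ((u @ v) ! 2) * (\<phi> ((u @ v) ! card S) - \<phi> ((u @ v) ! (card S - 1)))) * \<psi> (last (u @ v)) / den (u @ v)
      = \<phi> (u ! 0) * \<phi> (u ! 1) * \<phi> (u ! 2) * ((\<phi> (hd v) - \<phi> (last u)) * \<psi> (last v) / den (u @ v))"
      unfolding pos(1-4) using assms(3) by (subst (1 2 3) pos(5)) (auto simp: mult_ac)
  next
    fix u assume "u \<in> permutations_of_set S"
    then have "set u = S" by (rule permutations_of_setD)
    then show "W (E - S) * (\<Sum>v\<in>permutations_of_set (E - S). (\<phi> (hd v) - \<phi> (last u)) * \<psi> (last v) / den (u @ v))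
      = (- 1) ^ (card (E - S) - 1) * (1 / z (last u) / den u)"
      using ne(1) by (intro sum_cut_last_psi fin assms) auto
  qed
  also have "\<dots> = (- 1) ^ (card (E - S) - 1) * (W S * (\<Sum>u\<in>permutations_of_set S. \<phi> (u ! 0) * \<phi> (u ! 1) * \<phi> (u ! 2) * (1 / z (last u)) / den u))"
    by (simp only: sum_distrib_left) (simp add: mult_ac)
  finally show ?thesis
    unfolding sum_front_123_last_inv[OF fin(1) assms(3)] by simp
qed

text \<open>The term in which \<open>p\<close> crosses the cut behind \<open>S\<close> and
  \<open>q\<close> follows immediately. Both end weights reach the prefix, and both resulting prefix
  sums are proportional to \<open>card S - 3\<close>.\<close>

lemma sum_line_cut:
  assumes "finite E" "S \<subseteq> E" "card S \<ge> 3" "card (E - S) \<ge> 3"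
  shows "W E * (\<Sum>u\<in>permutations_of_set S. \<Sum>v\<in>permutations_of_set (E - S). 
      (\<lambda>w. \<phi> (w ! 0) * \<phi> (w ! 1) * ((\<phi> (w ! card S) - \<phi> (w ! (card S - 1))) * \<phi> (w ! Suc (card S))) * \<psi> (last w) / den w) (u @ v))
    = (- 1) ^ (card (E - S) - 1) * (of_nat (card (E - S) - 1) * (- 1) ^ (card S - 1) + 2) * of_nat (card S - 3) * t ^ 3"
proof -
  have fin: "finite S" "finite (E - S)" using assms finite_subset by auto
  have ne: "S \<noteq> {}" "E - S \<noteq> {}" using assms(3,4) by (metis card.empty not_numeral_le_zero)+
  let ?m = "card (E - S)"
  have "W E * (\<Sum>u\<in>permutations_of_set S. \<Sum>v\<in>permutations_of_set (E - S). 
      (\<lambda>w. \<phi> (w ! 0) * \<phi> (w ! 1) * ((\<phi> (w ! card S) - \<phi> (w ! (card S - 1))) * \<phi> (w ! Suc (card S))) * \<psi> (last w) / den w) (u @ v))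
    = W S * (\<Sum>u\<in>permutations_of_set S. \<phi> (u ! 0) * \<phi> (u ! 1) * 
        ((- 1) ^ (?m - 1) * (of_nat (?m - 1) * t\<^sup>2 * \<psi> (last u) - 2 * t / z (last u)) / den u))"
  proof (rule sum_over_prefix[OF assms(1,2)])
    fix u v assume uv: "u \<in> permutations_of_set S" "v \<in> permutations_of_set (E - S)"
    note pos = append_positions[OF uv ne]
    show "\<phi> ((u @ v) ! 0) * \<phi> ((u @ v) ! 1) * ((\<phi> ((u @ v) ! card S) - \<phi> ((u @ v) ! (card S - 1))) * \<phi> ((u @ v) ! Suc (card S))) * \<psi> (last (u @ v)) / den (u @ v)
      = \<phi> (u ! 0) * \<phi> (u ! 1) * ((\<phi> (hd v) - \<phi> (last u)) * (\<phi> (v ! 1) * \<psi> (last v)) / den (u @ v))"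
      unfolding pos(1-4) using assms(3) by (subst (1 2) pos(5)) (auto simp: mult_ac)
  next
    fix u assume "u \<in> permutations_of_set S"
    then have "set u = S" by (rule permutations_of_setD)
    then show "W (E - S) * (\<Sum>v\<in>permutations_of_set (E - S). (\<phi> (hd v) - \<phi> (last u)) * (\<phi> (v ! 1) * \<psi> (last v)) / den (u @ v))
      = (- 1) ^ (?m - 1) * (of_nat (?m - 1) * t\<^sup>2 * \<psi> (last u) - 2 * t / z (last u)) / den u"
      using ne(1) by (intro sum_cut_second_psi fin assms) auto
  qed
  also have "\<dots> = (- 1) ^ (?m - 1) * (of_nat (?m - 1) * t\<^sup>2 * 
        (W S * (\<Sum>u\<in>permutations_of_set S. \<phi> (u ! 0) * \<phi> (u ! 1) * \<psi> (last u) / den u))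
      - 2 * t * (W S * (\<Sum>u\<in>permutations_of_set S. \<phi> (u ! 0) * \<phi> (u ! 1) * (1 / z (last u)) / den u)))"
    unfolding sum_distrib_left sum_subtractf[symmetric]
    by (rule sum.cong[OF refl]) (simp add: algebra_simps diff_divide_distrib)
  also have "\<dots> = (- 1) ^ (?m - 1) * (of_nat (?m - 1) * t\<^sup>2 * ((- 1) ^ (card S - 1) * of_nat (card S - 3) * t)
      - 2 * t * - (of_nat (card S - 3) * t\<^sup>2))"
    unfolding sum_front_12_last_psi[OF fin(1) assms(3)] sum_front_12_last_inv[OF fin(1) assms(3)] ..
  also have "\<dots> = (- 1) ^ (?m - 1) * (of_nat (?m - 1) * (- 1) ^ (card S - 1) + 2) * of_nat (card S - 3) * t ^ 3"
    by (simp add: algebra_simps power2_eq_square power3_eq_cube)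
  finally show ?thesis .
qed

text \<open>The inner half of a term with two cuts: the cut behind \<open>S\<close> has already left
  \<open>1 / z\<close> on the last element of \<open>S\<close>, and the cut behind \<open>A\<close>
  turns this into \<open>\<psi>\<close> at the end of \<open>A\<close>.\<close>

lemma sum_line_cut_last_inv:
  assumes "finite S" "A \<subseteq> S" "card A \<ge> 3" "card A + 2 \<le> card S"
  shows "W S * (\<Sum>u\<in>permutations_of_set A. \<Sum>v\<in>permutations_of_set (S - A). 
      (\<lambda>w. \<phi> (w ! 0) * \<phi> (w ! 1) * (\<phi> (w ! card A) - \<phi> (w ! (card A - 1))) * (1 / z (last w)) / den w) (u @ v))
    = - ((- 1) ^ (card A - 1) * of_nat (card A - 3) * t ^ 3)"
proof -
  have fin: "finite A" "finite (S - A)" using assms finite_subset by auto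
  have cT: "card (S - A) \<ge> 2" using assms fin by (simp add: card_Diff_subset)
  have ne: "A \<noteq> {}" "S - A \<noteq> {}" using assms(3) cT by (metis card.empty not_numeral_le_zero)+
  have "W S * (\<Sum>u\<in>permutations_of_set A. \<Sum>v\<in>permutations_of_set (S - A). 
      (\<lambda>w. \<phi> (w ! 0) * \<phi> (w ! 1) * (\<phi> (w ! card A) - \<phi> (w ! (card A - 1))) * (1 / z (last w)) / den w) (u @ v))
    = W A * (\<Sum>u\<in>permutations_of_set A. \<phi> (u ! 0) * \<phi> (u ! 1) * - (t\<^sup>2 * \<psi> (last u) / den u))"
  proof (rule sum_over_prefix[OF assms(1,2)])
    fix u v assume uv: "u \<in> permutations_of_set A" "v \<in> permutations_of_set (S - A)"
    note pos = append_positions[OF uv ne]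
    show "\<phi> ((u @ v) ! 0) * \<phi> ((u @ v) ! 1) * (\<phi> ((u @ v) ! card A) - \<phi> ((u @ v) ! (card A - 1))) * (1 / z (last (u @ v))) / den (u @ v)
      = \<phi> (u ! 0) * \<phi> (u ! 1) * ((\<phi> (hd v) - \<phi> (last u)) * (1 / z (last v)) / den (u @ v))"
      unfolding pos(1-4) using assms(3) by (subst (1 2) pos(5)) (auto simp: mult_ac)
  next
    fix u assume "u \<in> permutations_of_set A"
    then have "set u = A" by (rule permutations_of_setD)
    then show "W (S - A) * (\<Sum>v\<in>permutations_of_set (S - A). (\<phi> (hd v) - \<phi> (last u)) * (1 / z (last v)) / den (u @ v))
      = - (t\<^sup>2 * \<psi> (last u) / den u)"
      using ne(1) by (intro sum_cut_last_inv fin cT) auto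
  qed
  also have "\<dots> = - (t\<^sup>2 * (W A * (\<Sum>u\<in>permutations_of_set A. \<phi> (u ! 0) * \<phi> (u ! 1) * \<psi> (last u) / den u)))"
    unfolding sum_distrib_left sum_negf[symmetric] by (rule sum.cong[OF refl]) simp
  finally show ?thesis
    unfolding sum_front_12_last_psi[OF fin(1) assms(3)] by (simp add: power2_eq_square power3_eq_cube)
qed


lemma sum_prefixes_const:
  assumes "finite E"
    and "\<And>S. S \<subseteq> E \<Longrightarrow> Q S \<Longrightarrow> x * (\<Sum>u\<in>permutations_of_set S. \<Sum>v\<in>permutations_of_set (E - S). g (card S) (u @ v)) = y * c S"
  shows "x * (\<Sum>w\<in>permutations_of_set E. \<Sum>k | k \<le> card E \<and> Q (set (take k w)). g k w)
    = (y :: 'k) * (\<Sum>S | S \<subseteq> E \<and> Q S. c S)"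
  unfolding sum_permutations_prefixes[OF assms(1)]
  by (simp only: sum_distrib_left[of _ _ "{S. S \<subseteq> E \<and> Q S}"]) (rule sum.cong, use assms(2) in auto)

text \<open>The computation free of matroids. \<open>F2\<close> and \<open>F3\<close> stand for rank
  at most \<open>2\<close> and at most \<open>3\<close>; \<open>p_iff\<close> and
  \<open>q_iff\<close> say that prefixes satisfy them exactly up to the third and the fourth basis
  element. The bounds \<open>3 \<le> card A\<close> and \<open>4 \<le> card S\<close> arise because
  \<open>p\<close> ends at position \<open>2\<close> and \<open>q\<close> at position
  \<open>3\<close> when both are moved down fully.\<close>

lemma sum_greedy_positions:
  fixes p q :: "'a list \<Rightarrow> nat" and F2 F3 :: "'a set \<Rightarrow> bool"
  assumes fin: "finite E" and n: "card E \<ge> 5"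
    and pq: "\<And>w. w \<in> permutations_of_set E \<Longrightarrow> 2 \<le> p w \<and> p w < q w \<and> q w < card E"
    and p_iff: "\<And>w k. w \<in> permutations_of_set E \<Longrightarrow> k \<le> card E \<Longrightarrow> F2 (set (take k w)) \<longleftrightarrow> k \<le> p w"
    and q_iff: "\<And>w k. w \<in> permutations_of_set E \<Longrightarrow> k \<le> card E \<Longrightarrow> F3 (set (take k w)) \<longleftrightarrow> k \<le> q w"
    and F2_compl: "\<And>A. A \<subseteq> E \<Longrightarrow> F2 A \<Longrightarrow> card (E - A) \<ge> 3"
    and F3_compl: "\<And>S. S \<subseteq> E \<Longrightarrow> F3 S \<Longrightarrow> card (E - S) \<ge> 2"
  defines "planes \<equiv> {S. S \<subseteq> E \<and> 4 \<le> card S \<and> F3 S}"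
    and "lines \<equiv> {A. A \<subseteq> E \<and> 3 \<le> card A \<and> F2 A}"
  shows "W E * (\<Sum>w\<in>permutations_of_set E. \<phi> (w ! 0) * \<phi> (w ! 1) * (\<phi> (w ! p w) * \<phi> (w ! q w)) * \<psi> (last w) / den w)
    = t ^ 3 * ((- 1) ^ (card E - 1) * of_nat ((card E - 5) choose 3)
      - (\<Sum>S\<in>planes. (- 1) ^ (card (E - S) - 1) * of_nat ((card S - 4) choose 2))
      + (\<Sum>A\<in>lines. (- 1) ^ (card (E - A) - 1) * (of_nat (card (E - A) - 1) * (- 1) ^ (card A - 1) + 2) * of_nat (card A - 3))
      - (\<Sum>S\<in>planes. \<Sum>A | A \<in> lines \<and> A \<subseteq> S \<and> card A + 2 \<le> card S.
          (- 1) ^ (card (E - S) - 1) * (- 1) ^ (card A - 1) * of_nat (card A - 3)))"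
proof -
  let ?P = "permutations_of_set E" and ?n = "card E"
  define \<delta> where "\<delta> w k = \<phi> (w ! k) - \<phi> (w ! (k - 1))" for w k
  define D where "D w x = \<phi> (w ! 0) * \<phi> (w ! 1) * x * \<psi> (last w) / den w" for w x
  have D_add: "D w (x + y) = D w x + D w y" for w x y
    by (simp add: D_def algebra_simps add_divide_distrib)
  have D_sum: "D w (\<Sum>i\<in>I. f i) = (\<Sum>i\<in>I. D w (f i))" for w f and I :: "nat set"
    by (simp add: D_def sum_distrib_left sum_distrib_right sum_divide_distrib)
  have card_take: "card (set (take k w)) = k" if "w \<in> ?P" "k \<le> ?n" for w k
    using that length_finite_permutations_of_set[OF that(1)] permutations_of_setD(2)[OF that(1)]
    by (simp add: distinct_card)
  define Q3 where "Q3 S \<longleftrightarrow> 4 \<le> card S \<and> F3 S" for S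
  define Q2 where "Q2 A \<longleftrightarrow> 3 \<le> card A \<and> F2 A" for A
  \<comment> \<open>The index range of the telescoping sum depends on \<open>w\<close>; as a
    condition on prefix sets it becomes independent of the ordering and can be regrouped.\<close>
  have q_set: "{4..q w} = {k. k \<le> ?n \<and> Q3 (set (take k w))}" if "w \<in> ?P" for w
    using that pq[OF that] q_iff[OF that] by (auto simp: Q3_def card_take)
  have p_set: "{3..p w} = {j. j \<le> ?n \<and> Q2 (set (take j w))}" if "w \<in> ?P" for w
    using that pq[OF that] p_iff[OF that] by (auto simp: Q2_def card_take)
  \<comment> \<open>\<open>card (set (take j w))\<close> is just \<open>j\<close>; in this form the
    bound is a condition on the prefix set, as the regrouping requires.\<close>
  define g4 where "g4 k w = (\<Sum>j | j \<le> k \<and> Q2 (set (take j w)) \<and> card (set (take j w)) + 2 \<le> k. D w (\<delta> w j * \<delta> w k))" for k w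
  have split: "D w (\<phi> (w ! p w) * \<phi> (w ! q w)) = D w (\<phi> (w ! 2) * \<phi> (w ! 3))
    + (\<Sum>k | k \<le> ?n \<and> Q3 (set (take k w)). D w (\<phi> (w ! 2) * \<delta> w k)) 
    + (\<Sum>j | j \<le> ?n \<and> Q2 (set (take j w)). D w (\<delta> w j * \<phi> (w ! Suc j)))
    + (\<Sum>k | k \<le> ?n \<and> Q3 (set (take k w)). g4 k w)" if w: "w \<in> ?P" for w
  proof -
    have "{j. 3 \<le> j \<and> j \<le> p w \<and> j + 2 \<le> k} = {j. j \<le> k \<and> Q2 (set (take j w)) \<and> card (set (take j w)) + 2 \<le> k}"
      if "k \<in> {4..q w}" for k
    proof -
      have "k \<le> ?n" using pq[OF w] that by auto
      then show ?thesis
        using p_iff[OF w] card_take[OF w] by (auto simp: Q2_def)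
    qed
    then show ?thesis
      using pq[OF w] unfolding phi_phi_telescope[of "p w" "q w" w, folded \<delta>_def] D_add D_sum
        q_set[OF w, symmetric] p_set[OF w, symmetric]
      by (simp add: phi_phi_telescope[of "p w" "q w" w, folded \<delta>_def] D_add D_sum g4_def)
  qed
  have T1: "W E * (\<Sum>w\<in>?P. D w (\<phi> (w ! 2) * \<phi> (w ! 3))) = t ^ 3 * ((- 1) ^ (?n - 1) * of_nat ((?n - 5) choose 3))"
    unfolding D_def using sum_front_1234_last_psi[OF fin n] by (simp add: mult_ac)
  have planes: "planes = {S. S \<subseteq> E \<and> Q3 S}" and lines: "lines = {A. A \<subseteq> E \<and> Q2 A}"
    by (auto simp: planes_def lines_def Q2_def Q3_def)
  have T2: "W E * (\<Sum>w\<in>?P. \<Sum>k | k \<le> ?n \<and> Q3 (set (take k w)). D w (\<phi> (w ! 2) * \<delta> w k)) 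
    = - (t ^ 3 * (\<Sum>S\<in>planes. (- 1) ^ (card (E - S) - 1) * of_nat ((card S - 4) choose 2)))"
  proof -
    have "W E * (\<Sum>u\<in>permutations_of_set S. \<Sum>v\<in>permutations_of_set (E - S). D (u @ v) (\<phi> ((u @ v) ! 2) * \<delta> (u @ v) (card S)))
      = - (t ^ 3) * ((- 1) ^ (card (E - S) - 1) * of_nat ((card S - 4) choose 2))" if "S \<subseteq> E" "Q3 S" for S
      using sum_plane_cut[of E S] fin that F3_compl unfolding D_def \<delta>_def Q3_def by (simp add: mult_ac)
    from sum_prefixes_const[OF fin this] show ?thesis by (simp add: planes)
  qed
  have T3: "W E * (\<Sum>w\<in>?P. \<Sum>j | j \<le> ?n \<and> Q2 (set (take j w)). D w (\<delta> w j * \<phi> (w ! Suc j)))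
    = t ^ 3 * (\<Sum>A\<in>lines. (- 1) ^ (card (E - A) - 1) * (of_nat (card (E - A) - 1) * (- 1) ^ (card A - 1) + 2) * of_nat (card A - 3))"
  proof -
    have "W E * (\<Sum>u\<in>permutations_of_set A. \<Sum>v\<in>permutations_of_set (E - A). D (u @ v) (\<delta> (u @ v) (card A) * \<phi> ((u @ v) ! Suc (card A))))
      = t ^ 3 * ((- 1) ^ (card (E - A) - 1) * (of_nat (card (E - A) - 1) * (- 1) ^ (card A - 1) + 2) * of_nat (card A - 3))" if "A \<subseteq> E" "Q2 A" for A
    proof -
      have "W E * (\<Sum>u\<in>permutations_of_set A. \<Sum>v\<in>permutations_of_set (E - A). D (u @ v) (\<delta> (u @ v) (card A) * \<phi> ((u @ v) ! Suc (card A))))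
      = (- 1) ^ (card (E - A) - 1) * (of_nat (card (E - A) - 1) * (- 1) ^ (card A - 1) + 2) * of_nat (card A - 3) * t ^ 3"
        unfolding D_def \<delta>_def using sum_line_cut[OF fin that(1)] that F2_compl unfolding Q2_def by blast
      then show ?thesis by (simp only: mult.commute)
    qed
    from sum_prefixes_const[OF fin this] show ?thesis by (simp only: lines)
  qed
  have T4: "W E * (\<Sum>w\<in>?P. \<Sum>k | k \<le> ?n \<and> Q3 (set (take k w)). g4 k w)
    = - (t ^ 3 * (\<Sum>S\<in>planes. \<Sum>A | A \<in> lines \<and> A \<subseteq> S \<and> card A + 2 \<le> card S.
          (- 1) ^ (card (E - S) - 1) * (- 1) ^ (card A - 1) * of_nat (card A - 3)))"
  proof -
    have "W E * (\<Sum>u\<in>permutations_of_set S. \<Sum>v\<in>permutations_of_set (E - S). g4 (card S) (u @ v))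
      = - (t ^ 3) * (\<Sum>A | A \<subseteq> S \<and> Q2 A \<and> card A + 2 \<le> card S. 
          (- 1) ^ (card (E - S) - 1) * (- 1) ^ (card A - 1) * of_nat (card A - 3))" if "S \<subseteq> E" "Q3 S" for S
    proof -
      have S: "card S \<ge> 4" "card (E - S) \<ge> 2" "finite S" "finite (E - S)" 
        using that F3_compl fin finite_subset by (auto simp: Q3_def)
      then have ne: "S \<noteq> {}" "E - S \<noteq> {}" by (metis card.empty not_numeral_le_zero)+
      define J where "J u = {j. j \<le> card S \<and> Q2 (set (take j u)) \<and> card (set (take j u)) + 2 \<le> card S}" for u
      define e where "e = (- 1 :: 'k) ^ (card (E - S) - 1)"
      \<comment> \<open>Only the tail behind \<open>S\<close> is summed here. It leaves
        \<open>1 / z (last u)\<close>, after which the cuts \<open>j\<close> inside \<open>u\<close>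
        are regrouped by their own prefix sets \<open>A\<close>.\<close>
      have "W E * (\<Sum>u\<in>permutations_of_set S. \<Sum>v\<in>permutations_of_set (E - S). g4 (card S) (u @ v))
        = W S * (\<Sum>u\<in>permutations_of_set S. (\<Sum>j\<in>J u. \<phi> (u ! 0) * \<phi> (u ! 1) * \<delta> u j) * (e * (1 / z (last u) / den u)))"
      proof (rule sum_over_prefix[OF fin \<open>S \<subseteq> E\<close>])
        fix u v assume uv: "u \<in> permutations_of_set S" "v \<in> permutations_of_set (E - S)"
        note pos = append_positions[OF uv ne]
        have len: "length u = card S" "distinct u" 
          using length_finite_permutations_of_set[OF uv(1)] permutations_of_setD(2)[OF uv(1)] by auto
        have J: "J u = {j. j \<le> card S \<and> Q2 (set (take j (u @ v))) \<and> card (set (take j (u @ v))) + 2 \<le> card S}"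
          unfolding J_def using len by auto
        have "D (u @ v) (\<delta> (u @ v) j * \<delta> (u @ v) (card S)) 
          = \<phi> (u ! 0) * \<phi> (u ! 1) * \<delta> u j * ((\<phi> (hd v) - \<phi> (last u)) * \<psi> (last v) / den (u @ v))" if "j \<in> J u" for j
        proof -
          have "card (set (take j u)) = j" using that len by (auto simp: J_def distinct_card)
          then have "j < card S" using that by (auto simp: J_def)
          moreover have "0 < card S" "1 < card S" using S by auto
          ultimately show ?thesis
            unfolding D_def \<delta>_def pos(1,2,4) by (simp add: pos(5) mult_ac)
        qed
        then show "g4 (card S) (u @ v) = (\<Sum>j\<in>J u. \<phi> (u ! 0) * \<phi> (u ! 1) * \<delta> u j) * ((\<phi> (hd v) - \<phi> (last u)) * \<psi> (last v) / den (u @ v))"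
          unfolding g4_def J[symmetric] sum_distrib_right by (rule sum.cong[OF refl])
      next
        fix u assume "u \<in> permutations_of_set S"
        then have "set u = S" by (rule permutations_of_setD)
        then show "W (E - S) * (\<Sum>v\<in>permutations_of_set (E - S). (\<phi> (hd v) - \<phi> (last u)) * \<psi> (last v) / den (u @ v))
          = e * (1 / z (last u) / den u)"
          unfolding e_def using ne(1) by (intro sum_cut_last_psi S) auto
      qed
      also have "\<dots> = e * (W S * (\<Sum>u\<in>permutations_of_set S. \<Sum>j\<in>J u. \<phi> (u ! 0) * \<phi> (u ! 1) * \<delta> u j * (1 / z (last u)) / den u))"
        by (simp only: sum_distrib_left sum_distrib_right) (simp add: mult_ac)
      also have "W S * (\<Sum>u\<in>permutations_of_set S. \<Sum>j\<in>J u. \<phi> (u ! 0) * \<phi> (u ! 1) * \<delta> u j * (1 / z (last u)) / den u)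
        = - (t ^ 3) * (\<Sum>A | A \<subseteq> S \<and> Q2 A \<and> card A + 2 \<le> card S. (- 1) ^ (card A - 1) * of_nat (card A - 3))"
        unfolding J_def
      proof (rule sum_prefixes_const[OF S(3)])
        fix A assume A: "A \<subseteq> S" "Q2 A \<and> card A + 2 \<le> card S"
        show "W S * (\<Sum>u\<in>permutations_of_set A. \<Sum>v\<in>permutations_of_set (S - A). \<phi> ((u @ v) ! 0) * \<phi> ((u @ v) ! 1) * \<delta> (u @ v) (card A) * (1 / z (last (u @ v))) / den (u @ v))
          = - (t ^ 3) * ((- 1) ^ (card A - 1) * of_nat (card A - 3))"
          using sum_line_cut_last_inv[OF S(3) A(1)] A(2) unfolding \<delta>_def Q2_def by (simp add: mult_ac)
      qed
      finally show ?thesis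
        unfolding e_def by (simp add: sum_distrib_left mult_ac)
    qed
    from sum_prefixes_const[OF fin this] have "W E * (\<Sum>w\<in>?P. \<Sum>k | k \<le> ?n \<and> Q3 (set (take k w)). g4 k w)
      = - (t ^ 3) * (\<Sum>S\<in>planes. \<Sum>A | A \<subseteq> S \<and> Q2 A \<and> card A + 2 \<le> card S. 
          (- 1) ^ (card (E - S) - 1) * (- 1) ^ (card A - 1) * of_nat (card A - 3))"
      unfolding planes .
    also have "(\<Sum>S\<in>planes. \<Sum>A | A \<subseteq> S \<and> Q2 A \<and> card A + 2 \<le> card S. 
          (- 1) ^ (card (E - S) - 1) * (- 1) ^ (card A - 1) * of_nat (card A - 3) :: 'k)
      = (\<Sum>S\<in>planes. \<Sum>A | A \<in> lines \<and> A \<subseteq> S \<and> card A + 2 \<le> card S.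
          (- 1) ^ (card (E - S) - 1) * (- 1) ^ (card A - 1) * of_nat (card A - 3))"
    proof (rule sum.cong[OF refl])
      fix S assume "S \<in> planes"
      then have "{A. A \<subseteq> S \<and> Q2 A \<and> card A + 2 \<le> card S} = {A. A \<in> lines \<and> A \<subseteq> S \<and> card A + 2 \<le> card S}"
        by (auto simp: planes lines)
      then show "(\<Sum>A | A \<subseteq> S \<and> Q2 A \<and> card A + 2 \<le> card S. 
          (- 1) ^ (card (E - S) - 1) * (- 1) ^ (card A - 1) * of_nat (card A - 3) :: 'k)
        = (\<Sum>A | A \<in> lines \<and> A \<subseteq> S \<and> card A + 2 \<le> card S.
          (- 1) ^ (card (E - S) - 1) * (- 1) ^ (card A - 1) * of_nat (card A - 3))"
        by (rule arg_cong)
    qed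
    finally show ?thesis by simp
  qed
  have main: "W E * (\<Sum>w\<in>?P. D w (\<phi> (w ! p w) * \<phi> (w ! q w)))
    = W E * (\<Sum>w\<in>?P. D w (\<phi> (w ! 2) * \<phi> (w ! 3)))
    + W E * (\<Sum>w\<in>?P. \<Sum>k | k \<le> ?n \<and> Q3 (set (take k w)). D w (\<phi> (w ! 2) * \<delta> w k)) 
    + W E * (\<Sum>w\<in>?P. \<Sum>j | j \<le> ?n \<and> Q2 (set (take j w)). D w (\<delta> w j * \<phi> (w ! Suc j)))
    + W E * (\<Sum>w\<in>?P. \<Sum>k | k \<le> ?n \<and> Q3 (set (take k w)). g4 k w)"
    unfolding distrib_left[symmetric] sum.distrib[symmetric]
    by (rule arg_cong[where f = "(*) (W E)"]) (rule sum.cong[OF refl split])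
  have "x * a + - (x * b) + x * c + - (x * d) = x * (a - b + c - d)" for x a b c d :: 'k
    by (simp add: algebra_simps)
  with main show ?thesis
    unfolding T1 T2 T3 T4 unfolding D_def by simp
qed

end

section \<open>Rank and flats\<close>

context matroid
begin

abbreviation rk :: "'a set \<Rightarrow> nat" where "rk \<equiv> mat_rank \<I>"

lemma indep_finite: "I \<in> \<I> \<Longrightarrow> finite I"
  using indep_ground finite_ground finite_subset by blast

lemma finite_indep_cards: "finite {card I | I. I \<in> \<I> \<and> I \<subseteq> X}"
proof (rule finite_subset)
  show "{card I | I. I \<in> \<I> \<and> I \<subseteq> X} \<subseteq> {..card E}"
    using indep_ground finite_ground by (auto intro: card_mono)
qed simp

lemma card_le_rank: "I \<in> \<I> \<Longrightarrow> I \<subseteq> X \<Longrightarrow> card I \<le> rk X"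
  unfolding mat_rank_def using finite_indep_cards by (intro Max_ge) auto

lemma rank_witness:
  obtains I where "I \<in> \<I>" "I \<subseteq> X" "card I = rk X"
proof -
  have "{card I | I. I \<in> \<I> \<and> I \<subseteq> X} \<noteq> {}" using indep_empty by auto
  then have "rk X \<in> {card I | I. I \<in> \<I> \<and> I \<subseteq> X}"
    unfolding mat_rank_def using finite_indep_cards by (intro Max_in)
  then show ?thesis using that by auto
qed

lemma rank_mono: "X \<subseteq> Y \<Longrightarrow> rk X \<le> rk Y"
  using rank_witness[of X] card_le_rank[of _ Y] by (metis order_trans)

lemma rank_le_card: "finite X \<Longrightarrow> rk X \<le> card X"
  using rank_witness[of X] card_mono by metis

lemma rank_insert_le: "rk (insert x X) \<le> Suc (rk X)"
proof -
  obtain I where I: "I \<in> \<I>" "I \<subseteq> insert x X" "card I = rk (insert x X)"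
    by (rule rank_witness)
  have "card (I - {x}) \<le> rk X"
    by (rule card_le_rank) (use I indep_mono in blast)+
  moreover have "card I \<le> Suc (card (I - {x}))"
    using indep_finite[OF I(1)] by (cases "x \<in> I") (simp_all add: card_Suc_Diff1)
  ultimately show ?thesis using I by simp
qed

lemma extend_indep:
  assumes "I \<in> \<I>" "I \<subseteq> X"
  obtains J where "J \<in> \<I>" "I \<subseteq> J" "J \<subseteq> X" "card J = rk X"
proof -
  have "\<exists>J\<in>\<I>. I \<subseteq> J \<and> J \<subseteq> X \<and> card J = rk X"
    using assms
  proof (induction "rk X - card I" arbitrary: I)
    case 0
    then show ?case using card_le_rank[of I X] by (intro bexI[of _ I]) auto
  next
    case (Suc m)
    obtain K where K: "K \<in> \<I>" "K \<subseteq> X" "card K = rk X" by (rule rank_witness)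
    have "card I < card K" using K Suc.hyps(2) by simp
    then obtain x where x: "x \<in> K - I" "insert x I \<in> \<I>"
      using indep_augment[OF Suc.prems(1) K(1)] by blast
    have "m = rk X - card (insert x I)"
      using Suc.hyps(2) x indep_finite[OF Suc.prems(1)] by simp
    moreover have "insert x I \<subseteq> X" using x K Suc.prems by auto
    ultimately show ?case using Suc.hyps(1)[of "insert x I"] x(2) by auto
  qed
  then show ?thesis using that by blast
qed

text \<open>Extend a maximal independent subset \<open>I\<close> of \<open>X\<close> to a maximal
  independent subset \<open>J\<close> of \<open>Y\<close>. If \<open>e\<close> could be added to
  \<open>J\<close>, it could be added to \<open>I\<close> as well.\<close>

lemma rank_insert_eq_mono:
  assumes "X \<subseteq> Y" "rk (insert e X) = rk X"
  shows "rk (insert e Y) = rk Y"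
proof (rule antisym)
  obtain I where I: "I \<in> \<I>" "I \<subseteq> X" "card I = rk X" by (rule rank_witness)
  then obtain J where J: "J \<in> \<I>" "I \<subseteq> J" "J \<subseteq> Y" "card J = rk Y"
    using assms(1) extend_indep[of I Y] by (metis order_trans)
  obtain K where K: "K \<in> \<I>" "K \<subseteq> insert e Y" "card K = rk (insert e Y)" by (rule rank_witness)
  show "rk (insert e Y) \<le> rk Y"
  proof (rule ccontr)
    assume "\<not> rk (insert e Y) \<le> rk Y"
    then obtain x where x: "x \<in> K - J" "insert x J \<in> \<I>"
      using indep_augment[OF J(1) K(1)] J K by auto
    have c: "card (insert x J) = Suc (rk Y)" using x J indep_finite by simp
    show False
    proof (cases "x \<in> Y")
      case True
      then have "card (insert x J) \<le> rk Y" using x J by (intro card_le_rank) auto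
      then show False using c by simp
    next
      case False
      then have "x = e" using x K by auto
      then have "insert e I \<in> \<I>" using indep_mono[OF x(2)] J(2) by (meson insert_mono)
      then have "card (insert e I) \<le> rk (insert e X)" using I by (intro card_le_rank) auto
      moreover have "e \<notin> I" using x J \<open>x = e\<close> by auto
      ultimately show False using assms(2) I indep_finite by simp
    qed
  qed
  show "rk Y \<le> rk (insert e Y)" by (rule rank_mono) auto
qed

lemma rank_Un_absorb:
  assumes "\<And>y. y \<in> Y \<Longrightarrow> rk (insert y X) = rk X"
  shows "rk (X \<union> Y) = rk X"
proof (rule antisym)
  obtain I where I: "I \<in> \<I>" "I \<subseteq> X" "card I = rk X" by (rule rank_witness)
  obtain J where J: "J \<in> \<I>" "J \<subseteq> X \<union> Y" "card J = rk (X \<union> Y)" by (rule rank_witness)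
  show "rk (X \<union> Y) \<le> rk X"
  proof (rule ccontr)
    assume "\<not> rk (X \<union> Y) \<le> rk X"
    then obtain x where x: "x \<in> J - I" "insert x I \<in> \<I>"
      using indep_augment[OF I(1) J(1)] I J by auto
    then have "card (insert x I) \<le> rk (insert x X)" using I by (intro card_le_rank) auto
    moreover have "rk (insert x X) = rk X"
      using assms x J by (cases "x \<in> X") (auto simp: insert_absorb)
    ultimately show False using x I indep_finite by simp
  qed
  show "rk X \<le> rk (X \<union> Y)" by (rule rank_mono) auto
qed

section \<open>Closure and flats\<close>

definition cl :: "'a set \<Rightarrow> 'a set" where "cl X = {e \<in> E. rk (insert e X) = rk X}"

lemma subset_cl: "X \<subseteq> E \<Longrightarrow> X \<subseteq> cl X"
  by (auto simp: cl_def insert_absorb)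

lemma rank_cl:
  assumes "X \<subseteq> E"
  shows "rk (cl X) = rk X"
proof -
  have "rk (X \<union> cl X) = rk X" by (rule rank_Un_absorb) (simp add: cl_def)
  then show ?thesis using subset_cl[OF assms] by (simp add: sup.absorb2)
qed

lemma flat_cl:
  assumes "X \<subseteq> E"
  shows "mat_flat E \<I> (cl X)"
  unfolding mat_flat_def
proof (intro conjI ballI)
  show "cl X \<subseteq> E" by (auto simp: cl_def)
  fix e assume e: "e \<in> E - cl X"
  then have "rk (insert e X) \<noteq> rk X" by (auto simp: cl_def)
  moreover have "rk X \<le> rk (insert e X)" by (rule rank_mono) auto
  moreover have "rk (insert e X) \<le> rk (insert e (cl X))"
    by (rule rank_mono) (use subset_cl[OF assms] in auto)
  ultimately show "rk (insert e (cl X)) > rk (cl X)"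
    using rank_cl[OF assms] by simp
qed

lemma cl_subset_flat:
  assumes "mat_flat E \<I> F" "X \<subseteq> F"
  shows "cl X \<subseteq> F"
proof
  fix e assume e: "e \<in> cl X"
  then have "rk (insert e F) = rk F"
    using rank_insert_eq_mono[OF assms(2)] by (simp add: cl_def)
  then show "e \<in> F" using assms(1) e by (force simp: mat_flat_def cl_def)
qed

lemma flat_eq_cl:
  assumes "mat_flat E \<I> F" "X \<subseteq> F" "rk F = rk X"
  shows "F = cl X"
proof
  show "F \<subseteq> cl X"
  proof
    fix e assume e: "e \<in> F"
    have "rk (insert e X) \<le> rk F" by (rule rank_mono) (use e assms in auto)
    moreover have "rk X \<le> rk (insert e X)" by (rule rank_mono) auto
    ultimately show "e \<in> cl X" using assms e by (auto simp: cl_def mat_flat_def)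
  qed
  show "cl X \<subseteq> F" by (rule cl_subset_flat[OF assms(1,2)])
qed

lemma flats_containing:
  assumes "X \<subseteq> E" "rk X = k"
  shows "{F \<in> flats_of_rank E \<I> k. X \<subseteq> F} = {cl X}"
proof
  show "{F \<in> flats_of_rank E \<I> k. X \<subseteq> F} \<subseteq> {cl X}"
    using flat_eq_cl[of _ X] assms(2) by (simp add: flats_of_rank_def subset_iff)
  show "{cl X} \<subseteq> {F \<in> flats_of_rank E \<I> k. X \<subseteq> F}"
    using flat_cl[OF assms(1)] rank_cl[OF assms(1)] subset_cl[OF assms(1)] assms(2) by (simp add: flats_of_rank_def)
qed

lemma flats_containing_cl:
  assumes "X \<subseteq> E"
  shows "{F \<in> flats_of_rank E \<I> k. X \<subseteq> F} = {F \<in> flats_of_rank E \<I> k. cl X \<subseteq> F}"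
  using subset_cl[OF assms] cl_subset_flat[of _ X] by (auto simp: flats_of_rank_def)

lemma flats_subset: "F \<in> flats_of_rank E \<I> k \<Longrightarrow> F \<subseteq> E"
  by (simp add: flats_of_rank_def mat_flat_def)

lemma flats_rank: "F \<in> flats_of_rank E \<I> k \<Longrightarrow> rk F = k"
  by (simp add: flats_of_rank_def)

lemma finite_flats: "finite (flats_of_rank E \<I> k)"
  by (rule finite_subset[of _ "Pow E"]) (auto dest: flats_subset simp: finite_ground)

lemma flats_card: "F \<in> flats_of_rank E \<I> k \<Longrightarrow> k \<le> card F"
  using rank_le_card[of F] flats_subset[of F k] flats_rank[of F k] finite_ground finite_subset by metis

lemma cl_flat: "F \<in> flats_of_rank E \<I> k \<Longrightarrow> cl F = F"
  using flat_eq_cl[of F F] by (simp add: flats_of_rank_def)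

text \<open>The flats of rank \<open>Suc k\<close> above \<open>L\<close> partition
  \<open>E - L\<close>: an element \<open>e\<close> outside \<open>L\<close> lies in exactly one of
  them, the closure of \<open>insert e L\<close>.\<close>

lemma sum_card_diff_covers:
  assumes "L \<in> flats_of_rank E \<I> k"
  shows "(\<Sum>P | P \<in> flats_of_rank E \<I> (Suc k) \<and> L \<subseteq> P. card (P - L)) = card (E - L)"
proof -
  let ?C = "{P. P \<in> flats_of_rank E \<I> (Suc k) \<and> L \<subseteq> P}"
  have L: "mat_flat E \<I> L" "rk L = k" "L \<subseteq> E"
    using assms by (auto simp: flats_of_rank_def mat_flat_def)
  have rki: "rk (insert e L) = Suc k" if "e \<in> E - L" for e
    using L that rank_insert_le[of e L] by (force simp: mat_flat_def)
  have "card (\<Union>P\<in>?C. P - L) = (\<Sum>P\<in>?C. card (P - L))"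
  proof (rule card_UN_disjoint)
    show "finite ?C" using finite_flats by simp
    show "\<forall>P\<in>?C. finite (P - L)"
      using flats_subset finite_ground finite_subset by (metis (mono_tags, lifting) finite_Diff mem_Collect_eq)
    show "\<forall>P\<in>?C. \<forall>Q\<in>?C. P \<noteq> Q \<longrightarrow> (P - L) \<inter> (Q - L) = {}"
    proof (intro ballI impI, rule ccontr)
      fix P Q assume PQ: "P \<in> ?C" "Q \<in> ?C" "P \<noteq> Q" "(P - L) \<inter> (Q - L) \<noteq> {}"
      then obtain e where e: "e \<in> P" "e \<in> Q" "e \<notin> L" by auto
      then have eE: "e \<in> E - L" using PQ flats_subset by auto
      have "P = cl (insert e L)" "Q = cl (insert e L)"
        by (rule flat_eq_cl, use PQ e rki[OF eE] in \<open>simp_all add: flats_of_rank_def\<close>)+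
      then show False using PQ by simp
    qed
  qed
  moreover have "(\<Union>P\<in>?C. P - L) = E - L"
  proof
    show "E - L \<subseteq> (\<Union>P\<in>?C. P - L)"
    proof
      fix e assume e: "e \<in> E - L"
      then have sub: "insert e L \<subseteq> E" using L by auto
      have "cl (insert e L) \<in> ?C" "e \<in> cl (insert e L)"
        using rki[OF e] flat_cl[OF sub] rank_cl[OF sub] subset_cl[OF sub] by (auto simp: flats_of_rank_def)
      then show "e \<in> (\<Union>P\<in>?C. P - L)" using e by auto
    qed
  qed (use flats_subset in auto)
  ultimately show ?thesis by simp
qed

section \<open>Consequences of having no loops, coloops or parallel pairs\<close>

lemma basis_card:
  assumes "mat_basis \<I> B"
  shows "card B = rk E"
proof -
  have B: "B \<in> \<I>" using assms by (simp add: mat_basis_def)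
  obtain J where J: "J \<in> \<I>" "B \<subseteq> J" "J \<subseteq> E" "card J = rk E"
    by (rule extend_indep[OF B indep_ground[OF B]])
  then have "J = B" using assms by (simp add: mat_basis_def)
  then show ?thesis using J by simp
qed

lemma indep_rank_basis:
  assumes "J \<in> \<I>" "card J = rk E"
  shows "mat_basis \<I> J"
  unfolding mat_basis_def
proof (intro conjI ballI impI)
  fix K assume K: "K \<in> \<I>" "J \<subseteq> K"
  then have "card K \<le> card J" using card_le_rank[OF K(1) indep_ground[OF K(1)]] assms by simp
  then show "K = J" using card_seteq[OF indep_finite[OF K(1)] K(2)] by simp
qed (fact assms(1))

text \<open>A coloop \<open>e\<close> lies in no circuit \<open>C\<close>: otherwise
  \<open>C - {e}\<close> extends to a basis, which contains \<open>e\<close> and hence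
  \<open>C\<close>. So \<open>e\<close> is a component by itself, and connectedness leaves
  \<open>E = {e}\<close>, of rank at most \<open>1\<close>.\<close>

lemma no_coloop_if_connected:
  assumes "mat_connected E \<I>" "rk E \<ge> 2"
  shows "\<not> mat_coloop E \<I> e"
proof
  assume e: "mat_coloop E \<I> e"
  define R where "R = {(e, f). e \<in> E \<and> f \<in> E \<and> (e = f \<or> (\<exists>C. mat_circuit E \<I> C \<and> e \<in> C \<and> f \<in> C))}"
  have no_circuit: "e \<notin> C" if C: "mat_circuit E \<I> C" for C
  proof
    assume eC: "e \<in> C"
    then have "C - {e} \<subset> C" by auto
    then have Ce: "C - {e} \<in> \<I>" using C by (simp add: mat_circuit_def)
    obtain J where J: "J \<in> \<I>" "C - {e} \<subseteq> J" "J \<subseteq> E" "card J = rk E"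
      by (rule extend_indep[OF Ce indep_ground[OF Ce]])
    then have "e \<in> J" using e indep_rank_basis by (auto simp: mat_coloop_def)
    then have "C \<subseteq> J" using J by auto
    then have "C \<in> \<I>" using J indep_mono by blast
    then show False using C by (simp add: mat_circuit_def)
  qed
  have eE: "e \<in> E" using e by (simp add: mat_coloop_def)
  have Re: "R `` {e} = {e}"
  proof (intro set_eqI iffI)
    fix f assume "f \<in> R `` {e}"
    then show "f \<in> {e}" unfolding R_def using no_circuit by fastforce
  qed (simp add: R_def eE)
  have "card (E // R) = 1" using assms(1) by (simp add: mat_connected_def mat_components_def R_def)
  then obtain Z where Z: "E // R = {Z}" by (auto simp: card_Suc_eq)
  have "x = e" if "x \<in> E" for x
  proof -
    have "R `` {x} \<in> E // R" "R `` {e} \<in> E // R" using that eE by (auto intro: quotientI)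
    then have Rx: "R `` {x} = {e}" unfolding Z Re by (metis singletonD)
    have "x \<in> R `` {x}" using that by (simp add: R_def)
    then show ?thesis unfolding Rx by simp
  qed
  then have "E = {e}" using eE by blast
  then show False using assms(2) rank_le_card[OF finite_ground] by simp
qed

text \<open>If a single element \<open>e\<close> were missing from the non-spanning set
  \<open>X\<close>, no basis could avoid \<open>e\<close>, which would be a coloop.\<close>

lemma card_compl_ge_2:
  assumes "\<nexists>e. mat_coloop E \<I> e" "X \<subseteq> E" "rk X < rk E"
  shows "card (E - X) \<ge> 2"
proof (rule ccontr)
  assume "\<not> 2 \<le> card (E - X)"
  moreover have "E - X \<noteq> {}" using assms by auto
  then have "card (E - X) \<noteq> 0" using finite_ground by simp
  ultimately have "card (E - X) = 1" by simp
  then obtain e where e: "E - X = {e}" by (auto simp: card_Suc_eq)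
  have "e \<in> B" if "mat_basis \<I> B" for B
  proof (rule ccontr)
    assume "e \<notin> B"
    moreover have B: "B \<in> \<I>" "B \<subseteq> E" using that indep_ground by (auto simp: mat_basis_def)
    ultimately have "B \<subseteq> X" using e by auto
    then have "card B \<le> rk X" using B card_le_rank by simp
    then show False using basis_card[OF that] assms by simp
  qed
  then show False using assms e by (auto simp: mat_coloop_def)
qed

text \<open>One more element raises the rank by at most one, so \<open>card_compl_ge_2\<close>
  applies to the enlarged set.\<close>

lemma card_compl_ge_3:
  assumes "\<nexists>e. mat_coloop E \<I> e" "X \<subseteq> E" "Suc (rk X) < rk E"
  shows "card (E - X) \<ge> 3"
proof -
  have "E - X \<noteq> {}" using assms by auto
  then obtain e where e: "e \<in> E - X" by auto
  have "card (E - insert e X) \<ge> 2"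
    using e assms rank_insert_le[of e X] by (intro card_compl_ge_2) auto
  moreover have "card (E - X) = Suc (card (E - insert e X))"
    using e finite_ground by (metis Diff_insert card_Suc_Diff1 finite_Diff)
  ultimately show ?thesis by simp
qed

lemma rank_ge_1:
  assumes "\<nexists>e. mat_loop E \<I> e" "X \<subseteq> E" "X \<noteq> {}"
  shows "rk X \<ge> 1"
proof -
  obtain x where x: "x \<in> X" using assms by auto
  then have "{x} \<in> \<I>" using assms by (auto simp: mat_loop_def)
  then show ?thesis using card_le_rank[of "{x}" X] x by simp
qed

text \<open>Two distinct elements that are not loops are independent, since otherwise they would
  form a circuit and be parallel.\<close>

lemma rank_ge_2:
  assumes "\<nexists>e. mat_loop E \<I> e" "\<nexists>e f. mat_parallel E \<I> e f" "X \<subseteq> E" "card X \<ge> 2"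
  shows "rk X \<ge> 2"
proof -
  have "finite X" using assms(3) finite_ground by (rule finite_subset)
  moreover have "\<not> card X \<le> Suc 0" using assms(4) by simp
  ultimately obtain x y where xy: "x \<in> X" "y \<in> X" "x \<noteq> y"
    by (auto simp: card_le_Suc0_iff_eq)
  have "{x, y} \<in> \<I>"
  proof (rule ccontr)
    assume "{x, y} \<notin> \<I>"
    moreover have "D \<in> \<I>" if "D \<subset> {x, y}" for D
    proof -
      have "{x} \<in> \<I>" "{y} \<in> \<I>" using assms xy by (auto simp: mat_loop_def)
      moreover have "D \<subseteq> {x} \<or> D \<subseteq> {y}" using that by auto
      ultimately show ?thesis using indep_mono by blast
    qed
    moreover have "{x, y} \<subseteq> E" using xy assms(3) by auto
    ultimately have "mat_parallel E \<I> x y"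
      using xy(3) by (simp add: mat_parallel_def mat_circuit_def)
    then show False using assms(2) by simp
  qed
  then have "card {x, y} \<le> rk X" using xy by (intro card_le_rank) auto
  then show ?thesis using xy by simp
qed

end

section \<open>Collecting sets by lines and planes\<close>

text \<open>For a set of \<open>n\<close> elements this is \<open>(- 1) ^ n\<close> times the
  \<open>n\<close>-th forward difference of \<open>h\<close> at \<open>0\<close>.\<close>

definition alt_sum :: "(nat \<Rightarrow> int) \<Rightarrow> 'a set \<Rightarrow> int"
  where "alt_sum h X = (\<Sum>S\<in>Pow X. (- 1) ^ card S * h (card S))"

text \<open>The subsets come in pairs \<open>S\<close>, \<open>insert x S\<close>, so removing an
  element of the ground set replaces \<open>h\<close> by a difference. The weights below become a
  single spike after one, two or three such steps.\<close>

lemma alt_sum_insert: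
  assumes "finite X" "x \<notin> X"
  shows "alt_sum h (insert x X) = alt_sum (\<lambda>k. h k - h (Suc k)) X"
proof -
  have inj: "inj_on (insert x) (Pow X)"
  proof (rule inj_onI)
    fix S T assume ST: "S \<in> Pow X" "T \<in> Pow X" "insert x S = insert x T"
    then have "x \<notin> S" "x \<notin> T" using assms by auto
    then show "S = T" using ST by (simp add: insert_ident)
  qed
  have "alt_sum h (insert x X) = alt_sum h X + (\<Sum>S\<in>Pow X. (- 1) ^ card (insert x S) * h (card (insert x S)))"
    unfolding alt_sum_def Pow_insert using assms
    by (subst sum.union_disjoint) (auto simp: sum.reindex[OF inj])
  also have "(\<Sum>S\<in>Pow X. (- 1) ^ card (insert x S) * h (card (insert x S)))
    = (\<Sum>S\<in>Pow X. - ((- 1) ^ card S * h (Suc (card S))))"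
  proof (rule sum.cong[OF refl])
    fix S assume "S \<in> Pow X"
    then have "card (insert x S) = Suc (card S)"
      using assms finite_subset by (subst card_insert_disjoint) auto
    then show "(- 1) ^ card (insert x S) * h (card (insert x S)) = - ((- 1) ^ card S * h (Suc (card S)))"
      by simp
  qed
  finally show ?thesis
    by (simp add: alt_sum_def algebra_simps sum_subtractf sum_negf)
qed

lemma alt_sum_Suc:
  fixes X :: "'a set"
  assumes "finite X" "card X = Suc n"
  obtains Y :: "'a set" where "finite Y" "card Y = n" "alt_sum h X = alt_sum (\<lambda>k. h k - h (Suc k)) Y"
proof -
  obtain x Y where X: "X = insert x Y" "x \<notin> Y" "card Y = n"
    using assms(2) by (auto simp: card_Suc_eq)
  then have Y: "finite Y" using assms(1) by simp
  show ?thesis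
    by (rule that[OF Y X(3)]) (simp only: X(1) alt_sum_insert[OF Y X(2)])
qed

lemma alt_sum_single:
  assumes "finite X"
  shows "alt_sum (\<lambda>k. if k = m then c else 0) X = (- 1) ^ m * c * int (card X choose m)"
proof -
  have "alt_sum (\<lambda>k. if k = m then c else 0) X = (\<Sum>S\<in>Pow X. if card S = m then (- 1) ^ m * c else 0)"
    unfolding alt_sum_def by (rule sum.cong) auto
  also have "\<dots> = (\<Sum>S | S \<in> Pow X \<and> card S = m. (- 1) ^ m * c)"
    by (rule sum.inter_filter[symmetric]) (use assms in simp)
  also have "\<dots> = (- 1) ^ m * c * int (card {S. S \<subseteq> X \<and> card S = m})"
    by simp
  also have "\<dots> = (- 1) ^ m * c * int (card X choose m)"
    by (simp only: n_subsets[OF assms])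
  finally show ?thesis .
qed

text \<open>One difference turns the step into a spike at \<open>1\<close>. The empty set has no
  element to remove, which is the reason for the correction term.\<close>

lemma alt_sum_cards_from_2:
  fixes X :: "'a set"
  assumes "finite X"
  shows "alt_sum (\<lambda>k. if 2 \<le> k then 1 else 0) X = int (card X) - 1 + (if X = {} then 1 else 0)"
proof (cases "card X")
  case 0
  then show ?thesis using assms by (simp add: alt_sum_def)
next
  case (Suc n)
  obtain Y :: "'a set" where Y: "finite Y" "card Y = n"
    "alt_sum (\<lambda>k. if 2 \<le> k then 1 else 0) X = alt_sum (\<lambda>k. (if 2 \<le> k then 1 else 0) - (if 2 \<le> Suc k then 1 else 0)) Y"
    by (rule alt_sum_Suc[OF assms Suc, where h = "\<lambda>k. if 2 \<le> k then 1 else 0"])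
  have "(\<lambda>k. (if 2 \<le> k then 1 else 0) - (if 2 \<le> Suc k then 1 else 0)) = (\<lambda>k. if k = 1 then - 1 else (0::int))"
    by (auto simp: fun_eq_iff)
  then show ?thesis using Y Suc by (auto simp: alt_sum_single)
qed

text \<open>Two differences: the ramp becomes a step, and the step a spike at
  \<open>2\<close>.\<close>

lemma alt_sum_cards_from_3:
  fixes X :: "'a set"
  assumes "finite X" "card X \<ge> 2"
  shows "alt_sum (\<lambda>k. if 3 \<le> k then int (k - 3) else 0) X = int ((card X - 2) choose 2)"
proof -
  let ?h = "\<lambda>k. if 3 \<le> k then int (k - 3) else 0" and ?h' = "\<lambda>k. if 3 \<le> k then - 1 else (0::int)"
  define n where "n = card X - 2"
  have n: "card X = Suc (Suc n)" using assms(2) by (simp add: n_def)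
  obtain Y :: "'a set" where Y: "finite Y" "card Y = Suc n" "alt_sum ?h X = alt_sum (\<lambda>k. ?h k - ?h (Suc k)) Y"
    by (rule alt_sum_Suc[OF assms(1) n, where h = "?h"])
  have "(\<lambda>k. ?h k - ?h (Suc k)) = ?h'" by (auto simp: fun_eq_iff)
  moreover obtain Z :: "'a set" where Z: "finite Z" "card Z = n" "alt_sum ?h' Y = alt_sum (\<lambda>k. ?h' k - ?h' (Suc k)) Z"
    by (rule alt_sum_Suc[OF Y(1,2), where h = "?h'"])
  moreover have "(\<lambda>k. ?h' k - ?h' (Suc k)) = (\<lambda>k. if k = 2 then 1 else 0)" by (auto simp: fun_eq_iff)
  ultimately have "alt_sum ?h X = alt_sum (\<lambda>k. if k = 2 then 1 else 0) Z" using Y(3) by simp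
  then show ?thesis using Z n by (simp add: alt_sum_single)
qed

text \<open>Three differences: from quadratic to ramp, to step, to a spike at
  \<open>3\<close>.\<close>

lemma alt_sum_cards_from_4:
  fixes X :: "'a set"
  assumes "finite X" "card X \<ge> 2"
  shows "alt_sum (\<lambda>k. if 4 \<le> k then int ((k - 4) choose 2) else 0) X = int ((card X - 3) choose 3)"
\<comment> \<open>Three differences consume three elements. With two elements both sides are
  \<open>0\<close>: there is no subset of size four, and \<open>card X - 3\<close> is
  truncated.\<close>
proof (cases "card X = 2")
  case True
  have "alt_sum (\<lambda>k. if 4 \<le> k then int ((k - 4) choose 2) else 0) X = 0"
    unfolding alt_sum_def using True assms(1) by (intro sum.neutral) (auto dest!: card_mono[OF assms(1)])
  then show ?thesis using True by simp
next
  case False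
  let ?h = "\<lambda>k. if 4 \<le> k then int ((k - 4) choose 2) else 0" 
    and ?h1 = "\<lambda>k. if 4 \<le> k then - int (k - 4) else 0"
    and ?h2 = "\<lambda>k. if 4 \<le> k then 1 else (0::int)"
  define n where "n = card X - 3"
  have n: "card X = Suc (Suc (Suc n))" using assms(2) False by (simp add: n_def)
  obtain Y :: "'a set" where Y: "finite Y" "card Y = Suc (Suc n)" "alt_sum ?h X = alt_sum (\<lambda>k. ?h k - ?h (Suc k)) Y"
    by (rule alt_sum_Suc[OF assms(1) n, where h = "?h"])
  obtain Z :: "'a set" where Z: "finite Z" "card Z = Suc n" "alt_sum ?h1 Y = alt_sum (\<lambda>k. ?h1 k - ?h1 (Suc k)) Z"
    by (rule alt_sum_Suc[OF Y(1,2), where h = "?h1"])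
  obtain V :: "'a set" where V: "finite V" "card V = n" "alt_sum ?h2 Z = alt_sum (\<lambda>k. ?h2 k - ?h2 (Suc k)) V"
    by (rule alt_sum_Suc[OF Z(1,2), where h = "?h2"])
  have "?h k - ?h (Suc k) = ?h1 k" for k
  proof (cases "4 \<le> k")
    case True
    then obtain i where "k = i + 4" by (metis le_add_diff_inverse2)
    then show ?thesis by (simp add: numeral_2_eq_2)
  next
    case False
    then show ?thesis by (cases "k = 3") auto
  qed
  moreover have "(\<lambda>k. ?h1 k - ?h1 (Suc k)) = ?h2" by (auto simp: fun_eq_iff)
  moreover have "(\<lambda>k. ?h2 k - ?h2 (Suc k)) = (\<lambda>k. if k = 3 then - 1 else 0)" by (auto simp: fun_eq_iff)
  ultimately have "alt_sum ?h X = alt_sum (\<lambda>k. if k = 3 then - 1 else 0) V" using Y(3) Z(3) V(3) by simp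
  then show ?thesis using V n by (simp add: alt_sum_single)
qed

text \<open>Write \<open>S\<close> as \<open>A \<union> Y\<close> with \<open>Y\<close> disjoint
  from \<open>A\<close>; the two signs combine to \<open>(- 1) ^ card Y\<close>.\<close>

lemma sum_supersets_alt:
  assumes "finite X" "A \<subseteq> X"
  shows "(\<Sum>S | A \<subseteq> S \<and> S \<subseteq> X \<and> card A + 2 \<le> card S. (- 1) ^ card S * (- 1) ^ card A)
    = int (card X) - int (card A) - 1 + (if X = A then 1 else 0)"
proof -
  have fin: "finite A" using assms finite_subset by auto
  have "(\<Sum>S | A \<subseteq> S \<and> S \<subseteq> X \<and> card A + 2 \<le> card S. (- 1) ^ card S * (- 1) ^ card A)
    = (\<Sum>Y | Y \<in> Pow (X - A) \<and> 2 \<le> card Y. (- 1 :: int) ^ card Y)"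
  proof (rule sum.reindex_bij_witness[where i = "\<lambda>Y. A \<union> Y" and j = "\<lambda>S. S - A"])
    fix S assume S: "S \<in> {S. A \<subseteq> S \<and> S \<subseteq> X \<and> card A + 2 \<le> card S}"
    then have "card S = card A + card (S - A)"
      using fin assms finite_subset by (metis (mono_tags, lifting) card_Diff_subset card_mono le_add_diff_inverse mem_Collect_eq)
    then show "(- 1 :: int) ^ card (S - A) = (- 1) ^ card S * (- 1) ^ card A" "S - A \<in> {Y. Y \<in> Pow (X - A) \<and> 2 \<le> card Y}"
      using S by (auto simp: power_add minus_one_power_iff)
  next
    fix Y assume Y: "Y \<in> {Y. Y \<in> Pow (X - A) \<and> 2 \<le> card Y}"
    then have "card (A \<union> Y) = card A + card Y"
      using fin assms finite_subset by (subst card_Un_disjoint) auto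
    then show "A \<union> Y \<in> {S. A \<subseteq> S \<and> S \<subseteq> X \<and> card A + 2 \<le> card S}" "A \<union> Y - A = Y"
      using Y assms by auto
  qed auto
  also have "\<dots> = (\<Sum>Y\<in>Pow (X - A). if 2 \<le> card Y then (- 1) ^ card Y else 0)"
    by (rule sum.inter_filter) (use assms in simp)
  also have "\<dots> = alt_sum (\<lambda>k. if 2 \<le> k then 1 else 0) (X - A)"
    unfolding alt_sum_def by (rule sum.cong) auto
  finally show ?thesis
    using assms fin by (subst (asm) alt_sum_cards_from_2) (auto simp: card_Diff_subset of_nat_diff card_mono)
qed

lemma sum_Pow_filter_alt:
  assumes "finite X"
  shows "(\<Sum>S | S \<subseteq> X \<and> Q (card S). (- 1) ^ card S * h (card S)) = alt_sum (\<lambda>k. if Q k then h k else 0) X"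
proof -
  have "(\<Sum>S | S \<subseteq> X \<and> Q (card S). (- 1) ^ card S * h (card S)) 
    = (\<Sum>S\<in>Pow X. if Q (card S) then (- 1) ^ card S * h (card S) else 0)"
    using sum.inter_filter[of "Pow X" "\<lambda>S. (- 1) ^ card S * h (card S)" "\<lambda>S. Q (card S)"] assms by simp
  also have "\<dots> = alt_sum (\<lambda>k. if Q k then h k else 0) X"
    unfolding alt_sum_def by (rule sum.cong) auto
  finally show ?thesis .
qed

section \<open>Sums over sets of rank at most three\<close>

text \<open>Connectedness is represented by the absence of coloops, which keeps complements of
  non-spanning sets large; the sign from the number of components is treated in
  \<open>omega_eq_cut_value\<close>.\<close>

locale simple_rank4_matroid = matroid +
  assumes rank_E: "mat_rank \<I> E = 4"
    and no_loops: "\<nexists>e. mat_loop E \<I> e"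
    and no_parallel: "\<nexists>e f. mat_parallel E \<I> e f"
    and no_coloops: "\<nexists>e. mat_coloop E \<I> e"
begin

abbreviation "Ls \<equiv> flats_of_rank E \<I> 2"
abbreviation "Ps \<equiv> flats_of_rank E \<I> 3"

definition N :: "'a set \<Rightarrow> int" where "N L = int (card {P \<in> Ps. L \<subseteq> P})"

lemma finite_subset_E: "X \<subseteq> E \<Longrightarrow> finite X"
  using finite_ground finite_subset by auto

text \<open>A set of rank \<open>3\<close> lies on one plane and on no line, and a set of rank \<open>2\<close> lies on one line
  \<open>L\<close> and on the planes through \<open>L\<close>.\<close>

lemma flat_weight:
  assumes "S \<subseteq> E" "card S \<ge> 2" "rk S \<le> 3"
  shows "int (card {P \<in> Ps. S \<subseteq> P}) - (\<Sum>L | L \<in> Ls \<and> S \<subseteq> L. N L - 1) = 1"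
proof -
  have "rk S \<ge> 2" using rank_ge_2[OF no_loops no_parallel] assms by simp
  then consider "rk S = 3" | "rk S = 2" using assms(3) by linarith
  then show ?thesis
  proof cases
    case 1
    have "\<not> S \<subseteq> L" if "L \<in> Ls" for L
      using rank_mono[of S L] flats_rank[OF that] 1 by auto
    then have none: "{L. L \<in> Ls \<and> S \<subseteq> L} = {}" by auto
    show ?thesis unfolding none using flats_containing[OF assms(1) 1] by simp
  next
    case 2
    have "{L. L \<in> Ls \<and> S \<subseteq> L} = {cl S}" using flats_containing[OF assms(1) 2] .
    then show ?thesis
      using flats_containing_cl[OF assms(1), of 3] by (simp add: N_def)
  qed
qed

text \<open>Insert the weight \<open>1\<close> from \<open>flat_weight\<close> and exchange the
  sums. Each flat then ranges over all of its own subsets with \<open>Q\<close>, where alternating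
  sums can be evaluated, and the factor \<open>N L - 1\<close> removes the multiple counting of sets
  on a line.\<close>

lemma sum_rank_le_3:
  fixes g :: "'a set \<Rightarrow> int"
  assumes "\<And>S. Q S \<Longrightarrow> card S \<ge> 2"
  shows "(\<Sum>S | S \<subseteq> E \<and> Q S \<and> rk S \<le> 3. g S)
    = (\<Sum>P\<in>Ps. \<Sum>S | S \<subseteq> P \<and> Q S. g S) - (\<Sum>L\<in>Ls. (N L - 1) * (\<Sum>S | S \<subseteq> L \<and> Q S. g S))"
proof -
  let ?X = "{S. S \<subseteq> E \<and> Q S \<and> rk S \<le> 3}"
  have finX: "finite ?X" using finite_ground by simp
  have 1: "{S. S \<in> ?X \<and> S \<subseteq> F} = {S. S \<subseteq> F \<and> Q S}" if "F \<in> flats_of_rank E \<I> k" "k \<le> 3" for F k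
  proof (intro set_eqI iffI)
    fix S assume S: "S \<in> {S. S \<subseteq> F \<and> Q S}"
    then have "S \<subseteq> F" by simp
    then have "rk S \<le> rk F" "S \<subseteq> E" using rank_mono flats_subset[OF that(1)] by auto
    then show "S \<in> {S. S \<in> ?X \<and> S \<subseteq> F}" using S flats_rank[OF that(1)] that(2) by simp
  qed simp
  have "(\<Sum>S\<in>?X. g S) = (\<Sum>S\<in>?X. g S * (int (card {P \<in> Ps. S \<subseteq> P}) - (\<Sum>L | L \<in> Ls \<and> S \<subseteq> L. N L - 1)))"
  proof (rule sum.cong[OF refl])
    fix S assume "S \<in> ?X"
    then have "int (card {P \<in> Ps. S \<subseteq> P}) - (\<Sum>L | L \<in> Ls \<and> S \<subseteq> L. N L - 1) = 1"
      using assms[of S] by (intro flat_weight) auto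
    then show "g S = g S * (int (card {P \<in> Ps. S \<subseteq> P}) - (\<Sum>L | L \<in> Ls \<and> S \<subseteq> L. N L - 1))"
      by (simp only: mult_1_right)
  qed
  also have "\<dots> = (\<Sum>S\<in>?X. \<Sum>P | P \<in> Ps \<and> S \<subseteq> P. g S) - (\<Sum>S\<in>?X. \<Sum>L | L \<in> Ls \<and> S \<subseteq> L. (N L - 1) * g S)"
    by (simp add: right_diff_distrib sum_subtractf sum_distrib_left mult.commute)
  also have "(\<Sum>S\<in>?X. \<Sum>P | P \<in> Ps \<and> S \<subseteq> P. g S) = (\<Sum>P\<in>Ps. \<Sum>S | S \<in> ?X \<and> S \<subseteq> P. g S)"
    by (rule sum.swap_restrict[OF finX finite_flats])
  also have "\<dots> = (\<Sum>P\<in>Ps. \<Sum>S | S \<subseteq> P \<and> Q S. g S)"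
    by (rule sum.cong[OF refl]) (simp only: 1 order_refl)
  also have "(\<Sum>S\<in>?X. \<Sum>L | L \<in> Ls \<and> S \<subseteq> L. (N L - 1) * g S) = (\<Sum>L\<in>Ls. \<Sum>S | S \<in> ?X \<and> S \<subseteq> L. (N L - 1) * g S)"
    by (rule sum.swap_restrict[OF finX finite_flats])
  also have "\<dots> = (\<Sum>L\<in>Ls. (N L - 1) * (\<Sum>S | S \<subseteq> L \<and> Q S. g S))"
  proof (rule sum.cong[OF refl])
    fix L assume "L \<in> Ls"
    then have "{S. S \<in> ?X \<and> S \<subseteq> L} = {S. S \<subseteq> L \<and> Q S}" by (rule 1) simp
    then show "(\<Sum>S | S \<in> ?X \<and> S \<subseteq> L. (N L - 1) * g S) = (N L - 1) * (\<Sum>S | S \<subseteq> L \<and> Q S. g S)"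
      by (simp only: sum_distrib_left)
  qed
  finally show ?thesis .
qed

lemma sum_rank_le_2:
  fixes g :: "'a set \<Rightarrow> int"
  assumes "\<And>S. Q S \<Longrightarrow> card S \<ge> 2"
  shows "(\<Sum>S | S \<subseteq> E \<and> Q S \<and> rk S \<le> 2. g S) = (\<Sum>L\<in>Ls. \<Sum>S | S \<subseteq> L \<and> Q S. g S)"
proof -
  let ?X = "{S. S \<subseteq> E \<and> Q S \<and> rk S \<le> 2}"
  have finX: "finite ?X" using finite_ground by simp
  have "(\<Sum>S\<in>?X. g S) = (\<Sum>S\<in>?X. \<Sum>L | L \<in> Ls \<and> S \<subseteq> L. g S)"
  proof (rule sum.cong[OF refl])
    fix S assume S: "S \<in> ?X"
    then have "rk S = 2" using rank_ge_2[OF no_loops no_parallel, of S] assms[of S] by auto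
    then show "g S = (\<Sum>L | L \<in> Ls \<and> S \<subseteq> L. g S)" using S flats_containing[of S 2] by simp
  qed
  also have "\<dots> = (\<Sum>L\<in>Ls. \<Sum>S | S \<in> ?X \<and> S \<subseteq> L. g S)"
    by (rule sum.swap_restrict[OF finX finite_flats])
  also have "\<dots> = (\<Sum>L\<in>Ls. \<Sum>S | S \<subseteq> L \<and> Q S. g S)"
  proof (rule sum.cong[OF refl])
    fix L assume L: "L \<in> Ls"
    have "{S. S \<in> ?X \<and> S \<subseteq> L} = {S. S \<subseteq> L \<and> Q S}"
    proof (intro set_eqI iffI)
      fix S assume S: "S \<in> {S. S \<subseteq> L \<and> Q S}"
      then have "S \<subseteq> L" by simp
      then have "rk S \<le> rk L" "S \<subseteq> E" using rank_mono flats_subset[OF L] by auto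
      then show "S \<in> {S. S \<in> ?X \<and> S \<subseteq> L}" using S flats_rank[OF L] by simp
    qed simp
    then show "(\<Sum>S | S \<in> ?X \<and> S \<subseteq> L. g S) = (\<Sum>S | S \<subseteq> L \<and> Q S. g S)" by (rule arg_cong)
  qed
  finally show ?thesis .
qed

lemma sum_card_planes_through:
  assumes "L \<in> Ls"
  shows "(\<Sum>P | P \<in> Ps \<and> L \<subseteq> P. int (card P)) = int (card E) - int (card L) + N L * int (card L)"
proof -
  have L: "L \<subseteq> E" using flats_subset[OF assms] .
  have "(\<Sum>P | P \<in> Ps \<and> L \<subseteq> P. int (card (P - L))) = int (card (E - L))"
    using sum_card_diff_covers[OF assms] by (simp add: numeral_3_eq_3 flip: of_nat_sum)
  moreover have "int (card (P - L)) = int (card P) - int (card L)" if "P \<in> Ps" "L \<subseteq> P" for P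
    using that finite_subset_E[OF L] finite_subset_E[OF flats_subset[OF that(1)]] 
    by (simp add: card_Diff_subset of_nat_diff card_mono)
  moreover have "int (card (E - L)) = int (card E) - int (card L)"
    using L finite_subset_E[OF L] finite_ground by (simp add: card_Diff_subset of_nat_diff card_mono)
  ultimately show ?thesis by (simp add: sum_subtractf N_def)
qed

text \<open>Apply \<open>sum_supersets_alt\<close> inside the planes through \<open>cl A\<close> and
  inside the line \<open>cl A\<close>. In the combination \<open>card (cl A)\<close> cancels, and so
  does \<open>N (cl A)\<close> apart from the exceptional case of a flat equal to \<open>A\<close>,
  which by rank can only be the line.\<close>

lemma sum_supersets_rank_le_3:
  assumes A: "A \<subseteq> E" "3 \<le> card A" "rk A \<le> 2"
  shows "(\<Sum>S | S \<subseteq> E \<and> (A \<subseteq> S \<and> card A + 2 \<le> card S) \<and> rk S \<le> 3. (- 1) ^ card S * (- 1) ^ card A)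
    = int (card E) - int (card A) - 1 - (if cl A = A then N A - 1 else 0)"
proof -
  let ?L = "cl A"
  have rA: "rk A = 2" using rank_ge_2[OF no_loops no_parallel A(1)] A by simp
  have L: "?L \<in> Ls" "A \<subseteq> ?L" 
    using flat_cl[OF A(1)] rank_cl[OF A(1)] subset_cl[OF A(1)] rA by (auto simp: flats_of_rank_def)
  have B: "(\<Sum>S | S \<subseteq> F \<and> A \<subseteq> S \<and> card A + 2 \<le> card S. (- 1) ^ card S * (- 1) ^ card A)
    = (if A \<subseteq> F then int (card F) - int (card A) - 1 + (if F = A then 1 else 0) else 0)" if "F \<subseteq> E" for F
  proof (cases "A \<subseteq> F")
    case True
    have "{S. S \<subseteq> F \<and> A \<subseteq> S \<and> card A + 2 \<le> card S} = {S. A \<subseteq> S \<and> S \<subseteq> F \<and> card A + 2 \<le> card S}" by auto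
    then show ?thesis using sum_supersets_alt[OF finite_subset_E[OF that] True] True by simp
  next
    case False
    then have none: "{S. S \<subseteq> F \<and> A \<subseteq> S \<and> card A + 2 \<le> card S} = {}" by auto
    show ?thesis unfolding none using False by simp
  qed
  have "(\<Sum>S | S \<subseteq> E \<and> (A \<subseteq> S \<and> card A + 2 \<le> card S) \<and> rk S \<le> 3. (- 1) ^ card S * (- 1) ^ card A)
    = (\<Sum>P\<in>Ps. \<Sum>S | S \<subseteq> P \<and> A \<subseteq> S \<and> card A + 2 \<le> card S. (- 1) ^ card S * (- 1) ^ card A) 
    - (\<Sum>L\<in>Ls. (N L - 1) * (\<Sum>S | S \<subseteq> L \<and> A \<subseteq> S \<and> card A + 2 \<le> card S. (- 1) ^ card S * (- 1) ^ card A))"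
    by (rule sum_rank_le_3) auto
  also have "(\<Sum>P\<in>Ps. \<Sum>S | S \<subseteq> P \<and> A \<subseteq> S \<and> card A + 2 \<le> card S. (- 1) ^ card S * (- 1) ^ card A) 
    = (\<Sum>P\<in>Ps. if A \<subseteq> P then int (card P) - int (card A) - 1 else 0)"
  proof (rule sum.cong[OF refl])
    fix P assume P: "P \<in> Ps"
    then have "P \<noteq> A" using rA flats_rank by force
    then show "(\<Sum>S | S \<subseteq> P \<and> A \<subseteq> S \<and> card A + 2 \<le> card S. (- 1) ^ card S * (- 1) ^ card A) 
      = (if A \<subseteq> P then int (card P) - int (card A) - 1 else 0)"
      using B[OF flats_subset[OF P]] by simp
  qed
  also have "\<dots> = (\<Sum>P | P \<in> Ps \<and> A \<subseteq> P. int (card P) - int (card A) - 1)"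
    by (rule sum.inter_filter[symmetric, OF finite_flats])
  also have "{P. P \<in> Ps \<and> A \<subseteq> P} = {P. P \<in> Ps \<and> ?L \<subseteq> P}" by (rule flats_containing_cl[OF A(1)])
  also have "(\<Sum>P | P \<in> Ps \<and> ?L \<subseteq> P. int (card P) - int (card A) - 1)
    = int (card E) - int (card ?L) + N ?L * int (card ?L) - N ?L * (int (card A) + 1)"
    using sum_card_planes_through[OF L(1)] by (simp add: sum_subtractf N_def algebra_simps)
  also have "(\<Sum>L\<in>Ls. (N L - 1) * (\<Sum>S | S \<subseteq> L \<and> A \<subseteq> S \<and> card A + 2 \<le> card S. (- 1) ^ card S * (- 1) ^ card A))
    = (\<Sum>L\<in>Ls. if A \<subseteq> L then (N L - 1) * (int (card L) - int (card A) - 1 + (if L = A then 1 else 0)) else 0)"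
    by (rule sum.cong[OF refl]) (use B flats_subset in auto)
  also have "\<dots> = (\<Sum>L | L \<in> Ls \<and> A \<subseteq> L. (N L - 1) * (int (card L) - int (card A) - 1 + (if L = A then 1 else 0)))"
    by (rule sum.inter_filter[symmetric, OF finite_flats])
  also have "\<dots> = (N ?L - 1) * (int (card ?L) - int (card A) - 1 + (if ?L = A then 1 else 0))"
    using flats_containing[OF A(1) rA] by simp
  finally show ?thesis by (cases "cl A = A") (simp_all add: algebra_simps)
qed

text \<open>The bracket of \<open>sum_greedy_positions\<close> times
  \<open>(- 1) ^ (card E - 1)\<close>, after which every sign is a parity of \<open>card S\<close>
  or \<open>card A\<close>.\<close>

definition cut_sum :: int where
  "cut_sum = int ((card E - 5) choose 3)
    - (\<Sum>S | S \<subseteq> E \<and> 4 \<le> card S \<and> rk S \<le> 3. (- 1) ^ card S * int ((card S - 4) choose 2))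
    + (\<Sum>A | A \<subseteq> E \<and> 3 \<le> card A \<and> rk A \<le> 2. (2 * (- 1) ^ card A - int (card (E - A) - 1)) * int (card A - 3))
    + (\<Sum>S | S \<subseteq> E \<and> 4 \<le> card S \<and> rk S \<le> 3.
        \<Sum>A | A \<in> {A. A \<subseteq> E \<and> 3 \<le> card A \<and> rk A \<le> 2} \<and> A \<subseteq> S \<and> card A + 2 \<le> card S.
          (- 1) ^ card S * (- 1) ^ card A * int (card A - 3))"

text \<open>The dependence on \<open>E\<close> of single and of double cuts cancels: the coefficient
  \<open>card (E - A) - 1\<close> of the former meets \<open>card E - card A - 1\<close> from
  \<open>sum_supersets_rank_le_3\<close>. Only sets \<open>A\<close> that are themselves lines leave
  a remainder, \<open>(N A - 1) * (card A - 3)\<close>; the rest is evaluated by alternating sums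
  over planes and lines.\<close>

lemma cut_sum_eq:
  "cut_sum = int ((card E - 5) choose 3) - (\<Sum>P\<in>Ps. int ((card P - 3) choose 3))
    + (\<Sum>L\<in>Ls. (N L - 1) * (int ((card L - 3) choose 3) - int (card L - 3)) + 2 * int ((card L - 2) choose 2))"
proof -
  let ?A = "{A. A \<subseteq> E \<and> 3 \<le> card A \<and> rk A \<le> 2}" and ?S = "{S. S \<subseteq> E \<and> 4 \<le> card S \<and> rk S \<le> 3}"
  have finA: "finite ?A" and finS: "finite ?S" using finite_ground by auto
  have flat_fin: "finite F" if "F \<in> flats_of_rank E \<I> k" for F k
    using flats_subset[OF that] finite_subset_E by auto
  have 1: "(\<Sum>S\<in>?S. (- 1) ^ card S * int ((card S - 4) choose 2)) 
    = (\<Sum>P\<in>Ps. int ((card P - 3) choose 3)) - (\<Sum>L\<in>Ls. (N L - 1) * int ((card L - 3) choose 3))"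
  proof -
    have *: "(\<Sum>S | S \<subseteq> F \<and> 4 \<le> card S. (- 1) ^ card S * int ((card S - 4) choose 2)) = int ((card F - 3) choose 3)"
      if "F \<in> flats_of_rank E \<I> k" "k \<ge> 2" for F k
      using sum_Pow_filter_alt[OF flat_fin[OF that(1)], where Q = "\<lambda>k. 4 \<le> k" and h = "\<lambda>k. int ((k - 4) choose 2)"]
        alt_sum_cards_from_4[OF flat_fin[OF that(1)]] flats_card[OF that(1)] that(2) by simp
    have "(\<Sum>S\<in>?S. (- 1) ^ card S * int ((card S - 4) choose 2)) 
      = (\<Sum>P\<in>Ps. \<Sum>S | S \<subseteq> P \<and> 4 \<le> card S. (- 1) ^ card S * int ((card S - 4) choose 2))
      - (\<Sum>L\<in>Ls. (N L - 1) * (\<Sum>S | S \<subseteq> L \<and> 4 \<le> card S. (- 1) ^ card S * int ((card S - 4) choose 2)))"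
      by (rule sum_rank_le_3) simp
    then show ?thesis by (simp add: * cong: sum.cong)
  qed
  have 2: "(\<Sum>S\<in>?S. \<Sum>A | A \<in> ?A \<and> A \<subseteq> S \<and> card A + 2 \<le> card S. (- 1) ^ card S * (- 1) ^ card A * int (card A - 3))
    = (\<Sum>A\<in>?A. (int (card E) - int (card A) - 1 - (if cl A = A then N A - 1 else 0)) * int (card A - 3))"
  proof -
    have "(\<Sum>S\<in>?S. \<Sum>A | A \<in> ?A \<and> A \<subseteq> S \<and> card A + 2 \<le> card S. (- 1) ^ card S * (- 1) ^ card A * int (card A - 3))
      = (\<Sum>A\<in>?A. \<Sum>S | S \<in> ?S \<and> A \<subseteq> S \<and> card A + 2 \<le> card S. (- 1) ^ card S * (- 1) ^ card A * int (card A - 3))"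
      by (rule sum.swap_restrict[OF finS finA])
    also have "\<dots> = (\<Sum>A\<in>?A. (int (card E) - int (card A) - 1 - (if cl A = A then N A - 1 else 0)) * int (card A - 3))"
    proof (rule sum.cong[OF refl])
      fix A assume A: "A \<in> ?A"
      then have "{S. S \<in> ?S \<and> A \<subseteq> S \<and> card A + 2 \<le> card S} = {S. S \<subseteq> E \<and> (A \<subseteq> S \<and> card A + 2 \<le> card S) \<and> rk S \<le> 3}"
        by auto
      then show "(\<Sum>S | S \<in> ?S \<and> A \<subseteq> S \<and> card A + 2 \<le> card S. (- 1) ^ card S * (- 1) ^ card A * int (card A - 3))
        = (int (card E) - int (card A) - 1 - (if cl A = A then N A - 1 else 0)) * int (card A - 3)"
        using sum_supersets_rank_le_3[of A] A by (simp add: sum_distrib_right[symmetric])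
    qed
    finally show ?thesis .
  qed
  have 3: "(\<Sum>A\<in>?A. (2 * (- 1) ^ card A - int (card (E - A) - 1)) * int (card A - 3))
    + (\<Sum>A\<in>?A. (int (card E) - int (card A) - 1 - (if cl A = A then N A - 1 else 0)) * int (card A - 3))
    = 2 * (\<Sum>A\<in>?A. (- 1) ^ card A * int (card A - 3)) - (\<Sum>A\<in>?A. if cl A = A then (N A - 1) * int (card A - 3) else 0)"
    unfolding sum.distrib[symmetric] sum_distrib_left sum_subtractf[symmetric]
  proof (rule sum.cong[OF refl])
    fix A assume A: "A \<in> ?A"
    \<comment> \<open>The bound turns the truncated \<open>card (E - A) - 1\<close> into an honest
      integer difference.\<close>
    then have "card (E - A) \<ge> 3" using no_coloops rank_E by (intro card_compl_ge_3) auto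
    moreover have "card (E - A) = card E - card A" "card A \<le> card E" 
      using A finite_ground finite_subset_E by (auto simp: card_Diff_subset card_mono)
    ultimately have compl: "int (card (E - A) - 1) = int (card E) - int (card A) - 1" by simp
    show "(2 * (- 1) ^ card A - int (card (E - A) - 1)) * int (card A - 3)
      + (int (card E) - int (card A) - 1 - (if cl A = A then N A - 1 else 0)) * int (card A - 3)
      = 2 * ((- 1) ^ card A * int (card A - 3)) - (if cl A = A then (N A - 1) * int (card A - 3) else 0)"
      unfolding compl by (cases "cl A = A") (simp_all add: algebra_simps)
  qed
  have 4: "(\<Sum>A\<in>?A. (- 1) ^ card A * int (card A - 3)) = (\<Sum>L\<in>Ls. int ((card L - 2) choose 2))"
  proof -
    have "(\<Sum>A\<in>?A. (- 1) ^ card A * int (card A - 3)) = (\<Sum>L\<in>Ls. \<Sum>A | A \<subseteq> L \<and> 3 \<le> card A. (- 1) ^ card A * int (card A - 3))"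
      by (rule sum_rank_le_2) simp
    also have "\<dots> = (\<Sum>L\<in>Ls. int ((card L - 2) choose 2))"
      by (rule sum.cong[OF refl]) 
        (use sum_Pow_filter_alt[OF flat_fin, where Q = "\<lambda>k. 3 \<le> k" and h = "\<lambda>k. int (k - 3)"]
          alt_sum_cards_from_3[OF flat_fin] flats_card in simp)
    finally show ?thesis .
  qed
  have 5: "(\<Sum>A\<in>?A. if cl A = A then (N A - 1) * int (card A - 3) else 0) = (\<Sum>L\<in>Ls. (N L - 1) * int (card L - 3))"
  proof -
    have eq: "{A. A \<in> ?A \<and> cl A = A} = {L. L \<in> Ls \<and> 3 \<le> card L}"
    proof (intro set_eqI iffI)
      fix A assume A: "A \<in> {A. A \<in> ?A \<and> cl A = A}"
      then have "rk A = 2" using rank_ge_2[OF no_loops no_parallel, of A] by simp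
      then show "A \<in> {L. L \<in> Ls \<and> 3 \<le> card L}" using A flat_cl[of A] by (simp add: flats_of_rank_def)
    next
      fix L assume L: "L \<in> {L. L \<in> Ls \<and> 3 \<le> card L}"
      then show "L \<in> {A. A \<in> ?A \<and> cl A = A}"
        using flats_subset[of L 2] flats_rank[of L 2] cl_flat[of L 2] by simp
    qed
    have "(\<Sum>A\<in>?A. if cl A = A then (N A - 1) * int (card A - 3) else 0) = (\<Sum>L | L \<in> Ls \<and> 3 \<le> card L. (N L - 1) * int (card L - 3))"
      unfolding eq[symmetric] by (rule sum.inter_filter[symmetric, OF finA])
    also have "\<dots> = (\<Sum>L\<in>Ls. (N L - 1) * int (card L - 3))"
      unfolding sum.inter_filter[OF finite_flats] by (rule sum.cong) auto
    finally show ?thesis .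
  qed
  show ?thesis
    unfolding cut_sum_def 1 2 using 3 unfolding 4 5
    by (simp add: sum.distrib sum_subtractf sum_distrib_left algebra_simps)
qed

end

section \<open>The invariant \<open>\<omega>\<close>\<close>

lemma esym_eq_0: "finite A \<Longrightarrow> card A < k \<Longrightarrow> esym k A u = 0"
  unfolding esym_def by (rule sum.neutral_const[THEN trans[rotated]], rule sum.cong) (auto dest: card_mono)

context simple_rank4_matroid
begin

section \<open>Positions of the greedy basis\<close>

text \<open>With at most four elements, removing any of them would lower the rank, contrary to
  \<open>card_compl_ge_2\<close>.\<close>

lemma card_E: "card E \<ge> 5"
proof -
  have "E \<noteq> {}" using rank_E rank_le_card[OF finite_ground] by auto
  then obtain e where e: "e \<in> E" by auto
  show ?thesis
  proof (rule ccontr)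
    assume "\<not> 5 \<le> card E"
    then have "card (E - {e}) \<le> 3" using e finite_ground by simp
    then have "rk (E - {e}) < rk E"
      using rank_le_card[of "E - {e}"] finite_ground rank_E by simp
    then have "card (E - (E - {e})) \<ge> 2" by (intro card_compl_ge_2[OF no_coloops]) auto
    moreover have "E - (E - {e}) = {e}" using e by auto
    ultimately show False by simp
  qed
qed

text \<open>As positions start at \<open>0\<close>, the length of the longest prefix of rank at most
  \<open>i\<close> is, for \<open>i < 4\<close>, also the position of the element that raises the
  rank to \<open>Suc i\<close>.\<close>

definition pos :: "nat \<Rightarrow> 'a list \<Rightarrow> nat"
  where "pos i w = Max {k. k \<le> card E \<and> rk (set (take k w)) \<le> i}"

lemma rank_prefix_le_iff:
  assumes "k \<le> card E"
  shows "rk (set (take k w)) \<le> i \<longleftrightarrow> k \<le> pos i w"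
proof
  let ?K = "{k. k \<le> card E \<and> rk (set (take k w)) \<le> i}"
  have fin: "finite ?K" by simp
  show "k \<le> pos i w" if "rk (set (take k w)) \<le> i"
    unfolding pos_def using that assms by (intro Max_ge[OF fin]) simp
  have "rk {} = 0" using rank_le_card[of "{}"] by simp
  then have "0 \<in> ?K" by simp
  then have "pos i w \<in> ?K" unfolding pos_def by (intro Max_in[OF fin]) blast
  then show "rk (set (take k w)) \<le> i" if "k \<le> pos i w"
    using rank_mono[OF set_take_subset_set_take[OF that, of w]] by simp
qed

text \<open>Simplicity makes the first two elements independent, which fixes the positions
  \<open>0\<close> and \<open>1\<close>; the other two rank jumps occur where the prefix rank first
  exceeds \<open>2\<close> and \<open>3\<close>. If the fourth basis element came last, the prefix
  before it would have a complement of one element, contrary to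
  \<open>card_compl_ge_2\<close>.\<close>

lemma
  assumes w: "w \<in> permutations_of_set E"
  shows pos_2_ge: "2 \<le> pos 2 w" and pos_2_less: "pos 2 w < pos 3 w" and pos_3_less: "Suc (pos 3 w) < card E"
    and greedy_basis_eq: "greedy_basis \<I> w = {w ! 0, w ! 1, w ! pos 2 w, w ! pos 3 w}"
proof -
  have len: "length w = card E" using w by (rule length_finite_permutations_of_set)
  have wE: "set w = E" "distinct w" using w by (auto simp: permutations_of_set_def)
  define r where "r k = rk (set (take k w))" for k
  have sub: "set (take k w) \<subseteq> E" for k using wE set_take_subset by metis
  have card_take: "card (set (take k w)) = k" if "k \<le> card E" for k
    using that wE len by (simp add: distinct_card)
  have r_iff: "r k \<le> i \<longleftrightarrow> k \<le> pos i w" if "k \<le> card E" for k i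
    unfolding r_def by (rule rank_prefix_le_iff[OF that])
  have r_le: "r k \<le> k" if "k \<le> card E" for k
    using rank_le_card[of "set (take k w)"] card_take[OF that] by (simp add: r_def)
  have r_step: "r (Suc k) \<le> Suc (r k)" if "k < card E" for k
    using that len rank_insert_le by (simp add: r_def take_Suc_conv_app_nth)
  have r_ge_2: "2 \<le> r k" if "2 \<le> k" "k \<le> card E" for k
    unfolding r_def using that card_take[OF that(2)] by (intro rank_ge_2[OF no_loops no_parallel sub]) simp
  have r_end: "r (card E) = 4" using len wE rank_E by (simp add: r_def)
  show p2: "2 \<le> pos 2 w"
    using r_iff[of 2 2] r_le[of 2] card_E by simp
  have p_lt: "pos i w < card E" if "i < 4" for i
    using r_iff[of "card E" i] r_end that by auto
  have jump: "Suc i \<le> r (Suc (pos i w))" "r (Suc (pos i w)) \<le> Suc i" "r (pos i w) \<le> i" if "i < 4" for i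
  proof -
    show "r (pos i w) \<le> i" using r_iff[OF less_imp_le[OF p_lt[OF that]]] by simp
    then show "r (Suc (pos i w)) \<le> Suc i" using r_step[OF p_lt[OF that]] by simp
    show "Suc i \<le> r (Suc (pos i w))" using r_iff[of "Suc (pos i w)" i] p_lt[OF that] by simp
  qed
  show pq: "pos 2 w < pos 3 w"
    using r_iff[of "Suc (pos 2 w)" 3] jump(2)[of 2] p_lt[of 2] by simp
  have "rk (set (take (pos 3 w) w)) \<le> 3" using jump(3)[of 3] by (simp add: r_def)
  then have "card (E - set (take (pos 3 w) w)) \<ge> 2"
    using rank_E by (intro card_compl_ge_2[OF no_coloops sub]) simp
  moreover have "card (E - set (take (pos 3 w) w)) = card E - pos 3 w"
    using sub card_take[of "pos 3 w"] p_lt[of 3] by (simp add: card_Diff_subset)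
  ultimately show "Suc (pos 3 w) < card E" by simp
  have "r k < r (Suc k) \<longleftrightarrow> k \<in> {0, 1, pos 2 w, pos 3 w}" if k: "k < card E" for k
  proof -
    have r1: "r 1 = 1"
    proof (rule antisym)
      show "r 1 \<le> 1" using r_le[of 1] card_E by simp
      have "card (set (take 1 w)) = 1" using card_take[of 1] card_E by simp
      then have "set (take 1 w) \<noteq> {}" by (metis card.empty zero_neq_one)
      then show "1 \<le> r 1" unfolding r_def by (rule rank_ge_1[OF no_loops sub])
    qed
    have r0: "r 0 = 0" using r_le[of 0] by simp
    have r2: "r 2 = 2" using r_le[of 2] r_ge_2[of 2] card_E by simp
    consider "k = 0" | "k = 1" | "2 \<le> k" "k < pos 2 w" | "k = pos 2 w" | "pos 2 w < k" "k < pos 3 w" | "k = pos 3 w" | "pos 3 w < k"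
      by linarith
    then show ?thesis
    proof cases
      case 3
      then have "r (Suc k) \<le> 2" using r_iff[of "Suc k" 2] k by simp
      then show ?thesis using r_ge_2[of k] 3 k pq by auto
    next
      case 5
      then have "r (Suc k) \<le> 3" "\<not> r k \<le> 2" using r_iff[of "Suc k" 3] r_iff[of k 2] k by simp_all
      then show ?thesis using 5 p2 by auto
    next
      case 7
      then have "\<not> r k \<le> 3" using r_iff[of k 3] k by simp
      moreover have "r (Suc k) \<le> 4" unfolding r_def using rank_mono[OF sub] rank_E by simp
      ultimately show ?thesis using 7 p2 pq by auto
    qed (use r0 r1 r2 jump[of 2] jump[of 3] p2 pq in \<open>auto simp: numeral_2_eq_2\<close>)
  qed
  then have "{k. k < length w \<and> r k < r (Suc k)} = {0, 1, pos 2 w, pos 3 w}"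
    using len p_lt[of 2] p_lt[of 3] card_E by auto
  moreover have "greedy_basis \<I> w = (!) w ` {k. k < length w \<and> r k < r (Suc k)}"
    unfolding greedy_basis_def r_def by auto
  ultimately show "greedy_basis \<I> w = {w ! 0, w ! 1, w ! pos 2 w, w ! pos 3 w}" by simp
qed

lemma greedy_positions_inj:
  assumes w: "w \<in> permutations_of_set E"
  shows "inj_on ((!) w) {0, 1, pos 2 w, pos 3 w, card E - 1}"
proof (rule inj_on_nth)
  show "distinct w" using w by (simp add: permutations_of_set_def)
  show "\<forall>i\<in>{0, 1, pos 2 w, pos 3 w, card E - 1}. i < length w"
    using length_finite_permutations_of_set[OF w] pos_2_ge[OF w] pos_2_less[OF w] pos_3_less[OF w] by auto
qed

lemma last_notin_greedy_basis:
  assumes w: "w \<in> permutations_of_set E"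
  shows "last w \<notin> greedy_basis \<I> w"
proof -
  have "w \<noteq> []" using length_finite_permutations_of_set[OF w] card_E by auto
  then have "last w = w ! (card E - 1)" by (simp add: last_conv_nth length_finite_permutations_of_set[OF w])
  moreover have "card E - 1 \<notin> {0, 1, pos 2 w, pos 3 w}"
    using pos_2_ge[OF w] pos_2_less[OF w] pos_3_less[OF w] card_E by auto
  moreover have "(!) w ` {0, 1, pos 2 w, pos 3 w} = {w ! 0, w ! 1, w ! pos 2 w, w ! pos 3 w}" by simp
  ultimately show ?thesis
    unfolding greedy_basis_eq[OF w] using greedy_positions_inj[OF w] by (auto simp: inj_on_def)
qed

lemma prod_greedy_basis:
  assumes w: "w \<in> permutations_of_set E"
  shows "(\<Prod>c\<in>greedy_basis \<I> w. f c) = f (w ! 0) * f (w ! 1) * (f (w ! pos 2 w) * f (w ! pos 3 w))"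
    and "card (greedy_basis \<I> w) = 4"
proof -
  have eq: "greedy_basis \<I> w = (!) w ` {0, 1, pos 2 w, pos 3 w}" unfolding greedy_basis_eq[OF w] by simp
  have inj: "inj_on ((!) w) {0, 1, pos 2 w, pos 3 w}"
    by (rule inj_on_subset[OF greedy_positions_inj[OF w]]) auto
  have d: "0 \<noteq> pos 2 w" "1 \<noteq> pos 2 w" "0 \<noteq> pos 3 w" "1 \<noteq> pos 3 w" "pos 2 w \<noteq> pos 3 w"
    using pos_2_ge[OF w] pos_2_less[OF w] by auto
  show "card (greedy_basis \<I> w) = 4" unfolding eq card_image[OF inj] using d by simp
  show "(\<Prod>c\<in>greedy_basis \<I> w. f c) = f (w ! 0) * f (w ! 1) * (f (w ! pos 2 w) * f (w ! pos 3 w))"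
    unfolding eq prod.reindex[OF inj] using d by (simp add: mult_ac)
qed

lemma greedy_basis_subset: "w \<in> permutations_of_set E \<Longrightarrow> greedy_basis \<I> w \<subseteq> E"
  by (auto simp: greedy_basis_def permutations_of_set_def)

text \<open>The bracket of \<open>sum_greedy_positions\<close> with the rank conditions inserted. It
  is polymorphic because it arises in a field of rational functions, whereas the collection by flats
  takes place in the integers.\<close>

definition cut_value :: "'k::comm_ring_1" where
  "cut_value = (- 1) ^ (card E - 1) * of_nat ((card E - 5) choose 3)
    - (\<Sum>S | S \<subseteq> E \<and> 4 \<le> card S \<and> rk S \<le> 3. (- 1) ^ (card (E - S) - 1) * of_nat ((card S - 4) choose 2))
    + (\<Sum>A | A \<subseteq> E \<and> 3 \<le> card A \<and> rk A \<le> 2.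
        (- 1) ^ (card (E - A) - 1) * (of_nat (card (E - A) - 1) * (- 1) ^ (card A - 1) + 2) * of_nat (card A - 3))
    - (\<Sum>S | S \<subseteq> E \<and> 4 \<le> card S \<and> rk S \<le> 3.
        \<Sum>A | A \<in> {A. A \<subseteq> E \<and> 3 \<le> card A \<and> rk A \<le> 2} \<and> A \<subseteq> S \<and> card A + 2 \<le> card S.
          (- 1) ^ (card (E - S) - 1) * (- 1) ^ (card A - 1) * of_nat (card A - 3))"

lemma of_int_cut_value: "of_int cut_value = cut_value"
  by (simp add: cut_value_def)

text \<open>\<open>W E\<close> times the weights \<open>\<phi>\<close> on the basis is
  \<open>W\<close> of its complement, and \<open>\<psi> (last w)\<close> removes the factor
  \<open>1 + t * z c\<close> of the last element, which lies in that complement.\<close>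

lemma sum_greedy_basis:
  fixes z :: "'a \<Rightarrow> 'k::field"
  assumes "chain_weights z t"
  shows "(\<Sum>w\<in>permutations_of_set E. (\<Prod>c\<in>E - greedy_basis \<I> w. z c) *
      (\<Prod>c\<in>E - greedy_basis \<I> w - {last w}. 1 + t * z c) / chain (map z w)) = t ^ 3 * cut_value"
proof -
  interpret chain_weights z t by fact
  have "(\<Sum>w\<in>permutations_of_set E. (\<Prod>c\<in>E - greedy_basis \<I> w. z c) *
      (\<Prod>c\<in>E - greedy_basis \<I> w - {last w}. 1 + t * z c) / den w)
    = (\<Sum>w\<in>permutations_of_set E. W E * (\<phi> (w ! 0) * \<phi> (w ! 1) * (\<phi> (w ! pos 2 w) * \<phi> (w ! pos 3 w)) * \<psi> (last w) / den w))"
  proof (rule sum.cong[OF refl])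
    fix w assume w: "w \<in> permutations_of_set E"
    let ?B = "greedy_basis \<I> w"
    have B: "?B \<subseteq> E" "finite ?B" using greedy_basis_subset[OF w] finite_subset_E by auto
    have "w \<noteq> []" using w card_E by (auto simp: permutations_of_set_def)
    then have last: "last w \<in> E - ?B" 
      using last_notin_greedy_basis[OF w] permutations_of_setD(1)[OF w] by auto
    have "W E * (\<Prod>c\<in>?B. \<phi> c) = W (E - ?B)"
      using W_Un[OF finite_ground B(1)] W_prod_phi[OF B(2)] by (simp add: mult_ac)
    also have "\<dots> = (\<Prod>c\<in>E - ?B. z c) * ((1 + t * z (last w)) * (\<Prod>c\<in>E - ?B - {last w}. 1 + t * z c))"
      unfolding W_def prod.distrib using finite_ground last by (simp add: prod.remove)
    finally have "W E * (\<Prod>c\<in>?B. \<phi> c) * \<psi> (last w) = (\<Prod>c\<in>E - ?B. z c) * (\<Prod>c\<in>E - ?B - {last w}. 1 + t * z c)"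
      by (simp add: \<psi>_def one_plus_nonzero)
    then show "(\<Prod>c\<in>E - ?B. z c) * (\<Prod>c\<in>E - ?B - {last w}. 1 + t * z c) / den w
      = W E * (\<phi> (w ! 0) * \<phi> (w ! 1) * (\<phi> (w ! pos 2 w) * \<phi> (w ! pos 3 w)) * \<psi> (last w) / den w)"
      unfolding prod_greedy_basis(1)[OF w] by (simp add: mult.assoc)
  qed
  also have "\<dots> = t ^ 3 * cut_value"
    unfolding sum_distrib_left[symmetric] cut_value_def
  proof (rule sum_greedy_positions[OF finite_ground card_E])
    show "2 \<le> pos 2 w \<and> pos 2 w < pos 3 w \<and> pos 3 w < card E" if "w \<in> permutations_of_set E" for w
      using pos_2_ge[OF that] pos_2_less[OF that] pos_3_less[OF that] by simp
    show "3 \<le> card (E - A)" if "A \<subseteq> E" "rk A \<le> 2" for A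
      using that rank_E by (intro card_compl_ge_3[OF no_coloops]) auto
    show "2 \<le> card (E - S)" if "S \<subseteq> E" "rk S \<le> 3" for S
      using that rank_E by (intro card_compl_ge_2[OF no_coloops]) auto
  qed (rule rank_prefix_le_iff, assumption)+
  finally show ?thesis .
qed

text \<open>Both sides of \<open>sum_greedy_basis\<close> are polynomial in \<open>t\<close> and
  agree at all positive integers, of which there are infinitely many in characteristic
  \<open>0\<close>. The coefficients of degree \<open>3\<close> therefore agree.\<close>

lemma sum_greedy_basis_esym:
  fixes z :: "'a \<Rightarrow> 'k::field_char_0"
  assumes "\<And>m. 0 < m \<Longrightarrow> chain_weights z (of_nat m)"
  shows "(\<Sum>w\<in>permutations_of_set E. (\<Prod>c\<in>E - greedy_basis \<I> w. z c) *
      esym 3 (E - greedy_basis \<I> w - {last w}) z / chain (map z w)) = cut_value"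
proof -
  define C where "C i = (\<Sum>w\<in>permutations_of_set E. (\<Prod>c\<in>E - greedy_basis \<I> w. z c) *
      esym i (E - greedy_basis \<I> w - {last w}) z / chain (map z w))" for i
  define p where "p = (\<Sum>i\<le>card E. monom (C i) i) - monom cut_value 3"
  have "poly p (of_nat m) = 0" if "0 < m" for m
  proof -
    have "(\<Sum>i\<le>card E. C i * of_nat m ^ i) = (\<Sum>w\<in>permutations_of_set E. (\<Prod>c\<in>E - greedy_basis \<I> w. z c) *
      (\<Prod>c\<in>E - greedy_basis \<I> w - {last w}. 1 + of_nat m * z c) / chain (map z w))"
      unfolding C_def sum_distrib_right
    proof (subst sum.swap, rule sum.cong[OF refl])
      fix w
      let ?X = "E - greedy_basis \<I> w - {last w}"
      have "(\<Prod>c\<in>?X. 1 + of_nat m * z c) = (\<Sum>i\<le>card ?X. of_nat m ^ i * esym i ?X z)"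
        by (rule prod_one_plus_esym) (use finite_ground in simp)
      also have "\<dots> = (\<Sum>i\<le>card E. of_nat m ^ i * esym i ?X z)"
        using finite_ground by (intro sum.mono_neutral_left) (auto intro: card_mono order_trans simp: esym_eq_0)
      finally show "(\<Sum>i\<le>card E. (\<Prod>c\<in>E - greedy_basis \<I> w. z c) * esym i ?X z / chain (map z w) * of_nat m ^ i)
        = (\<Prod>c\<in>E - greedy_basis \<I> w. z c) * (\<Prod>c\<in>?X. 1 + of_nat m * z c) / chain (map z w)"
        by (simp add: sum_distrib_left sum_divide_distrib mult_ac)
    qed
    then show ?thesis
      unfolding sum_greedy_basis[OF assms[OF that]] p_def by (simp add: poly_sum poly_monom mult_ac)
  qed
  then have "of_nat ` {0<..} \<subseteq> {x. poly p x = 0}" by auto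
  moreover have "infinite (of_nat ` {0<..} :: 'k set)"
    by (subst finite_image_iff) (auto simp: inj_on_def infinite_Ioi)
  ultimately have "p = 0" using poly_roots_finite[of p] infinite_super by blast
  then have "Polynomial.coeff p 3 = 0" by simp
  moreover have "Polynomial.coeff p 3 = C 3 - cut_value"
    using card_E by (simp add: p_def coeff_sum sum.delta)
  ultimately show ?thesis by (simp add: C_def)
qed

end

section \<open>Back to the rational functions of the definition\<close>

text \<open>The last condition holds because the numerator of \<open>1 + of_nat m * zvar c\<close>
  has constant coefficient \<open>1\<close>, read off as the value at the monomial
  \<open>0\<close>.\<close>

lemma chain_weights_zvar:
  assumes "0 < m"
  shows "chain_weights (zvar :: 'a \<Rightarrow> 'a ratfun) (of_nat m)"
proof
  let ?X = "\<lambda>e::'a. Poly_Mapping.single (Poly_Mapping.single (Var e) (1::nat)) (1::int)"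
  have X: "?X e = ?X f \<Longrightarrow> e = f" for e f
    by (metis Var_inject UNIV_I lookup_single_eq lookup_single_not_eq zero_neq_one)
  show "inj (zvar :: 'a \<Rightarrow> 'a ratfun)"
  proof (rule injI)
    fix e f :: 'a assume "zvar e = zvar f"
    then have "?X e = ?X f" by (simp add: zvar_def eq_fract)
    then show "e = f" by (rule X)
  qed
  show "zvar c \<noteq> 0" for c :: 'a
    by (simp add: zvar_def Zero_fract_def eq_fract)
  show "(of_nat m :: 'a ratfun) \<noteq> 0" using assms by simp
  show "1 + of_nat m * zvar c \<noteq> 0" for c :: 'a
  proof -
    have "1 + of_nat m * ?X c \<noteq> 0"
    proof
      assume zero: "1 + of_nat m * ?X c = 0"
      have eq: "of_nat m * ?X c = Poly_Mapping.single (Poly_Mapping.single (Var c) (1::nat)) (int m)"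
        by (simp add: mult_single flip: single_of_nat)
      have "Poly_Mapping.lookup (1 + Poly_Mapping.single (Poly_Mapping.single (Var c) (1::nat)) (int m)) 0 = 0"
        unfolding eq[symmetric] zero by (rule lookup_zero)
      moreover have "Poly_Mapping.single (Var c) (1::nat) \<noteq> 0"
        by (metis lookup_single_eq lookup_zero zero_neq_one)
      ultimately show False by (simp add: lookup_add lookup_single)
    qed
    then show ?thesis
      by (simp add: zvar_def of_nat_fract One_fract_def Zero_fract_def eq_fract)
  qed
qed

lemma esym_0 [simp]: "esym 0 A u = 1" if "finite A"
proof -
  have "{S. S \<subseteq> A \<and> card S = 0} = {{}}" using that by (auto simp: card_eq_0_iff dest: finite_subset)
  then show ?thesis by (simp add: esym_def)
qed

lemma esym_Suc_insert:
  assumes "finite A" "l \<notin> A"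
  shows "esym (Suc k) (insert l A) u = esym (Suc k) A u + u l * esym k A u"
proof -
  let ?X = "\<lambda>k. {S. S \<subseteq> A \<and> card S = k}"
  have fin: "finite S" if "S \<subseteq> A" for S using that assms(1) finite_subset by auto
  have inj: "inj_on (insert l) (?X k)"
  proof (rule inj_onI)
    fix S T assume ST: "S \<in> ?X k" "T \<in> ?X k" "insert l S = insert l T"
    then have "l \<notin> S" "l \<notin> T" using assms by auto
    then show "S = T" using ST by (simp add: insert_ident)
  qed
  have "{S. S \<subseteq> insert l A \<and> card S = Suc k} = ?X (Suc k) \<union> insert l ` ?X k"
  proof (intro set_eqI iffI)
    fix S assume S: "S \<in> {S. S \<subseteq> insert l A \<and> card S = Suc k}"
    show "S \<in> ?X (Suc k) \<union> insert l ` ?X k"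
    proof (cases "l \<in> S")
      case True
      then have "S = insert l (S - {l})" "S - {l} \<in> ?X k" using S by auto
      then show ?thesis by blast
    qed (use S in auto)
  next
    fix S assume "S \<in> ?X (Suc k) \<union> insert l ` ?X k"
    then show "S \<in> {S. S \<subseteq> insert l A \<and> card S = Suc k}"
    proof
      assume "S \<in> insert l ` ?X k"
      then obtain T where T: "S = insert l T" "T \<subseteq> A" "card T = k" by auto
      then have "l \<notin> T" using assms(2) by auto
      then show ?thesis using T fin[OF T(2)] by auto
    qed auto
  qed
  then have "esym (Suc k) (insert l A) u = (\<Sum>S\<in>?X (Suc k) \<union> insert l ` ?X k. \<Prod>s\<in>S. u s)"
    by (simp add: esym_def)
  also have "\<dots> = esym (Suc k) A u + (\<Sum>S\<in>insert l ` ?X k. \<Prod>s\<in>S. u s)"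
    unfolding esym_def using assms by (subst sum.union_disjoint) auto
  also have "(\<Sum>S\<in>insert l ` ?X k. \<Prod>s\<in>S. u s) = (\<Sum>S\<in>?X k. u l * (\<Prod>s\<in>S. u s))"
    unfolding sum.reindex[OF inj] comp_def
  proof (rule sum.cong[OF refl])
    fix S assume "S \<in> ?X k"
    then have "l \<notin> S" "finite S" using assms(2) fin by auto
    then show "(\<Prod>s\<in>insert l S. u s) = u l * (\<Prod>s\<in>S. u s)" by simp
  qed
  finally show ?thesis by (simp add: esym_def sum_distrib_left)
qed

text \<open>In generating functions this divides the product of \<open>1 + t * u c\<close> over
  \<open>C\<close> by the factor of \<open>l\<close>. With the recursion of \<open>esym\<close> for
  removing \<open>l\<close> the sum telescopes.\<close>

lemma alternating_esym_3:
  assumes "finite C" "l \<in> C"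
  shows "(\<Sum>j = 0..3. (- u l) ^ j * esym (3 - j) C u) = esym 3 (C - {l}) u"
proof -
  have C: "C = insert l (C - {l})" "finite (C - {l})" "l \<notin> C - {l}" using assms by auto
  have 1: "esym (Suc k) C u = esym (Suc k) (C - {l}) u + u l * esym k (C - {l}) u" for k
    by (subst C(1)) (rule esym_Suc_insert[OF C(2,3)])
  have "(\<Sum>j = 0..3. (- u l) ^ j * esym (3 - j) C u) 
    = esym 3 C u - u l * esym 2 C u + u l * u l * esym 1 C u - u l * u l * u l * esym 0 C u"
    by (simp add: numeral_3_eq_3 numeral_2_eq_2 algebra_simps)
  also have "\<dots> = esym 3 (C - {l}) u"
    using assms(1) by (simp add: numeral_3_eq_3 numeral_2_eq_2 1 algebra_simps)
  finally show ?thesis .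
qed

context simple_rank4_matroid
begin

text \<open>The signs are \<open>- 1\<close> from the single component, \<open>(- 1) ^ 4\<close>
  from \<open>i = 4\<close>, and \<open>(- 1) ^ (card E - 4)\<close> from the top elementary
  symmetric function of the \<open>- zvar c\<close>. The factor \<open>esym (r - i) B x\<close> is
  \<open>1\<close> at \<open>i = r\<close>.\<close>

lemma omega_eq_cut_value:
  assumes "mat_connected E \<I>"
  shows "omega E \<I> = (- 1) ^ (card E - 1) * cut_value"
proof -
  let ?P = "permutations_of_set E" and ?n = "card E"
  define a where "a i = (\<Sum>j = 0..i - 1. eq_deg E (g_summand E \<I> i j))" for i
  have "E \<noteq> {}" using card_E by auto
  then have g: "g_poly E \<I> = - (\<Sum>i = 1..4. smult (a i) ((- monom 1 1) ^ i))"
    using no_loops no_coloops assms by (auto simp: g_poly_def rank_E mat_connected_def a_def)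
  have m: "(- monom 1 1 :: 'a ratfun poly) ^ i = monom ((- 1) ^ i) i" for i
    by (induction i) (simp_all add: monom_0 one_pCons mult_monom flip: minus_monom)
  have "omega E \<I> = - (\<Sum>i = 1..4. if i = 4 then a i * (- 1) ^ i else 0)"
    unfolding omega_def g rank_E m coeff_minus coeff_sum coeff_smult
    by (intro arg_cong[where f = uminus] sum.cong refl) simp
  also have "\<dots> = - a 4" by (simp add: sum.delta)
  also have "a 4 = (\<Sum>j = 0..3. eq_deg E (g_summand E \<I> 4 j))" by (simp add: a_def)
  also have "\<dots> = (\<Sum>w\<in>?P. (\<Sum>j = 0..3. g_summand E \<I> 4 j w) / chain (map zvar w))"
    unfolding eq_deg_def
  proof (subst sum.swap, rule sum.cong[OF refl])
    fix w assume "w \<in> ?P"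
    then have "length w = ?n" by (rule length_finite_permutations_of_set)
    then have "chain (map zvar w) = (\<Prod>k<?n - 1. zvar (w ! k) - zvar (w ! Suc k))"
      by (simp add: chain_conv_prod)
    then show "(\<Sum>j = 0..3. g_summand E \<I> 4 j w / (\<Prod>k<?n - 1. zvar (w ! k) - zvar (w ! Suc k)))
      = (\<Sum>j = 0..3. g_summand E \<I> 4 j w) / chain (map zvar w)"
      by (simp only: sum_divide_distrib)
  qed
  also have "\<dots> = (\<Sum>w\<in>?P. (- 1) ^ (?n - 4) * ((\<Prod>c\<in>E - greedy_basis \<I> w. zvar c) *
      esym 3 (E - greedy_basis \<I> w - {last w}) zvar / chain (map zvar w)))"
  proof (rule sum.cong[OF refl])
    fix w assume w: "w \<in> ?P"
    let ?C = "E - greedy_basis \<I> w"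
    have "w \<noteq> []" using w \<open>E \<noteq> {}\<close> by (auto simp: permutations_of_set_def)
    then have last: "last w \<in> ?C" 
      using last_notin_greedy_basis[OF w] permutations_of_setD(1)[OF w] by auto
    have fin: "finite ?C" "finite (greedy_basis \<I> w)"
      using finite_ground greedy_basis_subset[OF w] finite_subset by auto
    have "card ?C = ?n - 4"
      using greedy_basis_subset[OF w] prod_greedy_basis(2)[OF w] fin by (simp add: card_Diff_subset)
    then have top: "esym (?n - 4) ?C (\<lambda>c. - zvar c) = (- 1) ^ (?n - 4) * (\<Prod>c\<in>?C. zvar c)"
      using esym_card[OF fin(1), of "\<lambda>c. - zvar c"] prod_uminus[of zvar ?C] by simp
    have "(\<Sum>j = 0..3. g_summand E \<I> 4 j w) = (\<Sum>j = 0..3. (- zvar (last w)) ^ j * esym (3 - j) ?C zvar) * esym (?n - 4) ?C (\<lambda>c. - zvar c)"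
      unfolding sum_distrib_right
      by (rule sum.cong[OF refl]) (use fin in \<open>simp add: g_summand_def Let_def rank_E\<close>)
    then show "(\<Sum>j = 0..3. g_summand E \<I> 4 j w) / chain (map zvar w)
      = (- 1) ^ (?n - 4) * ((\<Prod>c\<in>?C. zvar c) * esym 3 (?C - {last w}) zvar / chain (map zvar w))"
      unfolding alternating_esym_3[OF fin(1) last] top by (simp add: mult_ac)
  qed
  also have "\<dots> = (- 1) ^ (?n - 4) * cut_value"
    unfolding sum_distrib_left[symmetric] by (subst sum_greedy_basis_esym[OF chain_weights_zvar]) simp_all
  also have "- ((- 1) ^ (?n - 4) * cut_value) = (- 1) ^ (?n - 1) * (cut_value :: 'a ratfun)"
  proof -
    obtain k where "?n = k + 5" using card_E by (metis add.commute le_Suc_ex)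
    then show ?thesis by (simp add: power_add)
  qed
  finally show ?thesis .
qed

text \<open>The exponents \<open>card E - 1\<close> and \<open>card (E - S) - 1\<close> together
  have the parity of \<open>card S\<close>. In the line term this sign meets the inner
  \<open>(- 1) ^ (card A - 1)\<close>, so that \<open>card (E - A) - 1\<close> ends up with the
  constant sign \<open>- 1\<close>.\<close>

lemma cut_value_eq_cut_sum: "(- 1) ^ (card E - 1) * cut_value = cut_sum"
proof -
  have sgn: "(- 1 :: int) ^ (card E - 1) * (- 1) ^ (card (E - S) - 1) = (- 1) ^ card S" 
    if "S \<subseteq> E" "rk S \<le> 3" for S
  proof -
    have "card (E - S) \<ge> 2" using that rank_E by (intro card_compl_ge_2[OF no_coloops]) auto
    moreover have "card E = card S + card (E - S)"
      using that finite_ground finite_subset_E by (simp add: card_Diff_subset card_mono)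
    ultimately have "card E - 1 = card S + (card (E - S) - 1)" by simp
    then show ?thesis by (simp add: power_add mult.assoc flip: power_mult_distrib)
  qed
  have sgn': "(- 1 :: int) ^ (card A - 1) = - ((- 1) ^ card A)" if "3 \<le> card A" for A :: "'a set"
  proof -
    obtain k where "card A = k + 3" using \<open>3 \<le> card A\<close> by (metis add.commute le_Suc_ex)
    then show ?thesis by (simp add: numeral_3_eq_3)
  qed
  let ?s = "(- 1 :: int) ^ (card E - 1)"
  have 1: "?s * (\<Sum>S | S \<subseteq> E \<and> 4 \<le> card S \<and> rk S \<le> 3. (- 1) ^ (card (E - S) - 1) * of_nat ((card S - 4) choose 2))
    = (\<Sum>S | S \<subseteq> E \<and> 4 \<le> card S \<and> rk S \<le> 3. (- 1) ^ card S * int ((card S - 4) choose 2))"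
    unfolding sum_distrib_left
  proof (rule sum.cong[OF refl])
    fix S assume "S \<in> {S. S \<subseteq> E \<and> 4 \<le> card S \<and> rk S \<le> 3}"
    then have "?s * (- 1) ^ (card (E - S) - 1) = (- 1) ^ card S" by (intro sgn) auto
    then show "?s * ((- 1) ^ (card (E - S) - 1) * of_nat ((card S - 4) choose 2)) = (- 1) ^ card S * int ((card S - 4) choose 2)"
      by (simp only: mult.assoc[symmetric])
  qed
  have 2: "?s * (\<Sum>A | A \<subseteq> E \<and> 3 \<le> card A \<and> rk A \<le> 2.
        (- 1) ^ (card (E - A) - 1) * (of_nat (card (E - A) - 1) * (- 1) ^ (card A - 1) + 2) * of_nat (card A - 3))
    = (\<Sum>A | A \<subseteq> E \<and> 3 \<le> card A \<and> rk A \<le> 2. (2 * (- 1) ^ card A - int (card (E - A) - 1)) * int (card A - 3))"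
    unfolding sum_distrib_left
  proof (rule sum.cong[OF refl])
    fix A assume A: "A \<in> {A. A \<subseteq> E \<and> 3 \<le> card A \<and> rk A \<le> 2}"
    then have "?s * (- 1) ^ (card (E - A) - 1) = (- 1) ^ card A" by (intro sgn) auto
    moreover have "(- 1 :: int) ^ card A * (- 1) ^ card A = 1" by (simp flip: power_mult_distrib)
    ultimately have "?s * (- 1) ^ (card (E - A) - 1) * (x * - ((- 1) ^ card A) + 2) = 2 * (- 1) ^ card A - x" for x
      by (simp add: algebra_simps)
    then show "?s * ((- 1) ^ (card (E - A) - 1) * (of_nat (card (E - A) - 1) * (- 1) ^ (card A - 1) + 2) * of_nat (card A - 3))
      = (2 * (- 1) ^ card A - int (card (E - A) - 1)) * int (card A - 3)"
      using A sgn'[of A] by (simp only: mult.assoc[symmetric] mem_Collect_eq)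
  qed
  have 3: "?s * (\<Sum>S | S \<subseteq> E \<and> 4 \<le> card S \<and> rk S \<le> 3.
        \<Sum>A | A \<in> {A. A \<subseteq> E \<and> 3 \<le> card A \<and> rk A \<le> 2} \<and> A \<subseteq> S \<and> card A + 2 \<le> card S.
          (- 1) ^ (card (E - S) - 1) * (- 1) ^ (card A - 1) * of_nat (card A - 3))
    = - (\<Sum>S | S \<subseteq> E \<and> 4 \<le> card S \<and> rk S \<le> 3.
        \<Sum>A | A \<in> {A. A \<subseteq> E \<and> 3 \<le> card A \<and> rk A \<le> 2} \<and> A \<subseteq> S \<and> card A + 2 \<le> card S.
          (- 1) ^ card S * (- 1) ^ card A * int (card A - 3))"
    unfolding sum_distrib_left sum_negf[symmetric]
  proof (intro sum.cong[OF refl])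
    fix S A assume S: "S \<in> {S. S \<subseteq> E \<and> 4 \<le> card S \<and> rk S \<le> 3}"
      and A: "A \<in> {A. A \<in> {A. A \<subseteq> E \<and> 3 \<le> card A \<and> rk A \<le> 2} \<and> A \<subseteq> S \<and> card A + 2 \<le> card S}"
    then show "?s * ((- 1) ^ (card (E - S) - 1) * (- 1) ^ (card A - 1) * of_nat (card A - 3))
      = - ((- 1) ^ card S * (- 1) ^ card A * int (card A - 3))"
      using sgn[of S] sgn'[of A] by (simp only: mult.assoc[symmetric] mem_Collect_eq mult_minus_left mult_minus_right)
  qed
  have "?s * (?s * x) = x" for x by (simp flip: power_mult_distrib mult.assoc)
  moreover have "?s * (a - b + c - d) = ?s * a - ?s * b + ?s * c - ?s * d" for a b c d
    by (simp add: algebra_simps)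
  ultimately show ?thesis
    unfolding cut_value_def cut_sum_def by (simp only: 1 2 3 diff_minus_eq_add of_nat_id)
qed

end

section \<open>Rational coefficients of the final formula\<close>

lemma of_nat_choose_2: "(of_nat (k choose 2) :: 'a::field_char_0) = of_nat k * (of_nat k - 1) / 2"
  by (induction k) (simp_all add: numeral_2_eq_2 field_simps)

lemma of_nat_choose_3: "(of_nat (k choose 3) :: 'a::field_char_0) = of_nat k * (of_nat k - 1) * (of_nat k - 2) / 6"
proof (induction k)
  case (Suc k)
  have "of_nat (Suc k choose 3) = (of_nat (k choose 2) :: 'a) + of_nat (k choose 3)"
    by (simp add: numeral_3_eq_3 numeral_2_eq_2)
  also have "\<dots> = (3 * (of_nat k * (of_nat k - 1)) + of_nat k * (of_nat k - 1) * (of_nat k - 2)) / 6"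
    unfolding of_nat_choose_2 Suc.IH add_divide_distrib by simp
  also have "\<dots> = of_nat (Suc k) * (of_nat (Suc k) - 1) * (of_nat (Suc k) - 2) / 6"
    by (rule arg_cong[where f = "\<lambda>x. x / 6"]) (simp add: algebra_simps)
  finally show ?case .
qed simp

theorem proposition11p3:
  fixes E :: "'a set" and \<I> :: "'a set set"
  assumes "matroid E \<I>"
    and "mat_connected E \<I>"
    and "mat_rank \<I> E = 4"
    and "\<nexists>e. mat_loop E \<I> e"
    and "\<nexists>e f. mat_parallel E \<I> e f"
  shows "omega E \<I> = of_rat (
      ((of_nat (card E) - 5) gchoose 3)
      - (\<Sum>P\<in>flats_of_rank E \<I> 3. (of_nat (card P) - 3) gchoose 3)
      - (\<Sum>L\<in>flats_of_rank E \<I> 2. ((of_nat (card L) - 2) gchoose 2)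
           * (of_nat (card E) - 2 / 3 * of_nat (card L) - 13 / 3))
      + (\<Sum>(L, P) | L \<in> flats_of_rank E \<I> 2 \<and> P \<in> flats_of_rank E \<I> 3 \<and> L \<subseteq> P.
           ((of_nat (card L) - 2) gchoose 2)
           * (of_nat (card P) - 2 / 3 * of_nat (card L) - 7 / 3)))"
proof -
  interpret matroid E \<I> by fact
  have "\<nexists>e. mat_coloop E \<I> e"
    using no_coloop_if_connected[OF assms(2)] assms(3) by simp
  then interpret simple_rank4_matroid E \<I>
    using assms by unfold_locales auto
  let ?g = "\<lambda>L. (of_nat (card L) - 2) gchoose 2 :: rat"
  have pairs: "(\<Sum>(L, P) | L \<in> Ls \<and> P \<in> Ps \<and> L \<subseteq> P. ?g L * (of_nat (card P) - 2 / 3 * of_nat (card L) - 7 / 3))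
    = (\<Sum>L\<in>Ls. \<Sum>P | P \<in> Ps \<and> L \<subseteq> P. ?g L * (of_nat (card P) - 2 / 3 * of_nat (card L) - 7 / 3))"
  proof -
    have "{(L, P). L \<in> Ls \<and> P \<in> Ps \<and> L \<subseteq> P} = (SIGMA L:Ls. {P. P \<in> Ps \<and> L \<subseteq> P})" by auto
    then show ?thesis using finite_flats by (simp add: sum.Sigma)
  qed
  \<comment> \<open>The constants of the formula originate here. With \<open>l = card L\<close>,
    \<open>(l - 3 choose 3) - (l - 3)\<close> equals \<open>(l - 2 choose 2) * (l - 7) / 3\<close>
    for \<open>l \<ge> 3\<close>, so the right-hand side is \<open>(l - 2 choose 2)\<close> times
    \<open>(N L - 1) * (l - 7) / 3 + 2\<close>. Summing \<open>card P\<close> over the planes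
    through \<open>L\<close> produces the same factor on the left, with
    \<open>2 = 13 / 3 - 7 / 3\<close>.\<close>
  have line: "(\<Sum>P | P \<in> Ps \<and> L \<subseteq> P. ?g L * (of_nat (card P) - 2 / 3 * of_nat (card L) - 7 / 3))
      - ?g L * (of_nat (card E) - 2 / 3 * of_nat (card L) - 13 / 3)
    = of_int ((N L - 1) * (int ((card L - 3) choose 3) - int (card L - 3)) + 2 * int ((card L - 2) choose 2))"
    if L: "L \<in> Ls" for L
  proof -
    have "(\<Sum>P | P \<in> Ps \<and> L \<subseteq> P. of_nat (card P) :: rat) = of_int (\<Sum>P | P \<in> Ps \<and> L \<subseteq> P. int (card P))"
      by simp
    also have "\<dots> = of_nat (card E) - of_nat (card L) + of_int (N L) * of_nat (card L)"
      unfolding sum_card_planes_through[OF L] by simp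
    finally have "(\<Sum>P | P \<in> Ps \<and> L \<subseteq> P. of_nat (card P) - 2 / 3 * of_nat (card L) - 7 / 3 :: rat)
      = of_nat (card E) - of_nat (card L) + of_int (N L) * of_nat (card L) - of_int (N L) * (2 / 3 * of_nat (card L) + 7 / 3)"
      by (simp add: sum_subtractf N_def algebra_simps)
    then have "(\<Sum>P | P \<in> Ps \<and> L \<subseteq> P. ?g L * (of_nat (card P) - 2 / 3 * of_nat (card L) - 7 / 3))
      = ?g L * (of_nat (card E) - of_nat (card L) + of_int (N L) * of_nat (card L) - of_int (N L) * (2 / 3 * of_nat (card L) + 7 / 3))"
      by (simp only: sum_distrib_left[symmetric])
    moreover have "?g L * (of_nat (card E) - of_nat (card L) + of_int (N L) * of_nat (card L) - of_int (N L) * (2 / 3 * of_nat (card L) + 7 / 3))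
      - ?g L * (of_nat (card E) - 2 / 3 * of_nat (card L) - 13 / 3)
      = of_int ((N L - 1) * (int ((card L - 3) choose 3) - int (card L - 3)) + 2 * int ((card L - 2) choose 2))"
    proof -
      have "2 \<le> card L" using flats_card[OF L] .
      then have g: "?g L = of_nat ((card L - 2) choose 2)"
        by (simp add: binomial_gbinomial of_nat_diff)
      show ?thesis
      \<comment> \<open>For two-element lines \<open>card L - 3\<close> is truncated; there all
        binomial coefficients vanish and both sides are \<open>0\<close>.\<close>
      proof (cases "card L = 2")
        case False
        then obtain i where i: "card L = i + 3"
          using \<open>2 \<le> card L\<close> by (metis add.commute le_Suc_ex le_neq_implies_less numeral_3_eq_3 numeral_2_eq_2 Suc_leI)
        have c: "card L - 2 = Suc i" "card L - 3 = i" using i by auto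
        have "of_int ((N L - 1) * (int (i choose 3) - int i) + 2 * int (Suc i choose 2))
          = (of_int (N L) - 1) * (of_nat (i choose 3) - of_nat i) + 2 * (of_nat (Suc i choose 2) :: rat)"
          by (simp only: of_int_add of_int_mult of_int_diff of_int_1 of_int_of_nat_eq of_int_numeral)
        then show ?thesis
          unfolding g c unfolding i of_nat_choose_2 of_nat_choose_3 by (simp add: field_simps)
      qed (simp add: g numeral_2_eq_2 numeral_3_eq_3)
    qed
    ultimately show ?thesis by simp
  qed
  have plane: "(of_nat (card P) - 3) gchoose 3 = (of_int (int ((card P - 3) choose 3)) :: rat)" if "P \<in> Ps" for P
    using flats_card[OF that] by (simp add: binomial_gbinomial of_nat_diff)
  have ground: "(of_nat (card E) - 5) gchoose 3 = (of_int (int ((card E - 5) choose 3)) :: rat)"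
    using card_E by (simp add: binomial_gbinomial of_nat_diff)
  have "omega E \<I> = of_int cut_sum"
    unfolding omega_eq_cut_value[OF assms(2)] cut_value_eq_cut_sum[symmetric] 
    by (simp add: of_int_cut_value)
  also have "\<dots> = of_rat (of_int cut_sum)" by simp
  also have "of_int cut_sum = ((of_nat (card E) - 5) gchoose 3) - (\<Sum>P\<in>Ps. (of_nat (card P) - 3) gchoose 3)
      - (\<Sum>L\<in>Ls. ?g L * (of_nat (card E) - 2 / 3 * of_nat (card L) - 13 / 3))
      + (\<Sum>(L, P) | L \<in> Ls \<and> P \<in> Ps \<and> L \<subseteq> P. ?g L * (of_nat (card P) - 2 / 3 * of_nat (card L) - 7 / 3))"
  proof -
    have "of_int cut_sum = ((of_nat (card E) - 5) gchoose 3) - (\<Sum>P\<in>Ps. (of_nat (card P) - 3) gchoose 3)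
      + (\<Sum>L\<in>Ls. (\<Sum>P | P \<in> Ps \<and> L \<subseteq> P. ?g L * (of_nat (card P) - 2 / 3 * of_nat (card L) - 7 / 3))
      - ?g L * (of_nat (card E) - 2 / 3 * of_nat (card L) - 13 / 3))"
      unfolding cut_sum_eq ground by (simp only: line plane of_int_add of_int_diff of_int_sum cong: sum.cong)
    then show ?thesis unfolding pairs sum_subtractf by simp
  qed
  finally show ?thesis .
qed

end
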